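(* Let $\Phi,\Psi,\Xi$ be $\mathcal A$-localized frames in $\mathcal H$ satisfying $\Phi\sim_{\mathcal A}\Psi$ and $\Xi\sim_{\mathcal A}\Psi$. Let $w_1,w_2$ be $\mathcal A$-admissible weights and let $1\le p_1,p_2\le\infty$ or $p_1=p_2=0$. (i) If $O\in\mathcal B(\mathcal H^{p_1}_{w_1},\mathcal H^{p_2}_{w_2})$, then $\mathcal M_{(\Phi,\Xi)}(O)\in\mathcal B(\ell^{p_1}_{w_1},\ell^{p_2}_{w_2})$, with $$\|\mathcal M_{(\Phi,\Xi)}(O)\|_{\ell^{p_1}_{w_1}\to\ell^{p_2}_{w_2}}\le\|G_{\Phi,\Psi}\|_{\ell^{p_2}_{w_2}\to\ell^{p_2}_{w_2}}\,\|G_{\tilde\Psi,\Xi}\|_{\ell^{p_1}_{w_1}\to\ell^{p_1}_{w_1}}\,\|O\|_{\mathcal H^{p_1}_{w_1}\to\mathcal H^{p_2}_{w_2}},$$ and $\mathcal M_{(\Phi,\Xi)}(O)=C_\Phi\circ O\circ D_\Xi$. (ii) If $M\in\mathcal B(\ell^{p_1}_{w_1},\ell^{p_2}_{w_2})$ (induced by a matrix), then $\mathcal O_{(\Phi,\Xi)}(M)\in\mathcal B(\mathcal H^{p_1}_{w_1},\mathcal H^{p_2}_{w_2})$, $\mathcal O_{(\Phi,\Xi)}(M)=D_\Phi\circ M\circ C_\Xi$, and $$\|\mathcal O_{(\Phi,\Xi)}(M)\|_{\mathcal H^{p_1}_{w_1}\to\mathcal H^{p_2}_{w_2}}\le\|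G_{\tilde\Psi,\Phi}\|_{\ell^{p_2}_{w_2}\to\ell^{p_2}_{w_2}}\,\|G_{\Xi,\Psi}\|_{\ell^{p_1}_{w_1}\to\ell^{p_1}_{w_1}}\,\|M\|_{\ell^{p_1}_{w_1}\to\ell^{p_2}_{w_2}}.$$
   Context: $\mathcal H$ is a separable Hilbert space and $K\subseteq\mathbb R^d$ a countable separated index set; sequences and matrices are indexed by $K$. $\ell^{00}$ denotes the finitely supported sequences. A weight is a sequence $w=(w_k)$ with $w_k>0$; $\ell^p_w=\{c:(w_kc_k)\in\ell^p\}$ with $\|c\|_{\ell^p_w}=\|(w_kc_k)\|_{\ell^p}$; $\ell^0_w$ is the closure of $\ell^{00}$ in $\ell^\infty_w$. A frame $\Psi=(\psi_k)_{k\in K}$ satisfies $A\|f\|^2\le\sum_k|\langle f,\psi_k\rangle|^2\le B\|f\|^2$ for all $f\in\mathcal H$ with some $A,B>0$; $C_\Psi f=(\langle f,\psi_k\rangle)_k$, $D_\Psi c=\sum_kc_k\psi_k$, $S_\Psi=D_\Psi C_\Psi$; the canonical dual frame is $\tilde\Psi=(\tilde\psi_k)$, $\tilde\psi_k=S_\Psi^{-1}\psi_k$. Cross-Gram matrix: $(G_{\Psi,\Phi})_{k,l}=\langle\phi_l,\psi_k\rangle$, $G_\Psi=G_{\Psi,\Psi}$. $\mathcal A$ is a fixed solid spectral matrix algebra: a Banach $*$-algebra of matrices over $K$ such that (i) $\mathcal A\subseteq\mathcal B(\ell^2)$; (ii) $A\in\mathcal A$ invertible on $\ell^2$ implies $A^{-1}\in\mathcal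 A$; (iii) $A\in\mathcal A$ and $|b_{k,l}|\le|a_{k,l}|$ for all $k,l$ imply $B=(b_{k,l})\in\mathcal A$ and $\|B\|_{\mathcal A}\le\|A\|_{\mathcal A}$. Write $\Psi\sim_{\mathcal A}\Phi$ if $G_{\Psi,\Phi}\in\mathcal A$; $\Psi$ is $\mathcal A$-localized if $\Psi\sim_{\mathcal A}\Psi$ (it is known that then $\Psi\sim_{\mathcal A}\tilde\Psi$ and $\tilde\Psi\sim_{\mathcal A}\tilde\Psi$). A weight $w$ is $\mathcal A$-admissible if every $A\in\mathcal A$ defines a bounded operator on $\ell^p_w$ for all $1\le p\le\infty$ (then $1/w$ is admissible too). Coorbit spaces: $\mathcal H^{00}=\{\sum_kc_k\psi_k:c\in\ell^{00}\}$. For $1\le p<\infty$, $\mathcal H^p_w$ is the completion of $\mathcal H^{00}$ in the norm $\|f\|_{\mathcal H^p_w}=\|C_{\tilde\Psi}f\|_{\ell^p_w}$; $\mathcal H^0_w$ is the completion in $\|C_{\tilde\Psi}f\|_{\ell^\infty_w}$. $\mathcal H^\infty_w$ is the set of equivalence classes $f=[f_n]$ of sequences $f_n\in\mathcal H$ such that $\alpha_k=\lim_n\langle f_n,\tilde\psi_k\rangle$ exists for all $k$ and $\sup_n\|C_{\tilde\Psi}f_n\|_{\ell^\infty_w}<\infty$, where $(f_n)\sim(g_n)$ iff $\langle f_n-g_n,\tilde\psi_k\rangle\to0$ for all $k$; $C_{\tilde\Psi}f=\alpha$, $\|f\|_{\mathcal H^\infty_w}=\|\alpha\|_{\ell^\infty_w}$.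 Via coefficient sequences $C_{\tilde\Psi}f$, $\mathcal H^p_w\subseteq\mathcal H^\infty_w$. The pairing (for $1/p+1/q=1$ or $(p,q)=(0,1)$) is $\langle f,h\rangle_{\mathcal H^p_w,\mathcal H^q_{1/w}}=\sum_k(C_{\tilde\Psi}f)_k\overline{(C_\Psi h)_k}$, where $C_\Psi h=G_\Psi C_{\tilde\Psi}h$. Using $\Psi$ or any frame $\Phi\sim_{\mathcal A}\Psi$ gives the same spaces with equivalent norms; norms refer to $\Psi$. For such $\Phi$: $C_\Phi f=(\langle f,\phi_k\rangle)_k$ (pairing) on $\mathcal H^p_w$, and $D_\Phi c=\sum_kc_k\phi_k$ on $\ell^p_w$ (unconditionally convergent, weak-$*$, i.e. in $\sigma(\mathcal H^\infty_w,\mathcal H^1_{1/w})$, if $p=\infty$). Galerkin matrix of a bounded $O:\mathcal H^{p_1}_{w_1}\to\mathcal H^{p_2}_{w_2}$: $(\mathcal M_{(\Phi,\Xi)}(O))_{k,l}=\langle O\xi_l,\phi_k\rangle_{\mathcal H^{p_2}_{w_2},\mathcal H^{q_2}_{1/w_2}}=\langle O\xi_l,\phi_k\rangle_{\mathcal H^{\infty}_{w_2},\mathcal H^{1}_{1/w_2}}$. Operator of a matrix $M$ inducing (by matrix multiplication) a bounded operator $\ell^{p_1}_{w_1}\to\ell^{p_2}_{w_2}$: $\mathcal O_{(\Phi,\Xi)}(M)h=\sum_k\big(\sum_jM_{k,j}\langle h,\xi_j\rangle\big)\phi_k$ for $h\in\mathcal H^{p_1}_{w_1}$. $\mathcal B(X,Y)$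 denotes the bounded linear operators $X\to Y$.
   Formalization: The algebra 𝒜 is assumed to contain the identity matrix; for p1=∞ the identity M(O)=C_Φ∘O∘D_Ξ is claimed only on ℓ^0_{w1}, or on all of ℓ^∞_{w1} when O is weak-*-continuous, since a Banach limit times a fixed vector violates it otherwise. *)

theory Defs
  imports "HOL-Analysis.Analysis"
begin

section \<open>Complex Hilbert spaces\<close>

text \<open>The inner product is linear in its first argument.\<close>

class complex_hilbert = banach +
  fixes scaleC :: "complex \<Rightarrow> 'a \<Rightarrow> 'a" (infixr "*\<^sub>C" 75)
    and cinner :: "'a \<Rightarrow> 'a \<Rightarrow> complex"
  assumes scaleC_of_real: "complex_of_real r *\<^sub>C x = r *\<^sub>R x"
    and scaleC_add_right: "a *\<^sub>C (x + y) = a *\<^sub>C x + a *\<^sub>C y"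
    and scaleC_add_left: "(a + b) *\<^sub>C x = a *\<^sub>C x + b *\<^sub>C x"
    and scaleC_scaleC: "a *\<^sub>C b *\<^sub>C x = (a * b) *\<^sub>C x"
    and cinner_add_left: "cinner (x + y) z = cinner x z + cinner y z"
    and cinner_scaleC_left: "cinner (a *\<^sub>C x) y = a * cinner x y"
    and cinner_commute: "cinner x y = cnj (cinner y x)"
    and cinner_self: "cinner x x = complex_of_real ((norm x)\<^sup>2)"

instantiation complex :: complex_hilbert
begin

definition scaleC_complex :: "complex \<Rightarrow> complex \<Rightarrow> complex"
  where "scaleC_complex a x = a * x"

definition cinner_complex :: "complex \<Rightarrow> complex \<Rightarrow> complex"
  where "cinner_complex x y = x * cnj y"

instance
proof
  fix x :: complex
  show "cinner x x = complex_of_real ((norm x)\<^sup>2)"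
    unfolding cinner_complex_def by (rule complex_norm_square [symmetric])
qed (simp_all add: scaleC_complex_def cinner_complex_def algebra_simps scaleR_conv_of_real)

end

section \<open>Normed spaces with explicit carrier, and bounded operators\<close>

record 'x nspace =
  ns_carrier :: "'x set"
  ns_add :: "'x \<Rightarrow> 'x \<Rightarrow> 'x"
  ns_scale :: "complex \<Rightarrow> 'x \<Rightarrow> 'x"
  ns_norm :: "'x \<Rightarrow> real"

definition ns_diff :: "'x nspace \<Rightarrow> 'x \<Rightarrow> 'x \<Rightarrow> 'x" where
  "ns_diff X x y = ns_add X x (ns_scale X (-1) y)"

definition bounded_op :: "'x nspace \<Rightarrow> 'y nspace \<Rightarrow> ('x \<Rightarrow> 'y) \<Rightarrow> bool" where
  "bounded_op X Y T \<longleftrightarrow>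
     (\<forall>x\<in>ns_carrier X. T x \<in> ns_carrier Y) \<and>
     (\<forall>x\<in>ns_carrier X. \<forall>y\<in>ns_carrier X. T (ns_add X x y) = ns_add Y (T x) (T y)) \<and>
     (\<forall>a. \<forall>x\<in>ns_carrier X. T (ns_scale X a x) = ns_scale Y a (T x)) \<and>
     (\<exists>C. \<forall>x\<in>ns_carrier X. ns_norm Y (T x) \<le> C * ns_norm X x)"

definition op_norm :: "'x nspace \<Rightarrow> 'y nspace \<Rightarrow> ('x \<Rightarrow> 'y) \<Rightarrow> real" where
  "op_norm X Y T = Sup {ns_norm Y (T x) | x. x \<in> ns_carrier X \<and> ns_norm X x \<le> 1}"

section \<open>Weighted sequence spaces\<close>

text \<open>Sequences over \<open>K\<close> are functions on the ambient type that vanish outside \<open>K\<close>.\<close>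

type_synonym 'i mat = "'i \<Rightarrow> 'i \<Rightarrow> complex"

definition separated :: "'i::metric_space set \<Rightarrow> bool" where
  "separated K \<longleftrightarrow> (\<exists>\<delta>>0. \<forall>x\<in>K. \<forall>y\<in>K. x \<noteq> y \<longrightarrow> \<delta> \<le> dist x y)"

definition weight :: "'i set \<Rightarrow> ('i \<Rightarrow> real) \<Rightarrow> bool" where
  "weight K w \<longleftrightarrow> (\<forall>k\<in>K. 0 < w k)"

definition inv_weight :: "('i \<Rightarrow> real) \<Rightarrow> 'i \<Rightarrow> real" where
  "inv_weight w = (\<lambda>k. 1 / w k)"

definition seqs :: "'i set \<Rightarrow> ('i \<Rightarrow> complex) set" where
  "seqs K = {c. \<forall>k. k \<notin> K \<longrightarrow> c k = 0}"

definition fin_seqs :: "'i set \<Rightarrow> ('i \<Rightarrow> complex) set" where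
  "fin_seqs K = {c \<in> seqs K. finite {k. c k \<noteq> 0}}"

text \<open>The inserted \<open>0\<close> only matters for empty \<open>K\<close>.\<close>

definition wsup :: "'i set \<Rightarrow> ('i \<Rightarrow> real) \<Rightarrow> ('i \<Rightarrow> complex) \<Rightarrow> real" where
  "wsup K w c = Sup (insert 0 ((\<lambda>k. w k * cmod (c k)) ` K))"

definition linf_set :: "'i set \<Rightarrow> ('i \<Rightarrow> real) \<Rightarrow> ('i \<Rightarrow> complex) set" where
  "linf_set K w = {c \<in> seqs K. bdd_above ((\<lambda>k. w k * cmod (c k)) ` K)}"

definition lp_set :: "'i set \<Rightarrow> ereal \<Rightarrow> ('i \<Rightarrow> real) \<Rightarrow> ('i \<Rightarrow> complex) set" where
  "lp_set K p w =
     (if p = \<infinity> then linf_set K w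
      else if p = 0 then
        {c \<in> linf_set K w. \<forall>e>0. \<exists>d\<in>fin_seqs K. wsup K w (\<lambda>k. c k - d k) < e}
      else {c \<in> seqs K. (\<lambda>k. (w k * cmod (c k)) powr real_of_ereal p) summable_on K})"

definition lp_norm :: "'i set \<Rightarrow> ereal \<Rightarrow> ('i \<Rightarrow> real) \<Rightarrow> ('i \<Rightarrow> complex) \<Rightarrow> real" where
  "lp_norm K p w c =
     (if p = \<infinity> \<or> p = 0 then wsup K w c
      else (\<Sum>\<^sub>\<infinity>k\<in>K. (w k * cmod (c k)) powr real_of_ereal p) powr (1 / real_of_ereal p))"

definition lp :: "'i set \<Rightarrow> ereal \<Rightarrow> ('i \<Rightarrow> real) \<Rightarrow> ('i \<Rightarrow> complex) nspace" where
  "lp K p w = \<lparr>ns_carrier = lp_set K p w, ns_add = (\<lambda>c d k. c k + d k),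
     ns_scale = (\<lambda>a c k. a * c k), ns_norm = lp_norm K p w\<rparr>"

section \<open>Matrices and solid spectral matrix algebras\<close>

definition mats :: "'i set \<Rightarrow> 'i mat set" where
  "mats K = {A. \<forall>k l. k \<notin> K \<or> l \<notin> K \<longrightarrow> A k l = 0}"

definition mat_app :: "'i set \<Rightarrow> 'i mat \<Rightarrow> ('i \<Rightarrow> complex) \<Rightarrow> 'i \<Rightarrow> complex" where
  "mat_app K A c = (\<lambda>k. if k \<in> K then \<Sum>\<^sub>\<infinity>l\<in>K. A k l * c l else 0)"

definition mat_mult :: "'i set \<Rightarrow> 'i mat \<Rightarrow> 'i mat \<Rightarrow> 'i mat" where
  "mat_mult K A B = (\<lambda>k l. if k \<in> K \<and> l \<in> K then \<Sum>\<^sub>\<infinity>j\<in>K. A k j * B j l else 0)"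

definition mat_adj :: "'i mat \<Rightarrow> 'i mat" where
  "mat_adj A = (\<lambda>k l. cnj (A l k))"

definition mat_id :: "'i set \<Rightarrow> 'i mat" where
  "mat_id K = (\<lambda>k l. if k \<in> K \<and> k = l then 1 else 0)"

text \<open>Since \<open>infsum\<close> is total, convergence of the matrix-vector products has to be required
  separately.\<close>

definition mat_bounded ::
    "'i set \<Rightarrow> ereal \<Rightarrow> ('i \<Rightarrow> real) \<Rightarrow> ereal \<Rightarrow> ('i \<Rightarrow> real) \<Rightarrow> 'i mat \<Rightarrow> bool" where
  "mat_bounded K p1 w1 p2 w2 A \<longleftrightarrow>
     (\<forall>c\<in>lp_set K p1 w1. \<forall>k\<in>K. (\<lambda>l. A k l * c l) summable_on K) \<and>
     bounded_op (lp K p1 w1) (lp K p2 w2) (mat_app K A)"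

abbreviation l2_set :: "'i set \<Rightarrow> ('i \<Rightarrow> complex) set" where
  "l2_set K \<equiv> lp_set K 2 (\<lambda>_. 1)"

abbreviation l2_bounded :: "'i set \<Rightarrow> 'i mat \<Rightarrow> bool" where
  "l2_bounded K A \<equiv> mat_bounded K 2 (\<lambda>_. 1) 2 (\<lambda>_. 1) A"

text \<open>The identity matrix is required to belong to the algebra: inverse-closedness in the bounded
  operators on \<open>\<ell>\<^sup>2\<close> refers to a common unit.\<close>

definition banach_star_matrix_algebra :: "'i set \<Rightarrow> 'i mat set \<Rightarrow> ('i mat \<Rightarrow> real) \<Rightarrow> bool" where
  "banach_star_matrix_algebra K \<A> N \<longleftrightarrow>
     \<A> \<subseteq> mats K \<and> mat_id K \<in> \<A> \<and>
     (\<forall>A\<in>\<A>. \<forall>B\<in>\<A>. (\<lambda>k l. A k l + B k l) \<in> \<A> \<and> N (\<lambda>k l. A k l + B k l) \<le> N A + N B) \<and>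
     (\<forall>a. \<forall>A\<in>\<A>. (\<lambda>k l. a * A k l) \<in> \<A> \<and> N (\<lambda>k l. a * A k l) = cmod a * N A) \<and>
     (\<forall>A\<in>\<A>. 0 \<le> N A \<and> (N A = 0 \<longleftrightarrow> A = (\<lambda>k l. 0))) \<and>
     (\<forall>A\<in>\<A>. \<forall>B\<in>\<A>. mat_mult K A B \<in> \<A> \<and> N (mat_mult K A B) \<le> N A * N B) \<and>
     (\<forall>A\<in>\<A>. mat_adj A \<in> \<A> \<and> N (mat_adj A) = N A) \<and>
     (\<forall>X::nat \<Rightarrow> 'i mat. (\<forall>n. X n \<in> \<A>) \<and>
        (\<forall>e>0. \<exists>n0. \<forall>m\<ge>n0. \<forall>n\<ge>n0. N (\<lambda>k l. X m k l - X n k l) < e) \<longrightarrow>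
        (\<exists>A\<in>\<A>. (\<lambda>n. N (\<lambda>k l. X n k l - A k l)) \<longlonglongrightarrow> 0))"

definition solid_spectral_algebra :: "'i set \<Rightarrow> 'i mat set \<Rightarrow> ('i mat \<Rightarrow> real) \<Rightarrow> bool" where
  "solid_spectral_algebra K \<A> N \<longleftrightarrow>
     banach_star_matrix_algebra K \<A> N \<and>
     (\<forall>A\<in>\<A>. l2_bounded K A) \<and>
     (\<forall>A\<in>\<A>. \<forall>B\<in>mats K. l2_bounded K B \<and>
        (\<forall>c\<in>l2_set K. mat_app K A (mat_app K B c) = c \<and> mat_app K B (mat_app K A c) = c) \<longrightarrow>
        B \<in> \<A>) \<and>
     (\<forall>A\<in>\<A>. \<forall>B\<in>mats K. (\<forall>k l. cmod (B k l) \<le> cmod (A k l)) \<longrightarrow> B \<in> \<A> \<and> N B \<le> N A)"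

definition admissible :: "'i set \<Rightarrow> 'i mat set \<Rightarrow> ('i \<Rightarrow> real) \<Rightarrow> bool" where
  "admissible K \<A> w \<longleftrightarrow> weight K w \<and> (\<forall>A\<in>\<A>. \<forall>p\<ge>1. mat_bounded K p w p w A)"

section \<open>Frames\<close>

definition separable_type :: "'h::topological_space itself \<Rightarrow> bool" where
  "separable_type _ \<longleftrightarrow> (\<exists>D::'h set. countable D \<and> closure D = UNIV)"

definition frame :: "'i set \<Rightarrow> ('i \<Rightarrow> 'h::complex_hilbert) \<Rightarrow> bool" where
  "frame K \<Psi> \<longleftrightarrow> (\<exists>A>0. \<exists>B>0. \<forall>f.
     (\<lambda>k. (cmod (cinner f (\<Psi> k)))\<^sup>2) summable_on K \<and>
     A * (norm f)\<^sup>2 \<le> (\<Sum>\<^sub>\<infinity>k\<in>K. (cmod (cinner f (\<Psi> k)))\<^sup>2) \<and>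
     (\<Sum>\<^sub>\<infinity>k\<in>K. (cmod (cinner f (\<Psi> k)))\<^sup>2) \<le> B * (norm f)\<^sup>2)"

definition analysis :: "'i set \<Rightarrow> ('i \<Rightarrow> 'h::complex_hilbert) \<Rightarrow> 'h \<Rightarrow> 'i \<Rightarrow> complex" where
  "analysis K \<Psi> f = (\<lambda>k. if k \<in> K then cinner f (\<Psi> k) else 0)"

definition synthesis :: "'i set \<Rightarrow> ('i \<Rightarrow> 'h::complex_hilbert) \<Rightarrow> ('i \<Rightarrow> complex) \<Rightarrow> 'h" where
  "synthesis K \<Psi> c = (\<Sum>\<^sub>\<infinity>k\<in>K. c k *\<^sub>C \<Psi> k)"

definition frame_op :: "'i set \<Rightarrow> ('i \<Rightarrow> 'h::complex_hilbert) \<Rightarrow> 'h \<Rightarrow> 'h" where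
  "frame_op K \<Psi> f = synthesis K \<Psi> (analysis K \<Psi> f)"

definition dual_frame :: "'i set \<Rightarrow> ('i \<Rightarrow> 'h::complex_hilbert) \<Rightarrow> 'i \<Rightarrow> 'h" where
  "dual_frame K \<Psi> k = inv (frame_op K \<Psi>) (\<Psi> k)"

definition gram :: "'i set \<Rightarrow> ('i \<Rightarrow> 'h::complex_hilbert) \<Rightarrow> ('i \<Rightarrow> 'h) \<Rightarrow> 'i mat" where
  "gram K \<Psi> \<Phi> = (\<lambda>k l. if k \<in> K \<and> l \<in> K then cinner (\<Phi> l) (\<Psi> k) else 0)"

definition localized_wrt ::
    "'i set \<Rightarrow> 'i mat set \<Rightarrow> ('i \<Rightarrow> 'h::complex_hilbert) \<Rightarrow> ('i \<Rightarrow> 'h) \<Rightarrow> bool" where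
  "localized_wrt K \<A> \<Psi> \<Phi> \<longleftrightarrow> gram K \<Psi> \<Phi> \<in> \<A>"

definition localized :: "'i set \<Rightarrow> 'i mat set \<Rightarrow> ('i \<Rightarrow> 'h::complex_hilbert) \<Rightarrow> bool" where
  "localized K \<A> \<Psi> \<longleftrightarrow> localized_wrt K \<A> \<Psi> \<Psi>"

section \<open>Coorbit spaces\<close>

definition coorbit_seqs ::
    "'i set \<Rightarrow> ('i \<Rightarrow> 'h::complex_hilbert) \<Rightarrow> ('i \<Rightarrow> real) \<Rightarrow> (nat \<Rightarrow> 'h) set" where
  "coorbit_seqs K \<Psi> w =
     {f. (\<forall>k\<in>K. convergent (\<lambda>n. cinner (f n) (dual_frame K \<Psi> k))) \<and>
         (\<forall>n. analysis K (dual_frame K \<Psi>) (f n) \<in> linf_set K w) \<and>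
         bdd_above (range (\<lambda>n. lp_norm K \<infinity> w (analysis K (dual_frame K \<Psi>) (f n))))}"

definition coorbit_rel ::
    "'i set \<Rightarrow> ('i \<Rightarrow> 'h::complex_hilbert) \<Rightarrow> ('i \<Rightarrow> real) \<Rightarrow> ((nat \<Rightarrow> 'h) \<times> (nat \<Rightarrow> 'h)) set" where
  "coorbit_rel K \<Psi> w =
     {(f, g). f \<in> coorbit_seqs K \<Psi> w \<and> g \<in> coorbit_seqs K \<Psi> w \<and>
        (\<forall>k\<in>K. (\<lambda>n. cinner (f n - g n) (dual_frame K \<Psi> k)) \<longlonglongrightarrow> 0)}"

text \<open>All coorbit spaces consist of equivalence classes of sequences in the Hilbert space.
  An element of the Hilbert space becomes the class of its constant sequence.\<close>

type_synonym 'h coorb = "(nat \<Rightarrow> 'h) set"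

definition coorbit_inf :: "'i set \<Rightarrow> ('i \<Rightarrow> 'h::complex_hilbert) \<Rightarrow> ('i \<Rightarrow> real) \<Rightarrow> 'h coorb set" where
  "coorbit_inf K \<Psi> w = coorbit_seqs K \<Psi> w // coorbit_rel K \<Psi> w"

definition emb :: "'i set \<Rightarrow> ('i \<Rightarrow> 'h::complex_hilbert) \<Rightarrow> ('i \<Rightarrow> real) \<Rightarrow> 'h \<Rightarrow> 'h coorb" where
  "emb K \<Psi> w f = coorbit_rel K \<Psi> w `` {\<lambda>_. f}"

definition coorbit_add ::
    "'i set \<Rightarrow> ('i \<Rightarrow> 'h::complex_hilbert) \<Rightarrow> ('i \<Rightarrow> real) \<Rightarrow> 'h coorb \<Rightarrow> 'h coorb \<Rightarrow> 'h coorb" where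
  "coorbit_add K \<Psi> w X Y = (\<Union>f\<in>X. \<Union>g\<in>Y. coorbit_rel K \<Psi> w `` {\<lambda>n. f n + g n})"

definition coorbit_scale ::
    "'i set \<Rightarrow> ('i \<Rightarrow> 'h::complex_hilbert) \<Rightarrow> ('i \<Rightarrow> real) \<Rightarrow> complex \<Rightarrow> 'h coorb \<Rightarrow> 'h coorb" where
  "coorbit_scale K \<Psi> w a X = (\<Union>f\<in>X. coorbit_rel K \<Psi> w `` {\<lambda>n. a *\<^sub>C f n})"

text \<open>The coefficients of a class with respect to the canonical dual of \<open>\<Psi>\<close>.\<close>

definition coef :: "'i set \<Rightarrow> ('i \<Rightarrow> 'h::complex_hilbert) \<Rightarrow> 'h coorb \<Rightarrow> 'i \<Rightarrow> complex" where
  "coef K \<Psi> X =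
     (\<lambda>k. if k \<in> K then lim (\<lambda>n. cinner ((SOME f. f \<in> X) n) (dual_frame K \<Psi> k)) else 0)"

definition coorbit_fin :: "'i set \<Rightarrow> ('i \<Rightarrow> 'h::complex_hilbert) \<Rightarrow> 'h set" where
  "coorbit_fin K \<Psi> = {\<Sum>k | c k \<noteq> 0. c k *\<^sub>C \<Psi> k | c. c \<in> fin_seqs K}"

text \<open>For \<open>p \<noteq> \<infinity>\<close> the completion of \<open>coorbit_fin\<close> is realized inside the space with
  \<open>p = \<infinity>\<close>, by means of coefficient sequences: a Cauchy sequence in \<open>coorbit_fin\<close> converges
  coefficientwise and so represents a class. For \<open>p = 0\<close> the norm is that of \<open>p = \<infinity>\<close>. The
  membership condition guards against the totality of \<open>lp_norm\<close>.\<close>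

definition coorbit_set ::
    "'i set \<Rightarrow> ('i \<Rightarrow> 'h::complex_hilbert) \<Rightarrow> ereal \<Rightarrow> ('i \<Rightarrow> real) \<Rightarrow> 'h coorb set" where
  "coorbit_set K \<Psi> p w =
     (if p = \<infinity> then coorbit_inf K \<Psi> w
      else {X \<in> coorbit_inf K \<Psi> w. \<exists>g::nat \<Rightarrow> 'h.
        let r = (if p = 0 then \<infinity> else p);
            d = (\<lambda>n k. coef K \<Psi> X k - analysis K (dual_frame K \<Psi>) (g n) k) in
        (\<forall>n. g n \<in> coorbit_fin K \<Psi> \<and> d n \<in> lp_set K r w) \<and>
        (\<lambda>n. lp_norm K r w (d n)) \<longlonglongrightarrow> 0})"

definition coorbit ::
    "'i set \<Rightarrow> ('i \<Rightarrow> 'h::complex_hilbert) \<Rightarrow> ereal \<Rightarrow> ('i \<Rightarrow> real) \<Rightarrow> 'h coorb nspace" where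
  "coorbit K \<Psi> p w =
     \<lparr>ns_carrier = coorbit_set K \<Psi> p w,
      ns_add = coorbit_add K \<Psi> w,
      ns_scale = coorbit_scale K \<Psi> w,
      ns_norm = (\<lambda>X. lp_norm K p w (coef K \<Psi> X))\<rparr>"

text \<open>The pairing of \<open>X\<close> in a space with weight \<open>w\<close> and \<open>Y\<close> in a space with weight \<open>1/w\<close>;
  the formula is the same for all pairs of exponents.\<close>

definition pairing :: "'i set \<Rightarrow> ('i \<Rightarrow> 'h::complex_hilbert) \<Rightarrow> 'h coorb \<Rightarrow> 'h coorb \<Rightarrow> complex" where
  "pairing K \<Psi> X Y =
     (\<Sum>\<^sub>\<infinity>k\<in>K. coef K \<Psi> X k * cnj (mat_app K (gram K \<Psi> \<Psi>) (coef K \<Psi> Y) k))"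

definition coorbit_analysis ::
    "'i set \<Rightarrow> ('i \<Rightarrow> 'h::complex_hilbert) \<Rightarrow> ('i \<Rightarrow> real) \<Rightarrow> ('i \<Rightarrow> 'h) \<Rightarrow> 'h coorb \<Rightarrow> 'i \<Rightarrow> complex" where
  "coorbit_analysis K \<Psi> w \<Phi> X =
     (\<lambda>k. if k \<in> K then pairing K \<Psi> X (emb K \<Psi> (inv_weight w) (\<Phi> k)) else 0)"

text \<open>Unconditional convergence of \<open>\<Sum>k\<in>K. x k\<close> to \<open>X\<close>: in norm for \<open>p \<noteq> \<infinity>\<close>, and weak-* for
  \<open>p = \<infinity>\<close>.\<close>

definition coorbit_sums ::
    "'i set \<Rightarrow> ('i \<Rightarrow> 'h::complex_hilbert) \<Rightarrow> ereal \<Rightarrow> ('i \<Rightarrow> real) \<Rightarrow> ('i \<Rightarrow> 'h) \<Rightarrow> 'h coorb \<Rightarrow> bool" where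
  "coorbit_sums K \<Psi> p w x X \<longleftrightarrow>
     X \<in> coorbit_set K \<Psi> p w \<and>
     (\<forall>F. finite F \<and> F \<subseteq> K \<longrightarrow> emb K \<Psi> w (sum x F) \<in> coorbit_set K \<Psi> p w) \<and>
     (if p = \<infinity> then
        \<forall>Y\<in>coorbit_set K \<Psi> 1 (inv_weight w).
          ((\<lambda>F. pairing K \<Psi> (emb K \<Psi> w (sum x F)) Y) \<longlongrightarrow> pairing K \<Psi> X Y)
            (finite_subsets_at_top K)
      else
        ((\<lambda>F. ns_norm (coorbit K \<Psi> p w) (ns_diff (coorbit K \<Psi> p w) (emb K \<Psi> w (sum x F)) X))
          \<longlongrightarrow> 0) (finite_subsets_at_top K))"

definition coorbit_synthesis ::
    "'i set \<Rightarrow> ('i \<Rightarrow> 'h::complex_hilbert) \<Rightarrow> ereal \<Rightarrow> ('i \<Rightarrow> real) \<Rightarrow> ('i \<Rightarrow> 'h) \<Rightarrow>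
     ('i \<Rightarrow> complex) \<Rightarrow> 'h coorb" where
  "coorbit_synthesis K \<Psi> p w \<Phi> c = (THE X. coorbit_sums K \<Psi> p w (\<lambda>k. c k *\<^sub>C \<Phi> k) X)"

text \<open>The weak-* topology on \<open>H\<^sup>\<infinity>\<close> with weight \<open>w\<close> induced by the pairing with \<open>H\<^sup>1\<close> with
  weight \<open>1/w\<close>. An operator on \<open>H\<^sup>\<infinity>\<close> is determined by its Galerkin matrix only if it is
  continuous in this sense: for an orthonormal basis, a Banach limit times a fixed vector has
  Galerkin matrix \<open>0\<close>.\<close>

definition weak_star_topology ::
    "'i set \<Rightarrow> ('i \<Rightarrow> 'h::complex_hilbert) \<Rightarrow> ('i \<Rightarrow> real) \<Rightarrow> 'h coorb topology" where
  "weak_star_topology K \<Psi> w =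
     pullback_topology (coorbit_set K \<Psi> \<infinity> w)
       (\<lambda>X. restrict (pairing K \<Psi> X) (coorbit_set K \<Psi> 1 (inv_weight w)))
       (product_topology (\<lambda>_. euclidean) (coorbit_set K \<Psi> 1 (inv_weight w)))"

section \<open>Galerkin matrices and the operator of a matrix\<close>

definition galerkin ::
    "'i set \<Rightarrow> ('i \<Rightarrow> 'h::complex_hilbert) \<Rightarrow> ('i \<Rightarrow> real) \<Rightarrow> ('i \<Rightarrow> real) \<Rightarrow> ('i \<Rightarrow> 'h) \<Rightarrow> ('i \<Rightarrow> 'h) \<Rightarrow>
     ('h coorb \<Rightarrow> 'h coorb) \<Rightarrow> 'i mat" where
  "galerkin K \<Psi> w1 w2 \<Phi> \<Xi> T =
     (\<lambda>k l. if k \<in> K \<and> l \<in> K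
        then pairing K \<Psi> (T (emb K \<Psi> w1 (\<Xi> l))) (emb K \<Psi> (inv_weight w2) (\<Phi> k)) else 0)"

definition matrix_op_terms ::
    "'i set \<Rightarrow> ('i \<Rightarrow> 'h::complex_hilbert) \<Rightarrow> ('i \<Rightarrow> real) \<Rightarrow> ('i \<Rightarrow> 'h) \<Rightarrow> ('i \<Rightarrow> 'h) \<Rightarrow> 'i mat \<Rightarrow>
     'h coorb \<Rightarrow> 'i \<Rightarrow> 'h" where
  "matrix_op_terms K \<Psi> w1 \<Phi> \<Xi> M X =
     (\<lambda>k. (\<Sum>\<^sub>\<infinity>j\<in>K. M k j * pairing K \<Psi> X (emb K \<Psi> (inv_weight w1) (\<Xi> j))) *\<^sub>C \<Phi> k)"

definition matrix_op ::
    "'i set \<Rightarrow> ('i \<Rightarrow> 'h::complex_hilbert) \<Rightarrow> ('i \<Rightarrow> real) \<Rightarrow> ereal \<Rightarrow> ('i \<Rightarrow> real) \<Rightarrow>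
     ('i \<Rightarrow> 'h) \<Rightarrow> ('i \<Rightarrow> 'h) \<Rightarrow> 'i mat \<Rightarrow> 'h coorb \<Rightarrow> 'h coorb" where
  "matrix_op K \<Psi> w1 p2 w2 \<Phi> \<Xi> M X =
     (THE Y. coorbit_sums K \<Psi> p2 w2 (matrix_op_terms K \<Psi> w1 \<Phi> \<Xi> M X) Y)"

end

theory Submission
  imports Defs
begin

text \<open>Write \<open>G\<close> for Gram matrices and \<open>d\<close> for the canonical dual of \<open>\<Psi>\<close>. Taking coefficients with respect
  to \<open>d\<close> identifies the coorbit space with parameters \<open>p, w\<close> isometrically with the range of the
  projection \<open>P = G(d, \<Psi>)\<close> in the weighted \<open>\<ell>\<^sup>p\<close>. Under this identification analysis with \<open>\<Phi>\<close> is the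
  matrix \<open>G(\<Phi>, \<Psi>)\<close> and synthesis with \<open>\<Xi>\<close> is \<open>G(d, \<Xi>)\<close>, so both estimates are norms of a product of
  three bounded maps, once these matrices are known to lie in the algebra. The main point is \<open>P\<close>: the
  spectrum of \<open>G(\<Psi>, \<Psi>)\<close> is contained in \<open>{0} \<union> [A, B]\<close>, the resolvent on a circle that separates the two
  parts lies in the algebra by inverse-closedness, and \<open>P\<close> is the limit, in the norm of the algebra, of
  the Riemann sums of its Cauchy integral. For \<open>p\<^sub>1 = \<infinity>\<close> finite sequences are not dense, and the bound on
  the Galerkin matrix passes from finite sequences to all sequences by Fatou's lemma.\<close>

section \<open>Complex Hilbert spaces\<close>

text \<open>Inverse-closedness says nothing about the Gram matrix of \<Psi> itself, which for a
  redundant frame has a kernel on the square-summable sequences. Adding 1 - P fills that kernel, so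
  P has to be placed in the algebra before the Gram matrix can be inverted on its range. Equally
  spaced nodes on the circle make the Riemann sums computable as geometric sums, and since solidity
  makes every entry a continuous functional, the limit is identified entry by entry.

  The other obstacle is associativity of infinite matrix products: boundedness on a space does not
  by itself allow sums to be interchanged, but weighted absolute row and column bounds do. They act
  on the weighted sup space, which contains all the other sequence spaces, so a matrix identity is
  checked there once. They also survive the passage from \<open>w\<close> to \<open>1/w\<close> and
  so provide the test elements of every pairing.

  A bounded operator with \<open>p1 = \<infinity>\<close> is not determined by its Galerkin matrix.
  The factorization is therefore asserted there for sequences in the closure of the finite ones, or
  for weak-* continuous operators.\<close>

lemma cinner_add_right: "cinner x (y + z) = cinner x y + cinner x z"
  by (metis cinner_add_left cinner_commute complex_cnj_add)

lemma cinner_scaleC_right: "cinner x (a *\<^sub>C y) = cnj a * cinner x y"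
  by (metis cinner_scaleC_left cinner_commute complex_cnj_mult)

lemma cinner_scaleR_left: "cinner (r *\<^sub>R x) y = of_real r * cinner x y"
  by (metis scaleC_of_real cinner_scaleC_left)

lemma scaleC_one [simp]: "1 *\<^sub>C x = x"
  by (metis of_real_1 scaleC_of_real scaleR_one)

lemma scaleC_zero_left [simp]: "0 *\<^sub>C x = 0"
  by (metis of_real_0 scaleC_of_real scaleR_zero_left)

lemma additive_cinner_left: "Modules.additive (\<lambda>x. cinner x y)"
  by standard (rule cinner_add_left)

lemma additive_cinner_right: "Modules.additive (cinner x)"
  by standard (rule cinner_add_right)

lemma additive_scaleC: "Modules.additive (scaleC a)"
  by standard (rule scaleC_add_right)

lemma additive_scaleC_left: "Modules.additive (\<lambda>a. a *\<^sub>C x)"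
  by standard (rule scaleC_add_left)

lemmas cinner_zero_left [simp] = additive.zero [OF additive_cinner_left]
lemmas cinner_diff_left = additive.diff [OF additive_cinner_left]
lemmas cinner_sum_left = additive.sum [OF additive_cinner_left]
lemmas cinner_zero_right [simp] = additive.zero [OF additive_cinner_right]
lemmas scaleC_zero_right [simp] = additive.zero [OF additive_scaleC]
lemmas scaleC_diff_right = additive.diff [OF additive_scaleC]
lemmas scaleC_diff_left = additive.diff [OF additive_scaleC_left]
lemmas scaleC_sum_left = additive.sum [OF additive_scaleC_left]
lemmas scaleC_sum_right = additive.sum [OF additive_scaleC]

lemma norm_sq_conv_cinner: "(norm x)\<^sup>2 = Re (cinner x x)"
  by (simp add: cinner_self)

lemma norm_scaleC: "norm (a *\<^sub>C x) = cmod a * norm x"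
proof -
  have "complex_of_real ((norm (a *\<^sub>C x))\<^sup>2) = a * cnj a * cinner x x"
    by (subst cinner_self [symmetric]) (simp add: cinner_scaleC_left cinner_scaleC_right mult_ac)
  also have "\<dots> = complex_of_real ((cmod a * norm x)\<^sup>2)"
    by (simp add: cinner_self power_mult_distrib complex_norm_square [symmetric])
  finally show ?thesis
    by (simp only: of_real_eq_iff) (simp add: power2_eq_iff_nonneg)
qed

lemma norm_add_sq: "(norm (x + y))\<^sup>2 = (norm x)\<^sup>2 + 2 * Re (cinner x y) + (norm y)\<^sup>2"
proof -
  have "cinner y x = cnj (cinner x y)"
    by (rule cinner_commute)
  then show ?thesis
    by (simp add: norm_sq_conv_cinner cinner_add_left cinner_add_right)
qed

lemma cauchy_schwarz: "cmod (cinner x y) \<le> norm x * norm y"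
proof (cases "y = 0")
  case False
  \<comment> \<open>With this \<open>a\<close> the vector \<open>x + a *\<^sub>C y\<close> is the
    component of \<open>x\<close> orthogonal to \<open>y\<close>; that its squared norm is
    nonnegative is the inequality.\<close>
  define a where "a = - cinner x y / of_real ((norm y)\<^sup>2)"
  have "0 \<le> (norm (x + a *\<^sub>C y))\<^sup>2"
    by simp
  also have "\<dots> = (norm x)\<^sup>2 + 2 * Re (cnj a * cinner x y) + (cmod a * norm y)\<^sup>2"
    by (simp add: norm_add_sq cinner_scaleC_right norm_scaleC)
  also have "cnj a * cinner x y = - of_real ((cmod (cinner x y))\<^sup>2 / (norm y)\<^sup>2)"
    by (simp add: a_def mult.commute flip: complex_norm_square)
  also have "(cmod a * norm y)\<^sup>2 = (cmod (cinner x y))\<^sup>2 / (norm y)\<^sup>2"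
    using False by (simp add: a_def norm_divide norm_power norm_mult field_simps power2_eq_square)
  finally have "(cmod (cinner x y))\<^sup>2 / (norm y)\<^sup>2 \<le> (norm x)\<^sup>2"
    by simp
  then have "(cmod (cinner x y))\<^sup>2 \<le> (norm x * norm y)\<^sup>2"
    using False by (simp add: field_simps power_mult_distrib)
  then show ?thesis
    by (rule power2_le_imp_le) simp
qed simp

lemma bounded_linear_cinner_left: "bounded_linear (\<lambda>x. cinner x y)"
  by (rule bounded_linear_intro [where K = "norm y"])
     (simp_all add: cinner_add_left cinner_scaleR_left scaleR_conv_of_real cauchy_schwarz)

lemma bounded_linear_scaleC: "bounded_linear (scaleC a)"
proof (rule bounded_linear_intro [where K = "cmod a"])
  show "a *\<^sub>C r *\<^sub>R x = r *\<^sub>R a *\<^sub>C x" for r and x :: 'a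
    by (metis mult.commute scaleC_of_real scaleC_scaleC)
qed (simp_all add: scaleC_add_right norm_scaleC mult.commute)

section \<open>Bounded complex-linear maps\<close>

definition clinear_bdd :: "('a::complex_hilbert \<Rightarrow> 'b::complex_hilbert) \<Rightarrow> bool" where
  "clinear_bdd U \<longleftrightarrow> bounded_linear U \<and> (\<forall>a x. U (a *\<^sub>C x) = a *\<^sub>C U x)"

lemma clinear_bddD:
  assumes "clinear_bdd U"
  shows "bounded_linear U" "U (x + y) = U x + U y" "U (x - y) = U x - U y"
    "U (a *\<^sub>C x) = a *\<^sub>C U x" "U 0 = 0" "U (sum f F) = (\<Sum>k\<in>F. U (f k))"
  using assms unfolding clinear_bdd_def
  by (auto simp: linear_add linear_diff linear_0 linear_sum bounded_linear.linear)

lemma clinear_bddI: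
  assumes "\<And>x y. U (x + y) = U x + U y" and a: "\<And>a x. U (a *\<^sub>C x) = a *\<^sub>C U x"
    and "\<And>x. norm (U x) \<le> B * norm x"
  shows "clinear_bdd U"
  unfolding clinear_bdd_def
proof (intro conjI allI a bounded_linear_intro)
  show "U (r *\<^sub>R x) = r *\<^sub>R U x" for r x
    by (metis a scaleC_of_real)
  show "norm (U x) \<le> norm x * B" for x
    using assms(3) [of x] by (simp add: mult.commute)
qed fact

lemma clinear_bdd_compose:
  assumes "clinear_bdd U" "clinear_bdd V"
  shows "clinear_bdd (\<lambda>x. U (V x))"
  using assms unfolding clinear_bdd_def by (auto intro: bounded_linear_compose)

lemma clinear_bdd_id: "clinear_bdd (\<lambda>x. x)"
  by (rule clinear_bddI [where B = 1]) auto

lemma clinear_bdd_scaleC: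
  assumes "clinear_bdd U"
  shows "clinear_bdd (\<lambda>x. a *\<^sub>C U x)"
  using assms bounded_linear_compose [OF bounded_linear_scaleC, of U a]
  unfolding clinear_bdd_def by (auto simp: scaleC_scaleC mult.commute)

lemma clinear_bdd_diff:
  assumes "clinear_bdd U" "clinear_bdd V"
  shows "clinear_bdd (\<lambda>x. U x - V x)"
  using assms unfolding clinear_bdd_def by (auto intro: bounded_linear_sub simp: scaleC_diff_right)

subsection \<open>Neumann inverse\<close>

text \<open>This is (1 - U)^{-1}. As a total function of \<open>U\<close> it lets resolvents with
  varying parameters be written down before the contraction condition is checked.\<close>

definition neumann_inv :: "('a::complex_hilbert \<Rightarrow> 'a) \<Rightarrow> 'a \<Rightarrow> 'a" where
  "neumann_inv U g = (THE h. h - U h = g)"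

locale strict_contraction =
  fixes U :: "'a::complex_hilbert \<Rightarrow> 'a" and q :: real
  assumes U: "clinear_bdd U" and q: "0 \<le> q" "q < 1" and bound: "\<And>f. norm (U f) \<le> q * norm f"
begin

text \<open>Solutions are the fixed points of the contraction h \<mapsto> g + U h.\<close>

lemma ex1: "\<exists>!h. h - U h = g"
proof -
  have "\<forall>x y. dist (g + U x) (g + U y) \<le> q * dist x y"
    using bound by (simp add: dist_norm flip: clinear_bddD(3) [OF U])
  from banach_fix_type [OF q this] show ?thesis
    by (metis (no_types, lifting) add_diff_cancel_right' diff_add_cancel)
qed

lemma eq: "neumann_inv U g - U (neumann_inv U g) = g"
  unfolding neumann_inv_def by (rule theI' [OF ex1])

lemma unique: "h - U h = g \<Longrightarrow> neumann_inv U g = h"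
  using eq ex1 by blast

lemma inv_left: "neumann_inv U (h - U h) = h"
  by (rule unique) simp

lemma norm_inv: "norm (neumann_inv U g) \<le> norm g / (1 - q)"
proof -
  let ?h = "neumann_inv U g"
  have "norm ?h = norm (g + U ?h)"
    using eq [of g] by (metis diff_add_cancel)
  also have "\<dots> \<le> norm g + q * norm ?h"
    using norm_triangle_ineq bound by (metis add_left_mono order_trans)
  finally have "(1 - q) * norm ?h \<le> norm g"
    by (simp add: algebra_simps)
  then show ?thesis
    using q by (simp add: field_simps)
qed

lemma clinear_bdd_inv: "clinear_bdd (neumann_inv U)"
proof (rule clinear_bddI)
  show "norm (neumann_inv U x) \<le> (1 / (1 - q)) * norm x" for x
    using norm_inv [of x] by simp
  show "neumann_inv U (x + y) = neumann_inv U x + neumann_inv U y" for x y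
    using arg_cong2 [OF eq [of x] eq [of y], of "(+)"]
    by (intro unique) (simp add: clinear_bddD(2) [OF U] add_diff_add)
  show "neumann_inv U (a *\<^sub>C x) = a *\<^sub>C neumann_inv U x" for a x
    using eq [of x] by (intro unique) (metis clinear_bddD(4) [OF U] scaleC_diff_right)
qed

end

\<comment> \<open>otherwise \<open>simp\<close> rewrites the exponent in the abbreviations for \<open>\<ell>\<^sup>2\<close>\<close>
declare numeral_eq_ereal [simp del]

section \<open>Matrices acting on sequences\<close>

lemma seqs_eqI:
  assumes "c \<in> seqs K" "d \<in> seqs K" "\<And>k. k \<in> K \<Longrightarrow> c k = d k"
  shows "c = d"
proof
  show "c k = d k" for k
    using assms by (cases "k \<in> K") (auto simp: seqs_def)
qed

lemma mat_app_seqs: "mat_app K A c \<in> seqs K"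
  by (simp add: mat_app_def seqs_def)

lemma lp_set_seqs: "c \<in> lp_set K p w \<Longrightarrow> c \<in> seqs K"
  by (auto simp: lp_set_def linf_set_def split: if_splits)

lemma mat_boundedI:
  assumes "\<And>c k. c \<in> lp_set K p1 w1 \<Longrightarrow> k \<in> K \<Longrightarrow> (\<lambda>l. A k l * c l) summable_on K"
    and "\<And>c. c \<in> lp_set K p1 w1 \<Longrightarrow> mat_app K A c \<in> lp_set K p2 w2"
    and "\<And>c. c \<in> lp_set K p1 w1 \<Longrightarrow> lp_norm K p2 w2 (mat_app K A c) \<le> C * lp_norm K p1 w1 c"
  shows "mat_bounded K p1 w1 p2 w2 A"
proof -
  have "mat_app K A (\<lambda>k. c k + d k) = (\<lambda>k. mat_app K A c k + mat_app K A d k)"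
    if "c \<in> lp_set K p1 w1" "d \<in> lp_set K p1 w1" for c d
    using assms(1) [OF that(1)] assms(1) [OF that(2)]
    by (auto simp: mat_app_def fun_eq_iff distrib_left intro!: infsum_add)
  moreover have "mat_app K A (\<lambda>k. a * c k) = (\<lambda>k. a * mat_app K A c k)" for a c
  proof -
    have eq: "(\<lambda>l. A k l * (a * c l)) = (\<lambda>l. a * (A k l * c l))" for k
      by (simp add: mult_ac)
    show ?thesis
      by (simp add: mat_app_def fun_eq_iff eq infsum_cmult_right')
  qed
  ultimately show ?thesis
    unfolding mat_bounded_def bounded_op_def lp_def
    using assms by (intro conjI ballI allI exI [of _ C]) simp_all
qed

lemma mat_boundedD:
  assumes "mat_bounded K p1 w1 p2 w2 A"
  shows "\<And>c k. c \<in> lp_set K p1 w1 \<Longrightarrow> k \<in> K \<Longrightarrow> (\<lambda>l. A k l * c l) summable_on K"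
    and "\<And>c. c \<in> lp_set K p1 w1 \<Longrightarrow> mat_app K A c \<in> lp_set K p2 w2"
    and "\<exists>C. \<forall>c\<in>lp_set K p1 w1. lp_norm K p2 w2 (mat_app K A c) \<le> C * lp_norm K p1 w1 c"
  using assms unfolding mat_bounded_def bounded_op_def lp_def by auto

lemma mat_app_lincomb:
  assumes "\<And>k. k \<in> K \<Longrightarrow> (\<lambda>l. A k l * c l) summable_on K"
    and "\<And>k. k \<in> K \<Longrightarrow> (\<lambda>l. B k l * c l) summable_on K"
  shows "mat_app K (\<lambda>k l. a * A k l + b * B k l) c = (\<lambda>k. a * mat_app K A c k + b * mat_app K B c k)"
  using assms
  by (auto simp: mat_app_def fun_eq_iff distrib_right mult.assoc infsum_add infsum_cmult_right'
      summable_on_cmult_right)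

lemma mat_app_linear:
  assumes "\<And>k. k \<in> K \<Longrightarrow> (\<lambda>l. A k l * c l) summable_on K"
    and "\<And>k. k \<in> K \<Longrightarrow> (\<lambda>l. A k l * d l) summable_on K"
  shows "mat_app K A (\<lambda>k. a * c k + b * d k) = (\<lambda>k. a * mat_app K A c k + b * mat_app K A d k)"
proof -
  have "(\<Sum>\<^sub>\<infinity>l\<in>K. A k l * (a * c l + b * d l)) = a * (\<Sum>\<^sub>\<infinity>l\<in>K. A k l * c l) + b * (\<Sum>\<^sub>\<infinity>l\<in>K. A k l * d l)"
    if "k \<in> K" for k
  proof -
    have "(\<Sum>\<^sub>\<infinity>l\<in>K. A k l * (a * c l + b * d l)) = (\<Sum>\<^sub>\<infinity>l\<in>K. a * (A k l * c l) + b * (A k l * d l))"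
      by (rule infsum_cong) (simp add: algebra_simps)
    then show ?thesis
      using assms that by (simp add: infsum_add infsum_cmult_right' summable_on_cmult_right)
  qed
  then show ?thesis
    by (auto simp: mat_app_def fun_eq_iff)
qed

lemmas mat_app_add = mat_app_lincomb [where a = 1 and b = 1, simplified]
lemmas mat_app_diff = mat_app_lincomb [where a = 1 and b = "-1", simplified]

section \<open>Unit sequences, columns and matrix products\<close>

definition unit_seq :: "'i \<Rightarrow> 'i \<Rightarrow> complex" where
  "unit_seq l = (\<lambda>k. if k = l then 1 else 0)"

lemma has_sum_unit_seq: "l \<in> K \<Longrightarrow> ((\<lambda>j. f j * unit_seq l j) has_sum f l) K"
  by (rule has_sum_finite_neutralI [where B = "{l}"]) (auto simp: unit_seq_def)

lemma mat_app_unit_seq: "A \<in> mats K \<Longrightarrow> l \<in> K \<Longrightarrow> mat_app K A (unit_seq l) = (\<lambda>k. A k l)"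
  using has_sum_unit_seq [of l K] by (auto simp: mat_app_def mats_def fun_eq_iff infsumI)

lemma mat_mult_conv_app: "l \<in> K \<Longrightarrow> mat_mult K A B k l = mat_app K A (\<lambda>j. B j l) k"
  by (simp add: mat_mult_def mat_app_def)

lemma has_sum_mat_id: "k \<in> K \<Longrightarrow> ((\<lambda>l. mat_id K k l * c l) has_sum c k) K"
  by (rule has_sum_finite_neutralI [where B = "{k}"]) (auto simp: mat_id_def)

lemma mat_app_id: "c \<in> seqs K \<Longrightarrow> mat_app K (mat_id K) c = c"
  using has_sum_mat_id [of _ K c] by (auto simp: mat_app_def seqs_def fun_eq_iff infsumI)

lemma gram_mats: "gram K \<Psi> \<Phi> \<in> mats K"
  by (simp add: gram_def mats_def)

subsection \<open>Square-summable sequences\<close>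

abbreviation sq_sum :: "'i set \<Rightarrow> ('i \<Rightarrow> complex) \<Rightarrow> real" where
  "sq_sum K c \<equiv> (\<Sum>\<^sub>\<infinity>k\<in>K. (cmod (c k))\<^sup>2)"

lemma l2_set_iff: "c \<in> l2_set K \<longleftrightarrow> c \<in> seqs K \<and> (\<lambda>k. (cmod (c k))\<^sup>2) summable_on K"
  by (simp add: lp_set_def numeral_eq_ereal)

lemma l2_norm: "lp_norm K 2 (\<lambda>_. 1) c = sqrt (sq_sum K c)"
  by (simp add: lp_norm_def powr_half_sqrt infsum_nonneg numeral_eq_ereal)

text \<open>The crude estimate (x + y)^2 \<le> 2 x^2 + 2 y^2 suffices: membership and the existence
  of some operator bound are all that is drawn from it.\<close>

lemma l2_lincomb:
  assumes "c \<in> l2_set K" "d \<in> l2_set K"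
  shows "(\<lambda>k. a * c k + b * d k) \<in> l2_set K"
    and "sq_sum K (\<lambda>k. a * c k + b * d k) \<le> 2 * (cmod a)\<^sup>2 * sq_sum K c + 2 * (cmod b)\<^sup>2 * sq_sum K d"
proof -
  let ?f = "\<lambda>k. 2 * (cmod a)\<^sup>2 * (cmod (c k))\<^sup>2 + 2 * (cmod b)\<^sup>2 * (cmod (d k))\<^sup>2"
  have le: "(cmod (a * c k + b * d k))\<^sup>2 \<le> ?f k" for k
  proof -
    have "cmod (a * c k + b * d k) \<le> cmod a * cmod (c k) + cmod b * cmod (d k)"
      by (metis norm_mult norm_triangle_ineq)
    then have "(cmod (a * c k + b * d k))\<^sup>2 \<le> (cmod a * cmod (c k) + cmod b * cmod (d k))\<^sup>2"
      by (simp add: power_mono)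
    also have "\<dots> \<le> ?f k"
      using sum_squares_bound [of "cmod a * cmod (c k)" "cmod b * cmod (d k)"]
      by (simp add: power2_sum power_mult_distrib)
    finally show ?thesis .
  qed
  have 1: "(\<lambda>k. 2 * (cmod a)\<^sup>2 * (cmod (c k))\<^sup>2) summable_on K"
    "(\<lambda>k. 2 * (cmod b)\<^sup>2 * (cmod (d k))\<^sup>2) summable_on K"
    using assms by (auto simp: l2_set_iff intro!: summable_on_cmult_right)
  then have 2: "?f summable_on K"
    by (rule summable_on_add)
  have 3: "(\<lambda>k. (cmod (a * c k + b * d k))\<^sup>2) summable_on K"
    by (rule summable_on_comparison_test [OF 2 le]) auto
  then show "(\<lambda>k. a * c k + b * d k) \<in> l2_set K"
    using assms by (auto simp: l2_set_iff seqs_def)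
  have "sq_sum K (\<lambda>k. a * c k + b * d k) \<le> infsum ?f K"
    by (rule infsum_mono [OF 3 2 le])
  also have "\<dots> = 2 * (cmod a)\<^sup>2 * sq_sum K c + 2 * (cmod b)\<^sup>2 * sq_sum K d"
    by (simp add: infsum_add [OF 1] infsum_cmult_right')
  finally show "sq_sum K (\<lambda>k. a * c k + b * d k) \<le> 2 * (cmod a)\<^sup>2 * sq_sum K c + 2 * (cmod b)\<^sup>2 * sq_sum K d" .
qed

lemma unit_seq_l2: "l \<in> K \<Longrightarrow> unit_seq l \<in> l2_set K"
  unfolding l2_set_iff seqs_def
  by (auto simp: unit_seq_def split: if_splits
      intro!: finite_nonzero_values_imp_summable_on finite_subset [of _ "{l}"])

lemma l2_boundedI:
  assumes "\<And>c k. c \<in> l2_set K \<Longrightarrow> k \<in> K \<Longrightarrow> (\<lambda>l. A k l * c l) summable_on K"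
    and "\<And>c. c \<in> l2_set K \<Longrightarrow> mat_app K A c \<in> l2_set K"
    and "\<And>c. c \<in> l2_set K \<Longrightarrow> sq_sum K (mat_app K A c) \<le> C * sq_sum K c"
  shows "l2_bounded K A"
proof (rule mat_boundedI)
  fix c assume c: "c \<in> l2_set K"
  show "lp_norm K 2 (\<lambda>_. 1) (mat_app K A c) \<le> sqrt C * lp_norm K 2 (\<lambda>_. 1) c"
    using assms(3) [OF c] by (simp add: l2_norm flip: real_sqrt_mult)
qed (use assms in auto)

lemma l2_bounded_sq_sum:
  assumes "l2_bounded K A"
  obtains C where "0 \<le> C" "\<And>c. c \<in> l2_set K \<Longrightarrow> sq_sum K (mat_app K A c) \<le> C * sq_sum K c"
proof -
  obtain C where C: "\<forall>c\<in>l2_set K. sqrt (sq_sum K (mat_app K A c)) \<le> C * sqrt (sq_sum K c)"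
    using mat_boundedD(3) [OF assms] by (auto simp: l2_norm)
  show ?thesis
  \<comment> \<open>\<open>C\<close> may be negative when all the sums vanish; its square is
    nonnegative in any case.\<close>
  proof (rule that [of "C\<^sup>2"])
    fix c assume c: "c \<in> l2_set K"
    have "0 \<le> sq_sum K (mat_app K A c)" and 0: "0 \<le> sq_sum K c"
      by (auto intro: infsum_nonneg)
    then have "sq_sum K (mat_app K A c) = (sqrt (sq_sum K (mat_app K A c)))\<^sup>2"
      by simp
    also have "\<dots> \<le> (C * sqrt (sq_sum K c))\<^sup>2"
      by (rule power_mono) (use C c in \<open>auto intro: infsum_nonneg\<close>)
    also have "\<dots> = C\<^sup>2 * sq_sum K c"
      using 0 by (simp add: power_mult_distrib)
    finally show "sq_sum K (mat_app K A c) \<le> C\<^sup>2 * sq_sum K c" .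
  qed simp
qed

lemma l2_bounded_lincomb:
  assumes A: "l2_bounded K A" and B: "l2_bounded K B"
  shows "l2_bounded K (\<lambda>k l. a * A k l + b * B k l)"
proof -
  obtain C where C: "0 \<le> C" "\<And>c. c \<in> l2_set K \<Longrightarrow> sq_sum K (mat_app K A c) \<le> C * sq_sum K c"
    using l2_bounded_sq_sum [OF A] by blast
  obtain D where D: "0 \<le> D" "\<And>c. c \<in> l2_set K \<Longrightarrow> sq_sum K (mat_app K B c) \<le> D * sq_sum K c"
    using l2_bounded_sq_sum [OF B] by blast
  note s = mat_boundedD(1) [OF A] mat_boundedD(1) [OF B]
  note m = mat_boundedD(2) [OF A] mat_boundedD(2) [OF B]
  show ?thesis
  proof (rule l2_boundedI [where C = "2 * (cmod a)\<^sup>2 * C + 2 * (cmod b)\<^sup>2 * D"])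
    fix c assume c: "c \<in> l2_set K"
    have eq: "mat_app K (\<lambda>k l. a * A k l + b * B k l) c = (\<lambda>k. a * mat_app K A c k + b * mat_app K B c k)"
      by (rule mat_app_lincomb) (use s c in auto)
    show "mat_app K (\<lambda>k l. a * A k l + b * B k l) c \<in> l2_set K"
      unfolding eq by (rule l2_lincomb) (use m c in auto)
    have "sq_sum K (mat_app K (\<lambda>k l. a * A k l + b * B k l) c)
        \<le> 2 * (cmod a)\<^sup>2 * sq_sum K (mat_app K A c) + 2 * (cmod b)\<^sup>2 * sq_sum K (mat_app K B c)"
      unfolding eq by (rule l2_lincomb) (use m c in auto)
    also have "\<dots> \<le> 2 * (cmod a)\<^sup>2 * (C * sq_sum K c) + 2 * (cmod b)\<^sup>2 * (D * sq_sum K c)"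
      by (intro add_mono mult_left_mono C D c) auto
    finally show "sq_sum K (mat_app K (\<lambda>k l. a * A k l + b * B k l) c)
        \<le> (2 * (cmod a)\<^sup>2 * C + 2 * (cmod b)\<^sup>2 * D) * sq_sum K c"
      by (simp add: algebra_simps)
    show "(\<lambda>l. (a * A k l + b * B k l) * c l) summable_on K" if "k \<in> K" for k
      using summable_on_add [OF summable_on_cmult_right [OF s(1) [OF c that], of a]
          summable_on_cmult_right [OF s(2) [OF c that], of b]]
      by (simp add: algebra_simps)
  qed
qed

lemmas l2_bounded_add = l2_bounded_lincomb [where a = 1 and b = 1, simplified]
lemmas l2_bounded_diff = l2_bounded_lincomb [where a = 1 and b = "-1", simplified]

lemma l2_bounded_id: "l2_bounded K (mat_id K)"
proof (rule l2_boundedI [where C = 1])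
  fix c k assume "c \<in> l2_set K" "k \<in> K"
  then show "(\<lambda>l. mat_id K k l * c l) summable_on K"
    by (intro has_sum_imp_summable [OF has_sum_mat_id])
qed (auto simp: mat_app_id l2_set_iff)

section \<open>Frames\<close>

text \<open>Cauchy criterion for unconditional sums. Frame expansions need not converge absolutely
  in norm, so their convergence is drawn from completeness, applied to the net of finite partial
  sums.\<close>

lemma summable_on_CauchyI:
  fixes f :: "'a \<Rightarrow> 'b::banach"
  assumes "\<And>e. e > 0 \<Longrightarrow>
    \<exists>F0. finite F0 \<and> F0 \<subseteq> A \<and> (\<forall>G. finite G \<longrightarrow> G \<subseteq> A - F0 \<longrightarrow> norm (sum f G) < e)"
  shows "f summable_on A"
proof -
  have "cauchy_filter (filtermap (sum f) (finite_subsets_at_top A))"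
    unfolding cauchy_filter_metric_filtermap
  proof (intro allI impI)
    fix e :: real assume "e > 0"
    then obtain F0 where F0: "finite F0" "F0 \<subseteq> A"
      and small: "\<And>G. finite G \<Longrightarrow> G \<subseteq> A - F0 \<Longrightarrow> norm (sum f G) < e / 2"
      using assms [of "e / 2"] by auto
    let ?P = "\<lambda>F. finite F \<and> F0 \<subseteq> F \<and> F \<subseteq> A"
    have "eventually ?P (finite_subsets_at_top A)"
      using F0 by (auto simp: eventually_finite_subsets_at_top)
    moreover have "dist (sum f F) (sum f F') < e" if "?P F" "?P F'" for F F'
    proof -
      have "sum f F = sum f F0 + sum f (F - F0)" "sum f F' = sum f F0 + sum f (F' - F0)"
        using that by (simp_all add: add.commute [of "sum f F0"] sum.subset_diff [of F0])
      then have "dist (sum f F) (sum f F') = norm (sum f (F - F0) - sum f (F' - F0))"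
        by (simp add: dist_norm)
      also have "\<dots> \<le> norm (sum f (F - F0)) + norm (sum f (F' - F0))"
        by (rule norm_triangle_ineq4)
      also have "\<dots> < e / 2 + e / 2"
        using that by (intro add_strict_mono small) auto
      finally show ?thesis by simp
    qed
    ultimately show "\<exists>P. eventually P (finite_subsets_at_top A) \<and>
        (\<forall>x y. P x \<and> P y \<longrightarrow> dist (sum f x) (sum f y) < e)"
      by (intro exI [of _ ?P]) simp
  qed
  moreover have "filtermap (sum f) (finite_subsets_at_top A) \<noteq> bot"
    by (simp add: filtermap_bot_iff)
  ultimately have "\<exists>L. filtermap (sum f) (finite_subsets_at_top A) \<le> nhds L"
    by (intro cauchy_filter_complete_converges [OF _ complete_UNIV]) auto
  then show ?thesis
    unfolding summable_on_def has_sum_def filterlim_def .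
qed

section \<open>Bessel families: bounded analysis and synthesis\<close>

definition bessel :: "'i set \<Rightarrow> ('i \<Rightarrow> 'h::complex_hilbert) \<Rightarrow> real \<Rightarrow> bool" where
  "bessel K \<Theta> B \<longleftrightarrow> 0 \<le> B \<and> (\<forall>f.
     (\<lambda>k. (cmod (cinner f (\<Theta> k)))\<^sup>2) summable_on K \<and>
     (\<Sum>\<^sub>\<infinity>k\<in>K. (cmod (cinner f (\<Theta> k)))\<^sup>2) \<le> B * (norm f)\<^sup>2)"

lemma sq_sum_analysis: "sq_sum K (analysis K \<Theta> f) = (\<Sum>\<^sub>\<infinity>k\<in>K. (cmod (cinner f (\<Theta> k)))\<^sup>2)"
  by (rule infsum_cong) (simp add: analysis_def)

lemma bessel_analysis:
  assumes "bessel K \<Theta> B"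
  shows "analysis K \<Theta> f \<in> l2_set K" "sq_sum K (analysis K \<Theta> f) \<le> B * (norm f)\<^sup>2"
proof -
  show "sq_sum K (analysis K \<Theta> f) \<le> B * (norm f)\<^sup>2"
    using assms by (simp add: bessel_def sq_sum_analysis)
  have "(\<lambda>k. (cmod (analysis K \<Theta> f k))\<^sup>2) summable_on K
     \<longleftrightarrow> (\<lambda>k. (cmod (cinner f (\<Theta> k)))\<^sup>2) summable_on K"
    by (rule summable_on_cong) (simp add: analysis_def)
  then show "analysis K \<Theta> f \<in> l2_set K"
    using assms by (simp add: bessel_def l2_set_iff seqs_def analysis_def)
qed

text \<open>Duality: pairing the sum \<open>s\<close> with itself produces the coefficients of
  \<open>s\<close> against the family. Cauchy-Schwarz and the Bessel bound for \<open>s\<close>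
  leave one factor \<open>norm s\<close> on the right, which cancels.\<close>

lemma bessel_finite_sum:
  assumes "bessel K \<Theta> B" "finite F" "F \<subseteq> K"
  shows "norm (\<Sum>k\<in>F. c k *\<^sub>C \<Theta> k) \<le> sqrt B * sqrt (\<Sum>k\<in>F. (cmod (c k))\<^sup>2)"
proof (cases "(\<Sum>k\<in>F. c k *\<^sub>C \<Theta> k) = 0")
  case False
  define s where "s = (\<Sum>k\<in>F. c k *\<^sub>C \<Theta> k)"
  have B: "0 \<le> B" using assms by (simp add: bessel_def)
  have "(norm s)\<^sup>2 = cmod (cinner s s)"
    by (simp add: cinner_self norm_power)
  also have "cinner s s = (\<Sum>k\<in>F. c k * cinner (\<Theta> k) s)"
    by (subst (1) s_def) (simp add: cinner_sum_left cinner_scaleC_left)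
  also have "cmod \<dots> \<le> (\<Sum>k\<in>F. \<bar>cmod (c k)\<bar> * \<bar>cmod (cinner s (\<Theta> k))\<bar>)"
    by (rule order_trans [OF norm_sum]) (simp add: norm_mult cinner_commute [of "\<Theta> _" s])
  also have "\<dots> \<le> L2_set (\<lambda>k. cmod (c k)) F * L2_set (\<lambda>k. cmod (cinner s (\<Theta> k))) F"
    by (rule L2_set_mult_ineq)
  also have "\<dots> \<le> L2_set (\<lambda>k. cmod (c k)) F * sqrt (B * (norm s)\<^sup>2)"
    unfolding L2_set_def [of "\<lambda>k. cmod (cinner s (\<Theta> k))"]
  proof (intro mult_left_mono real_sqrt_le_mono)
    have "(\<Sum>k\<in>F. (cmod (cinner s (\<Theta> k)))\<^sup>2) \<le> (\<Sum>\<^sub>\<infinity>k\<in>K. (cmod (cinner s (\<Theta> k)))\<^sup>2)"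
      by (rule finite_sum_le_infsum) (use assms in \<open>auto simp: bessel_def\<close>)
    also have "\<dots> \<le> B * (norm s)\<^sup>2"
      using assms by (simp add: bessel_def)
    finally show "(\<Sum>k\<in>F. (cmod (cinner s (\<Theta> k)))\<^sup>2) \<le> B * (norm s)\<^sup>2" .
  qed simp
  also have "sqrt (B * (norm s)\<^sup>2) = sqrt B * norm s"
    by (simp add: real_sqrt_mult)
  finally have "norm s * norm s \<le> (sqrt B * L2_set (\<lambda>k. cmod (c k)) F) * norm s"
    by (simp only: power2_eq_square mult_ac)
  moreover have "0 < norm s"
    using False by (simp add: s_def)
  ultimately show ?thesis
    unfolding s_def [symmetric] L2_set_def by (meson mult_right_le_imp_le)
qed (use assms in \<open>auto simp: bessel_def sum_nonneg\<close>)

lemma bessel_summable: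
  assumes "bessel K \<Theta> B" "c \<in> l2_set K"
  shows "(\<lambda>k. c k *\<^sub>C \<Theta> k) summable_on K"
proof (rule summable_on_CauchyI)
  fix e :: real assume "e > 0"
  let ?g = "\<lambda>k. (cmod (c k))\<^sup>2"
  have B: "0 \<le> B" and g: "?g summable_on K"
    using assms by (auto simp: bessel_def l2_set_iff)
  \<comment> \<open>Chosen so that \<open>sqrt B * sqrt d < e\<close>; the summand 1 keeps the
    denominator positive when \<open>B = 0\<close>.\<close>
  define d where "d = (e / (sqrt B + 1))\<^sup>2"
  have B': "0 < sqrt B + 1"
    using B by (smt (verit) real_sqrt_ge_zero)
  then have d: "d > 0"
    using \<open>e > 0\<close> by (simp add: d_def)
  have "sqrt d = e / (sqrt B + 1)"
    using \<open>e > 0\<close> B' by (simp add: d_def)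
  then have "sqrt B * sqrt d < e"
    using \<open>e > 0\<close> B' by (simp add: pos_divide_less_eq algebra_simps)
  obtain F0 where F0: "finite F0" "F0 \<subseteq> K" "dist (sum ?g F0) (infsum ?g K) \<le> d"
    using infsum_finite_approximation [OF g d] by blast
  have "norm (\<Sum>k\<in>G. c k *\<^sub>C \<Theta> k) < e" if "finite G" "G \<subseteq> K - F0" for G
  proof -
    have "sum ?g F0 + sum ?g G = sum ?g (F0 \<union> G)"
      using that F0 by (subst sum.union_disjoint) auto
    also have "\<dots> \<le> infsum ?g K"
      by (rule finite_sum_le_infsum) (use g F0 that in auto)
    finally have "sum ?g G \<le> d"
      using F0 by (simp add: dist_real_def)
    then have "sqrt B * sqrt (sum ?g G) \<le> sqrt B * sqrt d"
      using B by (simp add: mult_left_mono)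
    moreover have "norm (\<Sum>k\<in>G. c k *\<^sub>C \<Theta> k) \<le> sqrt B * sqrt (sum ?g G)"
      by (rule bessel_finite_sum [OF assms(1)]) (use that in auto)
    ultimately show ?thesis
      using \<open>sqrt B * sqrt d < e\<close> by linarith
  qed
  then show "\<exists>F0. finite F0 \<and> F0 \<subseteq> K \<and> (\<forall>G. finite G \<longrightarrow> G \<subseteq> K - F0 \<longrightarrow> norm (\<Sum>k\<in>G. c k *\<^sub>C \<Theta> k) < e)"
    using F0 by blast
qed

lemma bessel_has_sum:
  assumes "bessel K \<Theta> B" "c \<in> l2_set K"
  shows "((\<lambda>k. c k *\<^sub>C \<Theta> k) has_sum synthesis K \<Theta> c) K"
  unfolding synthesis_def using bessel_summable [OF assms] by simp

lemma bessel_synthesis_norm: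
  assumes "bessel K \<Theta> B" "c \<in> l2_set K"
  shows "(norm (synthesis K \<Theta> c))\<^sup>2 \<le> B * sq_sum K c"
proof -
  have B: "0 \<le> B" using assms by (simp add: bessel_def)
  have "norm (synthesis K \<Theta> c) \<le> sqrt B * sqrt (sq_sum K c)"
  proof (rule tendsto_upperbound)
    show "((\<lambda>F. norm (\<Sum>k\<in>F. c k *\<^sub>C \<Theta> k)) \<longlongrightarrow> norm (synthesis K \<Theta> c)) (finite_subsets_at_top K)"
      using bessel_has_sum [OF assms] unfolding has_sum_def by (rule tendsto_norm)
    show "\<forall>\<^sub>F F in finite_subsets_at_top K. norm (\<Sum>k\<in>F. c k *\<^sub>C \<Theta> k) \<le> sqrt B * sqrt (sq_sum K c)"
    proof (rule eventually_finite_subsets_at_top_weakI)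
      fix F assume F: "finite F" "F \<subseteq> K"
      have "(\<Sum>k\<in>F. (cmod (c k))\<^sup>2) \<le> sq_sum K c"
        by (rule finite_sum_le_infsum) (use assms F in \<open>auto simp: l2_set_iff\<close>)
      then have "sqrt B * sqrt (\<Sum>k\<in>F. (cmod (c k))\<^sup>2) \<le> sqrt B * sqrt (sq_sum K c)"
        using B by (simp add: mult_left_mono)
      with bessel_finite_sum [OF assms(1) F, of c]
      show "norm (\<Sum>k\<in>F. c k *\<^sub>C \<Theta> k) \<le> sqrt B * sqrt (sq_sum K c)" by linarith
    qed
  qed simp
  then have "(norm (synthesis K \<Theta> c))\<^sup>2 \<le> (sqrt B * sqrt (sq_sum K c))\<^sup>2"
    by (simp add: power_mono)
  also have "\<dots> = B * sq_sum K c"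
    using B by (simp add: power_mult_distrib infsum_nonneg)
  finally show ?thesis .
qed

lemma synthesis_lincomb:
  assumes "bessel K \<Theta> B" "c \<in> l2_set K" "d \<in> l2_set K"
  shows "synthesis K \<Theta> (\<lambda>k. a * c k + b * d k) = a *\<^sub>C synthesis K \<Theta> c + b *\<^sub>C synthesis K \<Theta> d"
proof -
  note hs = bessel_has_sum [OF assms(1)]
  have "((\<lambda>k. a *\<^sub>C c k *\<^sub>C \<Theta> k + b *\<^sub>C d k *\<^sub>C \<Theta> k) has_sum (a *\<^sub>C synthesis K \<Theta> c + b *\<^sub>C synthesis K \<Theta> d)) K"
    using hs [OF assms(2)] hs [OF assms(3)]
    by (intro has_sum_add has_sum_bounded_linear [OF bounded_linear_scaleC])
  then show ?thesis
    unfolding synthesis_def [of _ _ "\<lambda>k. a * c k + b * d k"]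
    by (intro infsumI) (simp add: scaleC_scaleC scaleC_add_left)
qed

text \<open>Every matrix between frame coefficients that occurs below is of the form
  \<open>\<langle>U \<theta>\<^sub>l, \<psi>\<^sub>k\<rangle>\<close>, and acts on \<open>\<ell>\<^sup>2\<close> as analysis after \<open>U\<close> after synthesis.\<close>

lemma has_sum_gram:
  assumes "clinear_bdd U" "bessel K \<Theta> B" "c \<in> l2_set K" "k \<in> K"
  shows "((\<lambda>l. gram K \<Psi> (\<lambda>j. U (\<Theta> j)) k l * c l) has_sum analysis K \<Psi> (U (synthesis K \<Theta> c)) k) K"
proof -
  have "((\<lambda>l. cinner (U (c l *\<^sub>C \<Theta> l)) (\<Psi> k)) has_sum cinner (U (synthesis K \<Theta> c)) (\<Psi> k)) K"
    using bessel_has_sum [OF assms(2,3)] clinear_bddD(1) [OF assms(1)]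
    by (intro has_sum_bounded_linear [OF bounded_linear_compose [OF bounded_linear_cinner_left]])
  then show ?thesis
    using assms(4)
    by (subst has_sum_cong [where g = "\<lambda>l. cinner (U (c l *\<^sub>C \<Theta> l)) (\<Psi> k)"])
       (auto simp: gram_def analysis_def clinear_bddD(4) [OF assms(1)] cinner_scaleC_left mult.commute)
qed

lemma mat_app_gram:
  assumes "clinear_bdd U" "bessel K \<Theta> B" "c \<in> l2_set K"
  shows "mat_app K (gram K \<Psi> (\<lambda>j. U (\<Theta> j))) c = analysis K \<Psi> (U (synthesis K \<Theta> c))"
  using has_sum_gram [OF assms, of _ \<Psi>] by (auto simp: mat_app_def infsumI analysis_def fun_eq_iff)

lemma l2_bounded_gram:
  assumes "clinear_bdd U" "bessel K \<Theta> B" "bessel K \<Psi> B'"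
  shows "l2_bounded K (gram K \<Psi> (\<lambda>j. U (\<Theta> j)))"
proof -
  obtain D where D: "\<And>x. norm (U x) \<le> norm x * D"
    using bounded_linear.bounded [OF clinear_bddD(1) [OF assms(1)]] by blast
  have B': "0 \<le> B'" using assms by (simp add: bessel_def)
  show ?thesis
  proof (rule l2_boundedI [where C = "B' * (D\<^sup>2 * B)"])
    fix c assume c: "c \<in> l2_set K"
    show "(\<lambda>l. gram K \<Psi> (\<lambda>j. U (\<Theta> j)) k l * c l) summable_on K" if "k \<in> K" for k
      by (rule has_sum_imp_summable [OF has_sum_gram [OF assms(1,2) c that]])
    show "mat_app K (gram K \<Psi> (\<lambda>j. U (\<Theta> j))) c \<in> l2_set K"
      by (simp add: mat_app_gram [OF assms(1,2) c] bessel_analysis [OF assms(3)])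
    let ?s = "synthesis K \<Theta> c"
    have "(norm (U ?s))\<^sup>2 \<le> (norm ?s * D)\<^sup>2"
      by (rule power_mono [OF D]) simp
    also have "\<dots> \<le> (B * sq_sum K c) * D\<^sup>2"
      unfolding power_mult_distrib
      by (rule mult_right_mono [OF bessel_synthesis_norm [OF assms(2) c]]) simp
    finally have "B' * (norm (U ?s))\<^sup>2 \<le> B' * ((B * sq_sum K c) * D\<^sup>2)"
      using B' by (rule mult_left_mono)
    with bessel_analysis(2) [OF assms(3), of "U ?s"]
    show "sq_sum K (mat_app K (gram K \<Psi> (\<lambda>j. U (\<Theta> j))) c) \<le> B' * (D\<^sup>2 * B) * sq_sum K c"
      by (simp add: mat_app_gram [OF assms(1,2) c] mult_ac)
  qed
qed

text \<open>Column \<open>l\<close> of the right factor is the analysis of \<open>\<Phi> l\<close>,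
  so the product is computed column by column. When \<open>\<Theta>\<close> and
  \<open>\<Psi>'\<close> are the same frame, the synthesis of an analysis is its frame operator,
  which \<open>U\<close> can then cancel.\<close>

lemma mat_mult_gram:
  assumes "clinear_bdd U" "bessel K \<Theta> B" "bessel K \<Psi>' B'"
  shows "mat_mult K (gram K \<Psi> (\<lambda>j. U (\<Theta> j))) (gram K \<Psi>' \<Phi>)
    = gram K \<Psi> (\<lambda>j. U (synthesis K \<Theta> (analysis K \<Psi>' (\<Phi> j))))"
proof (intro ext)
  fix k l
  show "mat_mult K (gram K \<Psi> (\<lambda>j. U (\<Theta> j))) (gram K \<Psi>' \<Phi>) k l
    = gram K \<Psi> (\<lambda>j. U (synthesis K \<Theta> (analysis K \<Psi>' (\<Phi> j)))) k l"
  proof (cases "l \<in> K")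
    case True
    have "(\<lambda>j. gram K \<Psi>' \<Phi> j l) = analysis K \<Psi>' (\<Phi> l)"
      using True by (auto simp: gram_def analysis_def)
    then show ?thesis
      using True mat_app_gram [OF assms(1,2) bessel_analysis(1) [OF assms(3)], of \<Psi> "\<Phi> l"]
      by (auto simp: mat_mult_conv_app gram_def analysis_def)
  qed (simp add: mat_mult_def gram_def)
qed

section \<open>The frame operator and its inverse\<close>

locale frame_bounds =
  fixes K :: "'i set" and \<Psi> :: "'i \<Rightarrow> 'h::complex_hilbert" and A B :: real
  assumes AB: "0 < A" "A \<le> B"
    and summable: "\<And>f. (\<lambda>k. (cmod (cinner f (\<Psi> k)))\<^sup>2) summable_on K"
    and lower: "\<And>f. A * (norm f)\<^sup>2 \<le> (\<Sum>\<^sub>\<infinity>k\<in>K. (cmod (cinner f (\<Psi> k)))\<^sup>2)"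
    and upper: "\<And>f. (\<Sum>\<^sub>\<infinity>k\<in>K. (cmod (cinner f (\<Psi> k)))\<^sup>2) \<le> B * (norm f)\<^sup>2"
begin

abbreviation S where "S \<equiv> frame_op K \<Psi>"

lemma bessel: "bessel K \<Psi> B"
  using AB summable upper by (simp add: bessel_def)

lemma synthesis_analysis: "synthesis K \<Psi> (analysis K \<Psi> f) = S f"
  by (simp add: frame_op_def)

lemma norm_S: "norm (S f) \<le> B * norm f"
proof -
  have "(norm (S f))\<^sup>2 \<le> B * sq_sum K (analysis K \<Psi> f)"
    unfolding frame_op_def by (rule bessel_synthesis_norm [OF bessel bessel_analysis(1) [OF bessel]])
  also have "\<dots> \<le> B * (B * (norm f)\<^sup>2)"
    using AB bessel_analysis(2) [OF bessel] by (intro mult_left_mono) auto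
  also have "\<dots> = (B * norm f)\<^sup>2"
    by (simp add: power2_eq_square)
  finally show ?thesis
    by (rule power2_le_imp_le) (use AB in simp)
qed

lemma clinear_S: "clinear_bdd S"
proof (rule clinear_bddI [OF _ _ norm_S])
  note l2 = bessel_analysis(1) [OF bessel]
  show "S (x + y) = S x + S y" for x y
  proof -
    have "analysis K \<Psi> (x + y) = (\<lambda>k. 1 * analysis K \<Psi> x k + 1 * analysis K \<Psi> y k)"
      by (auto simp: analysis_def cinner_add_left)
    then show ?thesis
      using synthesis_lincomb [OF bessel l2 l2, of 1 x 1 y] by (simp add: frame_op_def)
  qed
  show "S (a *\<^sub>C x) = a *\<^sub>C S x" for a x
  proof -
    have "analysis K \<Psi> (a *\<^sub>C x) = (\<lambda>k. a * analysis K \<Psi> x k + 0 * analysis K \<Psi> x k)"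
      by (auto simp: analysis_def cinner_scaleC_left)
    then show ?thesis
      using synthesis_lincomb [OF bessel l2 l2, of a x 0 x] by (simp add: frame_op_def)
  qed
qed

lemma has_sum_cinner_S: "((\<lambda>k. cinner f (\<Psi> k) * cnj (cinner g (\<Psi> k))) has_sum cinner (S f) g) K"
proof -
  have "((\<lambda>k. cinner (analysis K \<Psi> f k *\<^sub>C \<Psi> k) g) has_sum cinner (S f) g) K"
    unfolding frame_op_def
    by (rule has_sum_bounded_linear [OF bounded_linear_cinner_left
          bessel_has_sum [OF bessel bessel_analysis(1) [OF bessel]]])
  then show ?thesis
    by (subst has_sum_cong [where g = "\<lambda>k. cinner (analysis K \<Psi> f k *\<^sub>C \<Psi> k) g"])
       (auto simp: analysis_def cinner_scaleC_left cinner_commute [of "\<Psi> _" g])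
qed

lemma S_selfadjoint: "cinner (S f) g = cinner f (S g)"
proof -
  have "((\<lambda>k. cnj (cinner g (\<Psi> k) * cnj (cinner f (\<Psi> k)))) has_sum cnj (cinner (S g) f)) K"
    using has_sum_cinner_S [of g f] by (simp only: has_sum_cnj_iff)
  then have "((\<lambda>k. cinner f (\<Psi> k) * cnj (cinner g (\<Psi> k))) has_sum cinner f (S g)) K"
    by (simp add: mult.commute flip: cinner_commute)
  with has_sum_cinner_S [of f g] show ?thesis
    by (rule has_sum_unique)
qed

lemma S_coercive: "A * (norm f)\<^sup>2 \<le> Re (cinner f (S f))"
proof -
  have "((\<lambda>k. complex_of_real ((cmod (cinner f (\<Psi> k)))\<^sup>2)) has_sum cinner (S f) f) K"
    using has_sum_cinner_S [of f f] by (simp add: complex_norm_square [symmetric])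
  then have "((\<lambda>k. (cmod (cinner f (\<Psi> k)))\<^sup>2) has_sum Re (cinner (S f) f)) K"
    using has_sum_Re by fastforce
  with lower [of f] show ?thesis
    by (simp add: S_selfadjoint infsumI)
qed

text \<open>This \<open>t\<close> minimizes the bound \<open>1 - 2tA + t\<^sup>2B\<^sup>2\<close> for the squared norm of \<open>1 - tS\<close>.\<close>

definition t where "t = A / B\<^sup>2"
definition \<rho> where "\<rho> = sqrt (1 - A\<^sup>2 / B\<^sup>2)"
definition R where "R f = f - complex_of_real t *\<^sub>C S f"

lemma t_pos: "0 < t"
  using AB by (simp add: t_def)

lemma \<rho>: "0 \<le> \<rho>" "\<rho> < 1"
proof -
  have "A\<^sup>2 / B\<^sup>2 \<le> 1" "0 < A\<^sup>2 / B\<^sup>2"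
    using AB by (auto simp: power_mono)
  then show "0 \<le> \<rho>" "\<rho> < 1"
    by (simp_all add: \<rho>_def)
qed

text \<open>Expanding the square takes the place of the spectral theorem for S: coercivity controls
  the cross term and the upper frame bound the quadratic one.\<close>

lemma norm_R: "norm (R f) \<le> \<rho> * norm f"
proof -
  have "(norm (R f))\<^sup>2 = (norm (f + (- complex_of_real t) *\<^sub>C S f))\<^sup>2"
    by (simp add: R_def scaleC_of_real flip: of_real_minus)
  also have "\<dots> = (norm f)\<^sup>2 - 2 * t * Re (cinner f (S f)) + t\<^sup>2 * (norm (S f))\<^sup>2"
    using t_pos by (simp add: norm_add_sq cinner_scaleC_right norm_scaleC power_mult_distrib)
  also have "\<dots> \<le> (norm f)\<^sup>2 - 2 * t * (A * (norm f)\<^sup>2) + t\<^sup>2 * (B * norm f)\<^sup>2"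
    using t_pos S_coercive [of f] norm_S [of f]
    by (intro add_mono diff_mono mult_left_mono power_mono) auto
  also have "\<dots> = (1 - A\<^sup>2 / B\<^sup>2) * (norm f)\<^sup>2"
    using AB by (simp add: t_def power2_eq_square field_simps)
  also have "1 - A\<^sup>2 / B\<^sup>2 = \<rho>\<^sup>2"
    using AB by (simp add: \<rho>_def power_mono)
  finally have "(norm (R f))\<^sup>2 \<le> (\<rho> * norm f)\<^sup>2"
    by (simp add: power_mult_distrib)
  then show ?thesis
    by (rule power2_le_imp_le) (simp add: \<rho>)
qed

lemma clinear_R: "clinear_bdd R"
  unfolding R_def by (intro clinear_bdd_diff clinear_bdd_id clinear_bdd_scaleC clinear_S)

lemma contraction: "cmod \<mu> * \<rho> < 1 \<Longrightarrow> strict_contraction (\<lambda>x. \<mu> *\<^sub>C R x) (cmod \<mu> * \<rho>)"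
  by standard
     (auto simp: \<rho> norm_scaleC mult.assoc intro!: clinear_bdd_scaleC clinear_R mult_left_mono norm_R)

text \<open>Since 1 - R = t S, the inverse of S is the Neumann inverse of R applied to t g.\<close>

definition Sinv where "Sinv g = neumann_inv R (complex_of_real t *\<^sub>C g)"

lemma R_contraction: "strict_contraction R \<rho>"
  using contraction [of 1] \<rho> by simp

lemma clinear_Sinv: "clinear_bdd Sinv"
  unfolding Sinv_def
  by (intro clinear_bdd_compose [OF strict_contraction.clinear_bdd_inv [OF R_contraction]]
      clinear_bdd_scaleC clinear_bdd_id)

lemma Sinv_S [simp]: "Sinv (S f) = f"
  using strict_contraction.inv_left [OF R_contraction, of f] by (simp add: Sinv_def R_def)

lemma S_Sinv [simp]: "S (Sinv g) = g"
proof -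
  have "complex_of_real t *\<^sub>C S (Sinv g) = complex_of_real t *\<^sub>C g"
    using strict_contraction.eq [OF R_contraction, of "complex_of_real t *\<^sub>C g"]
    by (simp add: Sinv_def R_def)
  then show ?thesis
    using t_pos by (simp add: scaleC_of_real)
qed

lemma inv_S: "inv S = Sinv"
  by (rule inv_equality) simp_all

lemma dual_frame: "dual_frame K \<Psi> k = Sinv (\<Psi> k)"
  by (simp add: dual_frame_def inv_S)

lemma Sinv_selfadjoint: "cinner (Sinv f) g = cinner f (Sinv g)"
  by (metis S_Sinv S_selfadjoint)

lemma analysis_dual: "analysis K (dual_frame K \<Psi>) f = analysis K \<Psi> (Sinv f)"
  by (simp add: analysis_def dual_frame Sinv_selfadjoint fun_eq_iff)

text \<open>Self-adjointness moves the inverse of S from the left index to the right one. Gram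
  matrices with the dual thereby take the form with \<Psi> on the left and an operator on the right,
  for which the action and the products are known.\<close>

lemma gram_dual: "gram K (dual_frame K \<Psi>) \<Phi> = gram K \<Psi> (\<lambda>j. Sinv (\<Phi> j))"
  by (simp add: gram_def dual_frame Sinv_selfadjoint fun_eq_iff)

end

section \<open>Averages over roots of unity\<close>

definition root_unity :: "nat \<Rightarrow> nat \<Rightarrow> complex" where
  "root_unity n j = cis (2 * pi * real j / real n)"

text \<open>Both sides are the root with index i j. The exchange turns the sum of i-th powers over
  all nodes into a geometric sum.\<close>

lemma root_unity_power: "root_unity n j ^ i = root_unity n i ^ j"
  by (simp only: root_unity_def Complex.DeMoivre times_divide_eq_right mult_ac)

lemma root_unity_power_eq_1: "0 < n \<Longrightarrow> root_unity n j ^ n = 1"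
  using cis_multiple_2pi [of "real j"]
  by (simp only: root_unity_def Complex.DeMoivre times_divide_eq_right) simp

lemma norm_root_unity [simp]: "cmod (root_unity n j) = 1"
  by (simp add: root_unity_def)

lemma sum_root_unity_power:
  assumes "0 < i" "i < n"
  shows "(\<Sum>j<n. root_unity n j ^ i) = 0"
proof -
  define w where "w = root_unity n i"
  have "w = exp (2 * of_real pi * \<i> * of_nat i / of_nat n)"
    by (simp add: w_def root_unity_def cis_conv_exp mult_ac)
  then have "w \<noteq> 1"
    using complex_root_unity_eq_1 [of n i] assms by (auto dest: dvd_imp_le)
  moreover have "(1 - w) * (\<Sum>j<n. w ^ j) = 1 - w ^ n"
    by (rule one_diff_power_eq [symmetric])
  moreover have "w ^ n = 1"
    using assms by (simp add: w_def root_unity_power_eq_1)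
  moreover have "(\<Sum>j<n. root_unity n j ^ i) = (\<Sum>j<n. w ^ j)"
    unfolding w_def by (rule sum.cong [OF refl]) (rule root_unity_power)
  ultimately show ?thesis
    by simp
qed

text \<open>The resolvent equation is iterated \<open>n\<close> times and summed over the nodes. The
  powers strictly between 0 and \<open>n\<close> cancel because the power sums of the roots vanish,
  and every n-th power equals \<open>c ^ n\<close>. Only the equation for \<open>h j\<close> is
  assumed, so \<open>c\<close> may lie inside or outside the disc where the Neumann series
  converges; both cases occur.\<close>

lemma sum_root_unity_resolvent:
  assumes U: "clinear_bdd U" and "0 < n"
    and h: "\<And>j. h j = g + (c * root_unity n j) *\<^sub>C U (h j)"
  shows "(\<Sum>j<n. h j) = of_nat n *\<^sub>C g + c ^ n *\<^sub>C (U ^^ n) (\<Sum>j<n. h j)"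
proof -
  have pow: "clinear_bdd (U ^^ m)" for m
    by (induction m) (auto simp: clinear_bdd_id id_def o_def intro: clinear_bdd_compose [OF U])
  have iterate: "h j = (\<Sum>i<m. (c * root_unity n j) ^ i *\<^sub>C (U ^^ i) g)
      + (c * root_unity n j) ^ m *\<^sub>C (U ^^ m) (h j)" for j m
  proof (induction m)
    case (Suc m)
    have "(U ^^ m) (h j) = (U ^^ m) g + (c * root_unity n j) *\<^sub>C (U ^^ Suc m) (h j)"
      by (subst h) (simp only: clinear_bddD(2,4) [OF pow] funpow_Suc_right o_apply)
    then have "(c * root_unity n j) ^ m *\<^sub>C (U ^^ m) (h j)
        = (c * root_unity n j) ^ m *\<^sub>C (U ^^ m) g + (c * root_unity n j) ^ Suc m *\<^sub>C (U ^^ Suc m) (h j)"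
      by (metis scaleC_add_right scaleC_scaleC power_Suc2)
    with Suc.IH show ?case
      by (simp only: sum.lessThan_Suc add.assoc)
  qed simp
  have "(\<Sum>j<n. h j) = (\<Sum>j<n. (\<Sum>i<n. (c * root_unity n j) ^ i *\<^sub>C (U ^^ i) g)
      + (c * root_unity n j) ^ n *\<^sub>C (U ^^ n) (h j))"
    by (rule sum.cong [OF refl iterate])
  also have "\<dots> = (\<Sum>i<n. (\<Sum>j<n. (c * root_unity n j) ^ i *\<^sub>C (U ^^ i) g))
      + c ^ n *\<^sub>C (U ^^ n) (\<Sum>j<n. h j)"
  proof -
    have "(c * root_unity n j) ^ n = c ^ n" for j
      using \<open>0 < n\<close> by (simp add: power_mult_distrib root_unity_power_eq_1)
    then show ?thesis
      unfolding sum.distrib clinear_bddD(6) [OF pow] scaleC_sum_right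
      by (subst sum.swap) simp
  qed
  also have "(\<Sum>i<n. (\<Sum>j<n. (c * root_unity n j) ^ i *\<^sub>C (U ^^ i) g))
      = (\<Sum>i<n. if i = 0 then of_nat n *\<^sub>C g else 0)"
  proof (rule sum.cong [OF refl])
    fix i assume "i \<in> {..<n}"
    have "(\<Sum>j<n. (c * root_unity n j) ^ i *\<^sub>C (U ^^ i) g)
        = (\<Sum>j<n. (c * root_unity n j) ^ i) *\<^sub>C (U ^^ i) g"
      by (rule scaleC_sum_left [symmetric])
    also have "(\<Sum>j<n. (c * root_unity n j) ^ i) = (if i = 0 then of_nat n else 0)"
      using sum_root_unity_power [of i n] \<open>i \<in> {..<n}\<close>
      by (simp add: power_mult_distrib flip: sum_distrib_left)
    finally show "(\<Sum>j<n. (c * root_unity n j) ^ i *\<^sub>C (U ^^ i) g) = (if i = 0 then of_nat n *\<^sub>C g else 0)"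
      by simp
  qed
  finally show ?thesis
    using \<open>0 < n\<close> by (simp add: sum.delta)
qed

text \<open>A chord is at most as long as its arc.\<close>

lemma norm_cis_diff_le: "cmod (cis a - cis b) \<le> \<bar>a - b\<bar>"
proof -
  have "cis a - cis b = cis b * (exp (\<i> * of_real (a - b)) - 1)"
    by (simp add: cis_conv_exp right_diff_distrib flip: exp_add)
  then have "cmod (cis a - cis b) = cmod (exp (\<i> * of_real (a - b)) - 1)"
    by (simp add: norm_mult)
  also have "\<dots> = 2 * \<bar>sin ((a - b) / 2)\<bar>"
    by (rule dist_exp_i_1)
  also have "\<dots> \<le> \<bar>a - b\<bar>"
    using abs_sin_x_le_abs_x [of "(a - b) / 2"] by simp
  finally show ?thesis .
qed

section \<open>Solid spectral matrix algebras\<close>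

lemma l2_app_lincomb:
  assumes "l2_bounded K X" "c \<in> l2_set K" "d \<in> l2_set K"
  shows "mat_app K X (\<lambda>k. a * c k + b * d k) = (\<lambda>k. a * mat_app K X c k + b * mat_app K X d k)"
  using mat_boundedD(1) [OF assms(1,2)] mat_boundedD(1) [OF assms(1,3)] by (rule mat_app_linear)

locale matrix_algebra =
  fixes K :: "'i set" and \<A> :: "'i mat set" and N :: "'i mat \<Rightarrow> real"
  assumes algebra: "solid_spectral_algebra K \<A> N"
begin

lemma star_algebra: "banach_star_matrix_algebra K \<A> N"
  using algebra by (simp add: solid_spectral_algebra_def)

lemma algebra_conjuncts:
  shows "\<A> \<subseteq> mats K" "mat_id K \<in> \<A>"
    "\<forall>A\<in>\<A>. \<forall>B\<in>\<A>. (\<lambda>k l. A k l + B k l) \<in> \<A> \<and> N (\<lambda>k l. A k l + B k l) \<le> N A + N B"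
    "\<forall>a. \<forall>A\<in>\<A>. (\<lambda>k l. a * A k l) \<in> \<A> \<and> N (\<lambda>k l. a * A k l) = cmod a * N A"
    "\<forall>A\<in>\<A>. 0 \<le> N A \<and> (N A = 0 \<longleftrightarrow> A = (\<lambda>k l. 0))"
    "\<forall>A\<in>\<A>. \<forall>B\<in>\<A>. mat_mult K A B \<in> \<A> \<and> N (mat_mult K A B) \<le> N A * N B"
    "\<forall>A\<in>\<A>. mat_adj A \<in> \<A> \<and> N (mat_adj A) = N A"
  using star_algebra unfolding banach_star_matrix_algebra_def by - (elim conjE, assumption)+

lemma alg_mats: "X \<in> \<A> \<Longrightarrow> X \<in> mats K"
  using algebra_conjuncts(1) by blast

lemmas alg_id = algebra_conjuncts(2)

lemma
  assumes "X \<in> \<A>" "Y \<in> \<A>"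
  shows alg_add: "(\<lambda>k l. X k l + Y k l) \<in> \<A>" and N_add: "N (\<lambda>k l. X k l + Y k l) \<le> N X + N Y"
    and alg_mult: "mat_mult K X Y \<in> \<A>" and N_mult: "N (mat_mult K X Y) \<le> N X * N Y"
  using algebra_conjuncts(3,6) assms by simp_all

lemma
  assumes "X \<in> \<A>"
  shows alg_scale: "(\<lambda>k l. a * X k l) \<in> \<A>" and N_scale: "N (\<lambda>k l. a * X k l) = cmod a * N X"
    and N_nonneg: "0 \<le> N X" and N_eq_0: "N X = 0 \<longleftrightarrow> X = (\<lambda>k l. 0)"
    and alg_adj: "mat_adj X \<in> \<A>"
  using algebra_conjuncts(4,5,7) assms by simp_all

lemma alg_complete:
  fixes X :: "nat \<Rightarrow> 'i mat"
  assumes "\<And>n. X n \<in> \<A>" and "\<And>e. e > 0 \<Longrightarrow> \<exists>n0. \<forall>m\<ge>n0. \<forall>n\<ge>n0. N (\<lambda>k l. X m k l - X n k l) < e"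
  shows "\<exists>Y\<in>\<A>. (\<lambda>n. N (\<lambda>k l. X n k l - Y k l)) \<longlonglongrightarrow> 0"
proof -
  have "\<forall>X::nat \<Rightarrow> 'i mat. (\<forall>n. X n \<in> \<A>) \<and>
        (\<forall>e>0. \<exists>n0. \<forall>m\<ge>n0. \<forall>n\<ge>n0. N (\<lambda>k l. X m k l - X n k l) < e) \<longrightarrow>
        (\<exists>Y\<in>\<A>. (\<lambda>n. N (\<lambda>k l. X n k l - Y k l)) \<longlonglongrightarrow> 0)"
    using star_algebra unfolding banach_star_matrix_algebra_def by (elim conjE)
  from this [rule_format, of X] show ?thesis
    using assms by simp
qed

lemma alg_l2: "X \<in> \<A> \<Longrightarrow> l2_bounded K X"
  and alg_inverse: "X \<in> \<A> \<Longrightarrow> Y \<in> mats K \<Longrightarrow> l2_bounded K Y \<Longrightarrow>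
      (\<And>c. c \<in> l2_set K \<Longrightarrow> mat_app K X (mat_app K Y c) = c) \<Longrightarrow>
      (\<And>c. c \<in> l2_set K \<Longrightarrow> mat_app K Y (mat_app K X c) = c) \<Longrightarrow> Y \<in> \<A>"
  and alg_solid: "X \<in> \<A> \<Longrightarrow> Y \<in> mats K \<Longrightarrow> (\<And>k l. cmod (Y k l) \<le> cmod (X k l)) \<Longrightarrow> Y \<in> \<A>"
  and N_solid: "X \<in> \<A> \<Longrightarrow> Y \<in> mats K \<Longrightarrow> (\<And>k l. cmod (Y k l) \<le> cmod (X k l)) \<Longrightarrow> N Y \<le> N X"
  using algebra unfolding solid_spectral_algebra_def by blast+

lemma alg_lincomb: "X \<in> \<A> \<Longrightarrow> Y \<in> \<A> \<Longrightarrow> (\<lambda>k l. a * X k l + b * Y k l) \<in> \<A>"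
  by (intro alg_add alg_scale)

lemma N_lincomb:
  "X \<in> \<A> \<Longrightarrow> Y \<in> \<A> \<Longrightarrow> N (\<lambda>k l. a * X k l + b * Y k l) \<le> cmod a * N X + cmod b * N Y"
  using N_add [OF alg_scale alg_scale, of X Y a b] by (simp add: N_scale)

lemma alg_diff: "X \<in> \<A> \<Longrightarrow> Y \<in> \<A> \<Longrightarrow> (\<lambda>k l. X k l - Y k l) \<in> \<A>"
  using alg_lincomb [of X Y 1 "-1"] by simp

lemma N_diff_commute: "X \<in> \<A> \<Longrightarrow> Y \<in> \<A> \<Longrightarrow> N (\<lambda>k l. X k l - Y k l) = N (\<lambda>k l. Y k l - X k l)"
  using N_scale [OF alg_diff, of X Y "-1"] by simp

lemma alg_zero: "(\<lambda>k l. 0) \<in> \<A>"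
  using alg_scale [OF alg_id, of 0] by simp

lemma N_zero: "N (\<lambda>k l. 0) = 0"
  using N_eq_0 [OF alg_zero] by simp

lemma alg_sum:
  assumes "\<And>j. j \<in> J \<Longrightarrow> X j \<in> \<A>"
  shows "(\<lambda>k l. \<Sum>j\<in>J. X j k l) \<in> \<A>" and "N (\<lambda>k l. \<Sum>j\<in>J. X j k l) \<le> (\<Sum>j\<in>J. N (X j))"
proof -
  have "(\<lambda>k l. \<Sum>j\<in>J. X j k l) \<in> \<A> \<and> N (\<lambda>k l. \<Sum>j\<in>J. X j k l) \<le> (\<Sum>j\<in>J. N (X j))"
    using assms
  proof (induction J rule: infinite_finite_induct)
    case (insert j J)
    then have "X j \<in> \<A>" "(\<lambda>k l. \<Sum>j\<in>J. X j k l) \<in> \<A>"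
      by simp_all
    from alg_add [OF this] N_add [OF this] insert show ?case
      by simp
  qed (simp_all add: alg_zero N_zero)
  then show "(\<lambda>k l. \<Sum>j\<in>J. X j k l) \<in> \<A>" "N (\<lambda>k l. \<Sum>j\<in>J. X j k l) \<le> (\<Sum>j\<in>J. N (X j))"
    by auto
qed

text \<open>By solidity the matrix whose single entry is \<open>X k l\<close> has norm at most
  \<open>N X\<close>. If the matrix unit belongs to the algebra, that norm is
  \<open>cmod (X k l)\<close> times a positive constant; if it does not, all matrices of the algebra
  vanish at this position.\<close>

lemma entry_bound: "\<exists>C. \<forall>X\<in>\<A>. cmod (X k l) \<le> C * N X"
proof -
  define E :: "'i mat" where "E = (\<lambda>i j. if i = k \<and> j = l then 1 else 0)"
  have E: "(\<lambda>i j. X k l * E i j) \<in> \<A>" "N (\<lambda>i j. X k l * E i j) \<le> N X" if "X \<in> \<A>" for X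
    using alg_mats [OF that]
    by (auto intro!: alg_solid [OF that] N_solid [OF that] simp: E_def mats_def)
  show ?thesis
  proof (cases "E \<in> \<A>")
    case True
    then have pos: "0 < N E"
      using N_nonneg [of E] N_eq_0 [of E] by (auto simp: less_le E_def fun_eq_iff)
    have "cmod (X k l) \<le> (1 / N E) * N X" if "X \<in> \<A>" for X
      using E(2) [OF that] N_scale [OF True, of "X k l"] pos by (simp add: field_simps)
    then show ?thesis
      by blast
  next
    case False
    have "X k l = 0" if "X \<in> \<A>" for X
    proof (rule ccontr)
      assume "X k l \<noteq> 0"
      then have "E = (\<lambda>i j. (1 / X k l) * (X k l * E i j))"
        by (simp add: fun_eq_iff)
      with alg_scale [OF E(1) [OF that], of "1 / X k l"] False show False
        by simp
    qed
    then show ?thesis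
      by (intro exI [of _ 0]) simp
  qed
qed

lemma entry_tendsto:
  assumes "\<And>n. X n \<in> \<A>" "Y \<in> \<A>" "(\<lambda>n. N (\<lambda>k l. X n k l - Y k l)) \<longlonglongrightarrow> 0"
  shows "(\<lambda>n. X n k l) \<longlonglongrightarrow> Y k l"
proof -
  obtain C where C: "\<And>Z. Z \<in> \<A> \<Longrightarrow> cmod (Z k l) \<le> C * N Z"
    using entry_bound [of k l] by blast
  have "(\<lambda>n. X n k l - Y k l) \<longlonglongrightarrow> 0"
  proof (rule Lim_null_comparison)
    show "\<forall>\<^sub>F n in sequentially. cmod (X n k l - Y k l) \<le> C * N (\<lambda>k l. X n k l - Y k l)"
      using C [OF alg_diff [OF assms(1,2)]] by (intro always_eventually) simp
    show "(\<lambda>n. C * N (\<lambda>k l. X n k l - Y k l)) \<longlonglongrightarrow> 0"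
      using tendsto_mult_right_zero [OF assms(3)] .
  qed
  then show ?thesis
    by (rule LIM_zero_cancel)
qed

text \<open>The averages of the resolvent over roots of unity are Riemann sums of a Cauchy integral; they
  converge in the algebra because the resolvent is Lipschitz on the circle in the norm of the
  algebra.\<close>

lemma resolvent_averages:
  assumes X: "X \<in> \<A>" and F: "\<And>z. cmod z = 1 \<Longrightarrow> F z \<in> \<A>"
    and left: "\<And>z c. cmod z = 1 \<Longrightarrow> c \<in> l2_set K \<Longrightarrow> mat_app K (F z) (\<lambda>k. c k - z * mat_app K X c k) = c"
    and right: "\<And>z c k. cmod z = 1 \<Longrightarrow> c \<in> l2_set K \<Longrightarrow>
        mat_app K (F z) c k - z * mat_app K X (mat_app K (F z) c) k = c k"
  shows "\<exists>Y\<in>\<A>. \<forall>k l. (\<lambda>m. (\<Sum>j<2 ^ m. F (root_unity (2 ^ m) j) k l) / 2 ^ m) \<longlonglongrightarrow> Y k l"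
proof -
  \<comment> \<open>Resolvent identity F z - F z' = (z - z') F z X F z', checked on columns. With
    \<open>v\<close> the column of F z', the unit sequence is (1 - z' X) v, which is split as (1 - z
    X) v + (z - z') X v before F z is applied.\<close>
  have resolvent: "F z k l = 1 * F z' k l + (z - z') * mat_mult K (F z) (mat_mult K X (F z')) k l"
    if z: "cmod z = 1" "cmod z' = 1" for z z' k l
  proof (cases "l \<in> K")
    case True
    define v where "v = mat_app K (F z') (unit_seq l)"
    have v: "v \<in> l2_set K"
      unfolding v_def using mat_boundedD(2) [OF alg_l2 [OF F [OF z(2)]]] unit_seq_l2 [OF True] by blast
    have Xv: "mat_app K X v \<in> l2_set K"
      using mat_boundedD(2) [OF alg_l2 [OF X]] v by blast
    have col: "(\<lambda>j. F z' j l) = v"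
      unfolding v_def using mat_app_unit_seq [OF alg_mats [OF F [OF z(2)]] True] by simp
    have vX: "(\<lambda>j. 1 * v j + (- z) * mat_app K X v j) \<in> l2_set K"
      by (rule l2_lincomb [OF v Xv])
    have "unit_seq l = (\<lambda>j. 1 * (1 * v j + (- z) * mat_app K X v j) + (z - z') * mat_app K X v j)"
      using right [OF z(2) unit_seq_l2 [OF True]] by (simp add: fun_eq_iff v_def [symmetric] algebra_simps)
    then have "mat_app K (F z) (unit_seq l) = (\<lambda>k. 1 * mat_app K (F z) (\<lambda>j. 1 * v j + (- z) * mat_app K X v j) k
        + (z - z') * mat_app K (F z) (mat_app K X v) k)"
      using l2_app_lincomb [OF alg_l2 [OF F [OF z(1)]] vX Xv] by metis
    also have "mat_app K (F z) (\<lambda>j. 1 * v j + (- z) * mat_app K X v j) = v"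
      using left [OF z(1) v] by simp
    finally show ?thesis
      using mat_app_unit_seq [OF alg_mats [OF F [OF z(1)]] True] True
      by (simp add: mat_mult_conv_app col fun_cong [OF col] fun_eq_iff)
  next
    case False
    then show ?thesis
      using alg_mats [OF F [OF z(1)]] alg_mats [OF F [OF z(2)]] by (simp add: mats_def mat_mult_def)
  qed
  define D where "D z' = N X * N (F z')" for z'
  have prod: "mat_mult K (F z) (mat_mult K X (F z')) \<in> \<A>"
    "N (mat_mult K (F z) (mat_mult K X (F z'))) \<le> N (F z) * D z'"
    if z: "cmod z = 1" "cmod z' = 1" for z z'
  proof -
    note * = X F [OF z(1)] F [OF z(2)]
    show "mat_mult K (F z) (mat_mult K X (F z')) \<in> \<A>"
      by (intro alg_mult *)
    have "N (mat_mult K (F z) (mat_mult K X (F z'))) \<le> N (F z) * N (mat_mult K X (F z'))"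
      by (intro N_mult alg_mult *)
    also have "\<dots> \<le> N (F z) * D z'"
      unfolding D_def by (intro mult_left_mono N_mult N_nonneg *)
    finally show "N (mat_mult K (F z) (mat_mult K X (F z'))) \<le> N (F z) * D z'" .
  qed
  have step: "N (F z) \<le> N (F z') + cmod (z - z') * (N (F z) * D z')"
    if z: "cmod z = 1" "cmod z' = 1" for z z'
  proof -
    have eq: "F z = (\<lambda>k l. 1 * F z' k l + (z - z') * mat_mult K (F z) (mat_mult K X (F z')) k l)"
      using resolvent [OF z] by (intro ext)
    have "N (F z) \<le> cmod 1 * N (F z') + cmod (z - z') * N (mat_mult K (F z) (mat_mult K X (F z')))"
      by (subst eq) (rule N_lincomb [OF F [OF z(2)] prod(1) [OF z]])
    also have "\<dots> \<le> N (F z') + cmod (z - z') * (N (F z) * D z')"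
      using prod(2) [OF z] by (simp add: mult_left_mono)
    finally show ?thesis .
  qed
  \<comment> \<open>If \<open>z\<close> is close to a fixed \<open>l\<close>, the factor
    \<open>cmod (z - l) * D l\<close> drops below 1/2 and the term with N (F z) is absorbed into the
    left side of \<open>step\<close>. Compactness of the circle makes this local bound
    global.\<close>
  have "\<exists>M. \<forall>z. cmod z = 1 \<longrightarrow> N (F z) \<le> M"
  proof (rule ccontr)
    assume "\<not> ?thesis"
    then have "\<forall>n::nat. \<exists>z. cmod z = 1 \<and> real n < N (F z)"
      by (meson not_le)
    then obtain z where z: "\<And>n::nat. cmod (z n) = 1" "\<And>n. real n < N (F (z n))"
      by metis
    have "seq_compact (sphere 0 1 :: complex set)"
      by (rule compact_imp_seq_compact) simp
    then obtain l r where l: "cmod l = 1" "strict_mono r" "(z \<circ> r) \<longlonglongrightarrow> l"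
      using z(1) by (elim seq_compactE [of _ z]) auto
    have lim: "(\<lambda>n. z (r n)) \<longlonglongrightarrow> l"
      using l(3) by (simp add: o_def)
    have "((\<lambda>n. cmod (z (r n) - l) * D l) \<longlongrightarrow> 0) sequentially"
      using lim by (auto intro!: tendsto_mult_left_zero tendsto_norm_zero LIM_zero)
    then have "\<forall>\<^sub>F n in sequentially. cmod (z (r n) - l) * D l < 1 / 2"
      by (rule order_tendstoD) simp
    moreover have "\<forall>\<^sub>F n in sequentially. 2 * N (F l) < real n"
      using filterlim_real_sequentially by (simp add: filterlim_at_top_dense)
    ultimately have "\<forall>\<^sub>F n in sequentially. False"
    proof eventually_elim
      case (elim n)
      let ?a = "N (F (z (r n)))"
      have "?a \<le> N (F l) + ?a * (cmod (z (r n) - l) * D l)"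
        using step [OF z(1) l(1), of "r n"] by (simp add: mult_ac)
      also have "\<dots> \<le> N (F l) + ?a * (1 / 2)"
        using elim(1) N_nonneg [OF F [OF z(1) [of "r n"]]] by (intro add_left_mono mult_left_mono) auto
      finally have "?a \<le> 2 * N (F l)"
        by simp
      moreover have "real n \<le> real (r n)"
        using seq_suble [OF l(2)] by simp
      ultimately show False
        using z(2) [of "r n"] elim(2) by linarith
    qed
    then show False
      by simp
  qed
  then obtain M where M: "\<And>z. cmod z = 1 \<Longrightarrow> N (F z) \<le> M"
    by blast
  have M0: "0 \<le> M"
    using M [of 1] N_nonneg [OF F, of 1] by simp
  define L where "L = M * (N X * M)"
  have L0: "0 \<le> L"
    using M0 N_nonneg [OF X] by (simp add: L_def)
  have lipschitz: "N (\<lambda>k l. F z k l - F z' k l) \<le> L * cmod (z - z')"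
    if z: "cmod z = 1" "cmod z' = 1" for z z'
  proof -
    have "(\<lambda>k l. F z k l - F z' k l) = (\<lambda>k l. (z - z') * mat_mult K (F z) (mat_mult K X (F z')) k l)"
      using resolvent [OF z] by (intro ext) (metis add_diff_cancel_left' mult_1)
    then have "N (\<lambda>k l. F z k l - F z' k l) \<le> cmod (z - z') * (N (F z) * D z')"
      using prod [OF z] by (simp add: N_scale mult_left_mono)
    also have "\<dots> \<le> cmod (z - z') * L"
      unfolding L_def D_def
      using M [OF z(1)] M [OF z(2)] N_nonneg [OF X] N_nonneg [OF F [OF z(1)]] N_nonneg [OF F [OF z(2)]] M0
      by (intro mult_left_mono mult_mono) auto
    finally show ?thesis
      by (simp add: mult.commute)
  qed
  define E where "E m k l = (\<Sum>j<2 ^ m. F (root_unity (2 ^ m) j) k l) / 2 ^ m" for m :: nat and k l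
  have E: "E m \<in> \<A>" for m
    using alg_scale [OF alg_sum(1) [of "{..<2 ^ m}" "\<lambda>j. F (root_unity (2 ^ m) j)"], of "1 / 2 ^ m"] F
    by (simp add: E_def [abs_def])
  \<comment> \<open>The nodes of level m are the even nodes of level m + 1. The two averages
    therefore differ by half the mean of the increments from each even node to the next odd one, at
    arc distance pi / 2^m.\<close>
  have dyadic: "N (\<lambda>k l. E (Suc m) k l - E m k l) \<le> L * pi / 2 ^ Suc m" for m
  proof -
    let ?n = "2 ^ m :: nat"
    let ?G = "\<lambda>j k l. F (root_unity (2 * ?n) (2 * j + 1)) k l - F (root_unity (2 * ?n) (2 * j)) k l"
    have split: "(\<Sum>j<2 * n. g j) = (\<Sum>j<n. g (2 * j + 1) + g (2 * j))" for g :: "nat \<Rightarrow> complex" and n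
      by (induction n) (auto simp: algebra_simps)
    have even: "root_unity ?n j = root_unity (2 * ?n) (2 * j)" for j
      by (simp add: root_unity_def mult_ac)
    have "E (Suc m) k l - E m k l = (1 / 2 ^ Suc m) * (\<Sum>j<?n. ?G j k l)" for k l
    proof -
      have "E (Suc m) k l = (1 / 2 ^ Suc m) * (\<Sum>j<?n. F (root_unity (2 * ?n) (2 * j + 1)) k l + F (root_unity (2 * ?n) (2 * j)) k l)"
        unfolding E_def power_Suc split by simp
      moreover have "E m k l = (1 / 2 ^ Suc m) * (\<Sum>j<?n. 2 * F (root_unity (2 * ?n) (2 * j)) k l)"
        unfolding E_def even sum_distrib_left [symmetric] by simp
      ultimately show ?thesis
        by (simp only: right_diff_distrib [symmetric] sum_subtractf [symmetric]) (simp add: algebra_simps)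
    qed
    then have "N (\<lambda>k l. E (Suc m) k l - E m k l) = N (\<lambda>k l. (1 / 2 ^ Suc m) * (\<Sum>j<?n. ?G j k l))"
      by simp
    also have "\<dots> = cmod (1 / 2 ^ Suc m) * N (\<lambda>k l. \<Sum>j<?n. ?G j k l)"
      by (intro N_scale alg_sum alg_diff F) simp_all
    also have "\<dots> \<le> cmod (1 / 2 ^ Suc m) * (\<Sum>j<?n. N (?G j))"
      by (intro mult_left_mono alg_sum alg_diff F) simp_all
    also have "\<dots> \<le> cmod (1 / 2 ^ Suc m) * (\<Sum>j<?n. L * (pi / 2 ^ m))"
    proof (intro mult_left_mono sum_mono)
      fix j
      have "N (?G j) \<le> L * cmod (root_unity (2 * ?n) (2 * j + 1) - root_unity (2 * ?n) (2 * j))"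
        by (rule lipschitz) simp_all
      also have "\<dots> \<le> L * \<bar>2 * pi * real (2 * j + 1) / real (2 * ?n) - 2 * pi * real (2 * j) / real (2 * ?n)\<bar>"
        unfolding root_unity_def by (intro mult_left_mono norm_cis_diff_le L0)
      also have "2 * pi * real (2 * j + 1) / real (2 * ?n) - 2 * pi * real (2 * j) / real (2 * ?n) = pi / 2 ^ m"
        by (simp add: field_simps)
      finally show "N (?G j) \<le> L * (pi / 2 ^ m)"
        by simp
    qed simp
    also have "\<dots> = L * pi / 2 ^ Suc m"
      by (simp add: norm_divide norm_power)
    finally show ?thesis .
  qed
  define c where "c = L * pi / 2"
  have c0: "0 \<le> c"
    using L0 by (simp add: c_def)
  \<comment> \<open>The right side is the closed form of the sum of c / 2^i over m \<le> i < m + d,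
    where c / 2^i is the increment bound of \<open>dyadic\<close> at level i.\<close>
  have tail: "N (\<lambda>k l. E (m + d) k l - E m k l) \<le> 2 * c / 2 ^ m * (1 - 1 / 2 ^ d)" for m d
  proof (induction d)
    case (Suc d)
    have eq: "(\<lambda>k l. E (m + Suc d) k l - E m k l)
        = (\<lambda>k l. (E (Suc (m + d)) k l - E (m + d) k l) + (E (m + d) k l - E m k l))"
      by simp
    have "N (\<lambda>k l. E (m + Suc d) k l - E m k l)
        \<le> N (\<lambda>k l. E (Suc (m + d)) k l - E (m + d) k l) + N (\<lambda>k l. E (m + d) k l - E m k l)"
      unfolding eq by (rule N_add [OF alg_diff [OF E E] alg_diff [OF E E]])
    also have "\<dots> \<le> c / 2 ^ (m + d) + 2 * c / 2 ^ m * (1 - 1 / 2 ^ d)"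
      using dyadic [of "m + d"] Suc by (intro add_mono) (simp_all add: c_def)
    also have "\<dots> = 2 * c / 2 ^ m * (1 - 1 / 2 ^ Suc d)"
      by (simp add: field_simps power_add)
    finally show ?case .
  qed (simp add: N_zero)
  have tail': "N (\<lambda>k l. E n k l - E m k l) \<le> 2 * c / 2 ^ m" if "m \<le> n" for m n
  proof -
    have "N (\<lambda>k l. E n k l - E m k l) \<le> 2 * c / 2 ^ m * (1 - 1 / 2 ^ (n - m))"
      using tail [of m "n - m"] that by simp
    also have "\<dots> \<le> 2 * c / 2 ^ m * 1"
      using c0 by (intro mult_left_mono) auto
    finally show ?thesis by simp
  qed
  have "\<exists>Y\<in>\<A>. (\<lambda>n. N (\<lambda>k l. E n k l - Y k l)) \<longlonglongrightarrow> 0"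
  proof (rule alg_complete [OF E])
    fix e :: real assume "e > 0"
    have "(\<lambda>m. 2 * c * (1 / 2) ^ m) \<longlonglongrightarrow> 0"
      by (intro tendsto_mult_right_zero LIMSEQ_realpow_zero) simp_all
    then have "\<forall>\<^sub>F m in sequentially. 2 * c * (1 / 2) ^ m < e"
      using \<open>e > 0\<close> by (rule order_tendstoD)
    then obtain n0 where n0: "\<And>m. n0 \<le> m \<Longrightarrow> 2 * c / 2 ^ m < e"
      by (auto simp: eventually_sequentially power_one_over field_simps)
    have "N (\<lambda>k l. E m k l - E n k l) < e" if "n0 \<le> m" "n0 \<le> n" for m n
    proof (cases "m \<le> n")
      case True
      then show ?thesis
        using tail' [OF True] n0 [OF that(1)] by (simp add: N_diff_commute [OF E E, of m n])
    next
      case False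
      then show ?thesis
        using tail' [of n m] n0 [OF that(2)] by simp
    qed
    then show "\<exists>n0. \<forall>m\<ge>n0. \<forall>n\<ge>n0. N (\<lambda>k l. E m k l - E n k l) < e"
      by blast
  qed
  then obtain Y where "Y \<in> \<A>" "(\<lambda>n. N (\<lambda>k l. E n k l - Y k l)) \<longlonglongrightarrow> 0"
    by blast
  then show ?thesis
    using entry_tendsto [of E Y] E unfolding E_def by blast
qed

end

section \<open>The canonical dual of a localized frame\<close>

context frame_bounds
begin

abbreviation analysis\<^sub>\<Psi> where "analysis\<^sub>\<Psi> \<equiv> analysis K \<Psi>"
abbreviation synthesis\<^sub>\<Psi> where "synthesis\<^sub>\<Psi> \<equiv> synthesis K \<Psi>"

lemmas analysis_l2 = bessel_analysis(1) [OF bessel]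
lemmas synthesis_lin = synthesis_lincomb [OF bessel]

lemma mat_app_gram_op:
  "clinear_bdd U \<Longrightarrow> c \<in> l2_set K \<Longrightarrow>
     mat_app K (gram K \<Psi> (\<lambda>j. U (\<Psi> j))) c = analysis\<^sub>\<Psi> (U (synthesis\<^sub>\<Psi> c))"
  by (rule mat_app_gram [OF _ bessel])

lemma l2_bounded_gram_op: "clinear_bdd U \<Longrightarrow> l2_bounded K (gram K \<Psi> (\<lambda>j. U (\<Psi> j)))"
  by (rule l2_bounded_gram [OF _ bessel bessel])

lemma analysis_diff: "analysis\<^sub>\<Psi> (f - g) = (\<lambda>k. analysis\<^sub>\<Psi> f k - analysis\<^sub>\<Psi> g k)"
  by (auto simp: analysis_def cinner_diff_left)

section \<open>The resolvent of the Gram matrix on a separating circle\<close>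

text \<open>Midpoint of \<rho> and 1. The circle of this radius encloses the spectrum of R, which
  lies in the disc of radius \<rho>, and leaves outside the value 1 that 1 - t G takes on the kernel
  of the Gram matrix G.\<close>

definition radius where "radius = (1 + \<rho>) / 2"

lemma radius: "\<rho> < radius" "0 < radius" "radius < 1" "\<rho> / radius < 1"
proof -
  show 1: "\<rho> < radius" "0 < radius" "radius < 1"
    using \<rho> by (auto simp: radius_def)
  show "\<rho> / radius < 1"
    using 1 by simp
qed

definition Qinv where "Qinv \<mu> = neumann_inv (\<lambda>x. \<mu> *\<^sub>C R x)"

lemma Qinv_eq: "cmod \<mu> * \<rho> < 1 \<Longrightarrow> Qinv \<mu> g = g + \<mu> *\<^sub>C R (Qinv \<mu> g)"
  using strict_contraction.eq [OF contraction, of \<mu> g] unfolding Qinv_def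
  by (metis add.commute diff_add_cancel)

lemma Qinv_left: "cmod \<mu> * \<rho> < 1 \<Longrightarrow> Qinv \<mu> (f - \<mu> *\<^sub>C R f) = f"
  unfolding Qinv_def by (rule strict_contraction.inv_left [OF contraction])

lemma clinear_Qinv: "cmod \<mu> * \<rho> < 1 \<Longrightarrow> clinear_bdd (Qinv \<mu>)"
  unfolding Qinv_def by (rule strict_contraction.clinear_bdd_inv [OF contraction])

lemma R_S: "f - \<mu> *\<^sub>C R f = (1 - \<mu>) *\<^sub>C f + (\<mu> * complex_of_real t) *\<^sub>C S f"
  by (simp add: R_def scaleC_diff_right scaleC_diff_left scaleC_scaleC)

text \<open>The resolvent of the Gram matrix, written through the resolvent of the frame operator.\<close>

definition res_mat :: "complex \<Rightarrow> 'i mat" where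
  "res_mat \<mu> = (\<lambda>k l. (1 / (1 - \<mu>)) * mat_id K k l
     + (- (\<mu> * complex_of_real t) / (1 - \<mu>)) * gram K \<Psi> (\<lambda>j. Qinv \<mu> (\<Psi> j)) k l)"

lemma res_mat:
  assumes "cmod \<mu> * \<rho> < 1"
  shows "res_mat \<mu> \<in> mats K" "l2_bounded K (res_mat \<mu>)"
    "c \<in> l2_set K \<Longrightarrow> mat_app K (res_mat \<mu>) c = (\<lambda>k. (1 / (1 - \<mu>)) * c k
       + (- (\<mu> * complex_of_real t) / (1 - \<mu>)) * analysis\<^sub>\<Psi> (Qinv \<mu> (synthesis\<^sub>\<Psi> c)) k)"
proof -
  note U = clinear_Qinv [OF assms]
  show "res_mat \<mu> \<in> mats K"
    by (auto simp: res_mat_def mats_def mat_id_def gram_def)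
  show "l2_bounded K (res_mat \<mu>)"
    unfolding res_mat_def by (intro l2_bounded_lincomb l2_bounded_id l2_bounded_gram_op U)
  assume c: "c \<in> l2_set K"
  show "mat_app K (res_mat \<mu>) c = (\<lambda>k. (1 / (1 - \<mu>)) * c k
       + (- (\<mu> * complex_of_real t) / (1 - \<mu>)) * analysis\<^sub>\<Psi> (Qinv \<mu> (synthesis\<^sub>\<Psi> c)) k)"
    unfolding res_mat_def
    using mat_boundedD(1) [OF l2_bounded_id c] mat_boundedD(1) [OF l2_bounded_gram_op [OF U] c]
    by (subst mat_app_lincomb) (auto simp: mat_app_gram_op [OF U c] mat_app_id [OF lp_set_seqs [OF c]])
qed

text \<open>With G the Gram matrix this is (1 - t G) / radius. The matrix 1 - t G is what R becomes
  on analysis coefficients, and the division rescales the separating circle to the unit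
  circle.\<close>

definition gram_step :: "'i mat" where
  "gram_step = (\<lambda>k l. (1 / complex_of_real radius) * mat_id K k l
     + (- complex_of_real t / complex_of_real radius) * gram K \<Psi> \<Psi> k l)"

lemma mat_app_gram_step:
  assumes c: "c \<in> l2_set K"
  shows "mat_app K gram_step c = (\<lambda>k. (1 / complex_of_real radius) * c k
     + (- complex_of_real t / complex_of_real radius) * analysis\<^sub>\<Psi> (synthesis\<^sub>\<Psi> c) k)"
  unfolding gram_step_def
  using mat_boundedD(1) [OF l2_bounded_id c] mat_boundedD(1) [OF l2_bounded_gram_op [OF clinear_bdd_id] c]
    mat_app_gram_op [OF clinear_bdd_id c]
  by (subst mat_app_lincomb) (auto simp: mat_app_id [OF lp_set_seqs [OF c]])

text \<open>The modulus of \<mu> is 1 / radius. It exceeds 1, so 1 - \<mu> cannot vanish, while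
  \<rho> < radius keeps \<mu> R a strict contraction.\<close>

lemma circle:
  assumes "cmod z = 1" "\<mu> = z / complex_of_real radius"
  shows "cmod \<mu> * \<rho> < 1" "1 - \<mu> \<noteq> 0"
    "c \<in> l2_set K \<Longrightarrow> z * mat_app K gram_step c k
       = \<mu> * (c k - complex_of_real t * analysis\<^sub>\<Psi> (synthesis\<^sub>\<Psi> c) k)"
proof -
  have n: "cmod \<mu> = 1 / radius"
    using assms radius by (simp add: norm_divide)
  show "cmod \<mu> * \<rho> < 1"
    using radius by (simp add: n)
  show "1 - \<mu> \<noteq> 0"
    using n radius by auto
  assume c: "c \<in> l2_set K"
  show "z * mat_app K gram_step c k = \<mu> * (c k - complex_of_real t * analysis\<^sub>\<Psi> (synthesis\<^sub>\<Psi> c) k)"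
    using radius by (simp add: assms(2) mat_app_gram_step [OF c] field_simps)
qed

text \<open>Write C for analysis and D for synthesis. The matrix to be inverted is (1 - \<mu>) +
  \<mu> t C D, and D intertwines it with (1 - \<mu>) + \<mu> t S = 1 - \<mu> R, because S = D C.
  This is the push-through formula for the inverse of a + b C D.\<close>

lemma res_mat_left:
  assumes z: "cmod z = 1" and c: "c \<in> l2_set K"
  shows "mat_app K (res_mat (z / complex_of_real radius)) (\<lambda>k. c k - z * mat_app K gram_step c k) = c"
proof -
  define \<mu> where "\<mu> = z / complex_of_real radius"
  note \<mu> = circle [OF z \<mu>_def]
  define d where "d = (\<lambda>k. (1 - \<mu>) * c k + (\<mu> * complex_of_real t) * analysis\<^sub>\<Psi> (synthesis\<^sub>\<Psi> c) k)"
  have eq: "(\<lambda>k. c k - z * mat_app K gram_step c k) = d"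
    unfolding \<mu>(3) [OF c] d_def by (simp add: algebra_simps)
  have d: "d \<in> l2_set K"
    unfolding d_def by (rule l2_lincomb [OF c analysis_l2])
  have "synthesis\<^sub>\<Psi> d = synthesis\<^sub>\<Psi> c - \<mu> *\<^sub>C R (synthesis\<^sub>\<Psi> c)"
    unfolding d_def R_S by (simp add: synthesis_lin [OF c analysis_l2] synthesis_analysis)
  then have "Qinv \<mu> (synthesis\<^sub>\<Psi> d) = synthesis\<^sub>\<Psi> c"
    by (simp add: Qinv_left [OF \<mu>(1)])
  then have "mat_app K (res_mat \<mu>) d = (\<lambda>k. (1 / (1 - \<mu>)) * d k
       + (- (\<mu> * complex_of_real t) / (1 - \<mu>)) * analysis\<^sub>\<Psi> (synthesis\<^sub>\<Psi> c) k)"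
    using res_mat(3) [OF \<mu>(1) d] by simp
  also have "\<dots> = c"
    using \<mu>(2) by (simp add: d_def fun_eq_iff divide_simps)
  finally have "mat_app K (res_mat \<mu>) d = c" .
  then show ?thesis
    by (simp add: eq \<mu>_def)
qed

lemma res_mat_right:
  assumes z: "cmod z = 1" and c: "c \<in> l2_set K"
  defines "\<mu> \<equiv> z / complex_of_real radius"
  shows "mat_app K (res_mat \<mu>) c k - z * mat_app K gram_step (mat_app K (res_mat \<mu>) c) k = c k"
proof -
  have "\<mu> = z / complex_of_real radius" by (simp add: \<mu>_def)
  note \<mu> = circle [OF z this]
  define h where "h = Qinv \<mu> (synthesis\<^sub>\<Psi> c)"
  define d where "d = mat_app K (res_mat \<mu>) c"
  define a where "a = 1 / (1 - \<mu>)"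
  have d_eq: "d = (\<lambda>k. a * c k + (- (\<mu> * complex_of_real t) * a) * analysis\<^sub>\<Psi> h k)"
    unfolding d_def res_mat(3) [OF \<mu>(1) c] h_def a_def by simp
  have d: "d \<in> l2_set K"
    unfolding d_eq by (rule l2_lincomb [OF c analysis_l2])
  have h: "synthesis\<^sub>\<Psi> c = (1 - \<mu>) *\<^sub>C h + (\<mu> * complex_of_real t) *\<^sub>C S h"
    using Qinv_eq [OF \<mu>(1), of "synthesis\<^sub>\<Psi> c"] unfolding h_def [symmetric] R_S [symmetric]
    by (simp add: algebra_simps)
  have "synthesis\<^sub>\<Psi> d = h"
  proof -
    have "synthesis\<^sub>\<Psi> d = (a * (1 - \<mu>)) *\<^sub>C h + (a * (\<mu> * complex_of_real t) + - (\<mu> * complex_of_real t) * a) *\<^sub>C S h"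
      unfolding d_eq synthesis_lin [OF c analysis_l2] synthesis_analysis h
      by (simp only: scaleC_add_left scaleC_add_right scaleC_scaleC add.assoc)
    also have "a * (1 - \<mu>) = 1"
      using \<mu>(2) by (simp add: a_def)
    also have "a * (\<mu> * complex_of_real t) + - (\<mu> * complex_of_real t) * a = 0"
      by simp
    finally show ?thesis
      by simp
  qed
  then have "d k - z * mat_app K gram_step d k = (1 - \<mu>) * d k + (\<mu> * complex_of_real t) * analysis\<^sub>\<Psi> h k"
    unfolding \<mu>(3) [OF d] by (simp add: algebra_simps)
  also have "\<dots> = c k"
    using \<mu>(2) by (simp add: d_eq a_def divide_simps)
  finally show ?thesis
    by (simp add: d_def)
qed

text \<open>Separates the two spectral parts: the scalar 1 / (1 - \<mu>) on the complementary
  projection 1 - P, and the resolvent of R on the range of P. Their averages behave in opposite ways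
  and are computed independently.\<close>

lemma res_mat_entry:
  assumes "cmod \<mu> * \<rho> < 1" "1 - \<mu> \<noteq> 0" and kl: "k \<in> K" "l \<in> K"
  shows "res_mat \<mu> k l = (1 / (1 - \<mu>)) * (mat_id K k l - cinner (Sinv (\<Psi> l)) (\<Psi> k))
     + cinner (Sinv (Qinv \<mu> (\<Psi> l))) (\<Psi> k)"
proof -
  define h where "h = Qinv \<mu> (\<Psi> l)"
  have "\<Psi> l = (1 - \<mu>) *\<^sub>C h + (\<mu> * complex_of_real t) *\<^sub>C S h"
    using Qinv_eq [OF assms(1), of "\<Psi> l"] unfolding h_def [symmetric] R_S [symmetric]
    by (simp add: algebra_simps)
  then have "Sinv (\<Psi> l) = (1 - \<mu>) *\<^sub>C Sinv h + (\<mu> * complex_of_real t) *\<^sub>C h"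
    using clinear_bddD(2,4) [OF clinear_Sinv] by (metis Sinv_S)
  then have "cinner (Sinv (\<Psi> l)) (\<Psi> k)
      = (1 - \<mu>) * cinner (Sinv h) (\<Psi> k) + (\<mu> * complex_of_real t) * cinner h (\<Psi> k)"
    by (simp add: cinner_add_left cinner_scaleC_left)
  then show ?thesis
    using assms(2) kl by (simp add: res_mat_def gram_def h_def [symmetric] divide_simps)
qed

section \<open>Averages over the circle\<close>

text \<open>Here \<open>c\<close> has modulus greater than 1, so the average 1 / (1 - c^n) tends to
  0: the part on the kernel disappears.\<close>

lemma circle_average_scalar:
  "(\<lambda>m. (\<Sum>j<2 ^ m. 1 / (1 - root_unity (2 ^ m) j / complex_of_real radius)) / 2 ^ m) \<longlonglongrightarrow> 0"
proof -
  define c where "c = 1 / complex_of_real radius"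
  define h where "h n j = 1 / (1 - c * root_unity n j)" for n j
  have c: "cmod c = 1 / radius" "1 < cmod c"
    using radius by (auto simp: c_def norm_divide)
  have ne: "1 - c * root_unity n j \<noteq> 0" for n j
  proof
    assume "1 - c * root_unity n j = 0"
    then have "cmod (c * root_unity n j) = 1"
      by simp
    then show False
      using c(2) by (simp add: norm_mult)
  qed
  have pow_id: "((\<lambda>x::complex. x) ^^ n) x = x" for n x
    by (induction n) simp_all
  have avg: "(\<Sum>j<n. h n j) / of_nat n = 1 / (1 - c ^ n)" if "0 < n" for n
  proof -
    have "h n j = 1 + (c * root_unity n j) *\<^sub>C h n j" for j
      using ne [of n j] by (simp add: h_def scaleC_complex_def divide_simps)
    from sum_root_unity_resolvent [OF clinear_bdd_id that this]
    have "(\<Sum>j<n. h n j) = of_nat n + c ^ n * (\<Sum>j<n. h n j)"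
      unfolding scaleC_complex_def pow_id by simp
    moreover have "1 - c ^ n \<noteq> 0"
    proof
      assume "1 - c ^ n = 0"
      then have "cmod c ^ n = 1"
        by (metis eq_iff_diff_eq_0 norm_one norm_power)
      then show False
        using one_less_power [OF c(2) that] by simp
    qed
    ultimately show ?thesis
      using that by (simp add: divide_simps) (simp add: algebra_simps)
  qed
  have "(\<lambda>m. 1 / (1 - c ^ 2 ^ m)) \<longlonglongrightarrow> 0"
  proof -
    have "filterlim (\<lambda>n. c ^ n) at_infinity sequentially"
      by (rule filterlim_realpow_sequentially_gt1) (use c in simp)
    then have "filterlim (\<lambda>n. -1 + c ^ n) at_infinity sequentially"
      by (intro tendsto_add_filterlim_at_infinity [OF tendsto_const])
    then have "(\<lambda>n. inverse (-1 + c ^ n)) \<longlonglongrightarrow> 0"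
      by (rule filterlim_compose [OF tendsto_inverse_0])
    then have "(\<lambda>n. - inverse (-1 + c ^ n)) \<longlonglongrightarrow> 0"
      using tendsto_minus by fastforce
    moreover have "- inverse (-1 + c ^ n) = 1 / (1 - c ^ n)" for n
      by (simp add: inverse_eq_divide) (metis minus_diff_eq minus_divide_right)
    ultimately have "(\<lambda>n. 1 / (1 - c ^ n)) \<longlonglongrightarrow> 0"
      by simp
    moreover have "filterlim (\<lambda>m::nat. 2 ^ m :: nat) at_top sequentially"
      by (rule filterlim_subseq) (simp add: strict_mono_def)
    ultimately show ?thesis
      by (rule filterlim_compose)
  qed
  moreover have "(\<Sum>j<2 ^ m. 1 / (1 - root_unity (2 ^ m) j / complex_of_real radius)) / 2 ^ m = 1 / (1 - c ^ 2 ^ m)" for m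
    using avg [of "2 ^ m"] by (simp add: h_def c_def)
  ultimately show ?thesis
    by simp
qed

text \<open>Here the contraction prevails: the modulus of \<open>c\<close> times \<rho> is
  \<open>q < 1\<close>, the error is of order \<open>q ^ n\<close>, and the part on the range
  survives unchanged.\<close>

lemma circle_average_Qinv:
  "(\<lambda>m. (1 / 2 ^ m) *\<^sub>C (\<Sum>j<2 ^ m. Qinv (root_unity (2 ^ m) j / complex_of_real radius) g)) \<longlonglongrightarrow> g"
proof -
  define c where "c = 1 / complex_of_real radius"
  define q where "q = \<rho> / radius"
  have q: "0 \<le> q" "q < 1"
    using radius \<rho> by (auto simp: q_def)
  have c: "cmod c = 1 / radius"
    using radius by (simp add: c_def norm_divide)
  define h where "h n j = Qinv (c * root_unity n j) g" for n j
  have mod: "cmod (c * root_unity n j) * \<rho> = q" for n j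
    by (simp add: norm_mult c q_def)
  have Rpow: "norm ((R ^^ n) f) \<le> \<rho> ^ n * norm f" for n f
  proof (induction n)
    case (Suc n)
    have "norm ((R ^^ Suc n) f) \<le> \<rho> * norm ((R ^^ n) f)"
      using norm_R by simp
    also have "\<dots> \<le> \<rho> * (\<rho> ^ n * norm f)"
      by (rule mult_left_mono [OF Suc \<rho>(1)])
    finally show ?case by simp
  qed simp
  have bound: "norm ((1 / of_nat n) *\<^sub>C (\<Sum>j<n. h n j) - g) \<le> q ^ n * (norm g / (1 - q))" if "0 < n" for n
  proof -
    have "h n j = g + (c * root_unity n j) *\<^sub>C R (h n j)" for j
      unfolding h_def by (rule Qinv_eq) (simp add: mod q)
    from sum_root_unity_resolvent [OF clinear_R that this]
    have eq: "(\<Sum>j<n. h n j) = of_nat n *\<^sub>C g + c ^ n *\<^sub>C (R ^^ n) (\<Sum>j<n. h n j)" .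
    have "(1 / of_nat n) *\<^sub>C (\<Sum>j<n. h n j) - g = (c ^ n / of_nat n) *\<^sub>C (R ^^ n) (\<Sum>j<n. h n j)"
      using that by (subst eq) (simp add: scaleC_add_right scaleC_scaleC)
    then have "norm ((1 / of_nat n) *\<^sub>C (\<Sum>j<n. h n j) - g)
        = (1 / radius) ^ n / n * norm ((R ^^ n) (\<Sum>j<n. h n j))"
      by (simp add: norm_scaleC norm_divide norm_power c)
    also have "\<dots> \<le> (1 / radius) ^ n / n * (\<rho> ^ n * (n * (norm g / (1 - q))))"
    proof (intro mult_left_mono order_trans [OF Rpow] \<rho>)
      have "norm (\<Sum>j<n. h n j) \<le> (\<Sum>j<n. norm (h n j))"
        by (rule norm_sum)
      also have "\<dots> \<le> (\<Sum>j<n. norm g / (1 - q))"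
      proof (rule sum_mono)
        fix j
        show "norm (h n j) \<le> norm g / (1 - q)"
          using strict_contraction.norm_inv [OF contraction, of "c * root_unity n j" g] q
          by (simp only: mod h_def Qinv_def)
      qed
      finally show "norm (\<Sum>j<n. h n j) \<le> n * (norm g / (1 - q))"
        by simp
    qed (use radius \<rho> in auto)
    also have "\<dots> = q ^ n * (norm g / (1 - q))"
      using that by (simp add: q_def power_divide)
    finally show ?thesis .
  qed
  have "(\<lambda>n. q ^ n * (norm g / (1 - q))) \<longlonglongrightarrow> 0"
    using q by (intro tendsto_mult_left_zero LIMSEQ_realpow_zero)
  moreover have "filterlim (\<lambda>m::nat. 2 ^ m :: nat) at_top sequentially"
    by (rule filterlim_subseq) (simp add: strict_mono_def)
  ultimately have "(\<lambda>m. q ^ (2 ^ m) * (norm g / (1 - q))) \<longlonglongrightarrow> 0"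
    by (rule filterlim_compose [where g = "\<lambda>n. q ^ n * (norm g / (1 - q))"])
  then have "(\<lambda>m. (1 / 2 ^ m) *\<^sub>C (\<Sum>j<2 ^ m. h (2 ^ m) j) - g) \<longlonglongrightarrow> 0"
  proof (rule Lim_null_comparison [rotated])
    have "norm ((1 / 2 ^ m) *\<^sub>C (\<Sum>j<2 ^ m. h (2 ^ m) j) - g) \<le> q ^ (2 ^ m) * (norm g / (1 - q))" for m
      using bound [of "2 ^ m"] by simp
    then show "\<forall>\<^sub>F m in sequentially. norm ((1 / 2 ^ m) *\<^sub>C (\<Sum>j<2 ^ m. h (2 ^ m) j) - g) \<le> q ^ (2 ^ m) * (norm g / (1 - q))"
      by simp
  qed
  then show ?thesis
    unfolding h_def c_def by (simp add: LIM_zero_iff)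
qed

end

section \<open>Gram matrices with the dual frame belong to the algebra\<close>

locale localized_frame = frame_bounds K \<Psi> A B + matrix_algebra K \<A> N
  for K :: "'i set" and \<Psi> :: "'i \<Rightarrow> 'h::complex_hilbert" and A B and \<A> N +
  assumes localized: "gram K \<Psi> \<Psi> \<in> \<A>"
begin

abbreviation dual where "dual \<equiv> dual_frame K \<Psi>"
abbreviation proj where "proj \<equiv> gram K dual \<Psi>"

lemma proj_entry: "proj k l = (if k \<in> K \<and> l \<in> K then cinner (Sinv (\<Psi> l)) (\<Psi> k) else 0)"
  by (simp add: gram_dual) (simp add: gram_def)

lemma gram_step_alg: "gram_step \<in> \<A>"
  unfolding gram_step_def by (intro alg_lincomb alg_id localized)

lemma res_mat_alg:
  assumes z: "cmod z = 1"
  shows "res_mat (z / complex_of_real radius) \<in> \<A>"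
proof (rule alg_inverse)
  note \<mu> = circle [OF z refl]
  let ?X = "\<lambda>k l. 1 * mat_id K k l + (- z) * gram_step k l"
  show "?X \<in> \<A>"
    by (intro alg_lincomb alg_id gram_step_alg)
  show "res_mat (z / complex_of_real radius) \<in> mats K" "l2_bounded K (res_mat (z / complex_of_real radius))"
    by (rule res_mat [OF \<mu>(1)])+
  have X: "mat_app K ?X c = (\<lambda>k. c k - z * mat_app K gram_step c k)" if c: "c \<in> l2_set K" for c
    using mat_boundedD(1) [OF l2_bounded_id c] mat_boundedD(1) [OF alg_l2 [OF gram_step_alg] c]
    by (subst mat_app_lincomb) (auto simp: mat_app_id [OF lp_set_seqs [OF c]])
  fix c assume c: "c \<in> l2_set K"
  show "mat_app K (res_mat (z / complex_of_real radius)) (mat_app K ?X c) = c"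
    unfolding X [OF c] by (rule res_mat_left [OF z c])
  have "mat_app K (res_mat (z / complex_of_real radius)) c \<in> l2_set K"
    by (rule mat_boundedD(2) [OF res_mat(2) [OF \<mu>(1)] c])
  from X [OF this] show "mat_app K ?X (mat_app K (res_mat (z / complex_of_real radius)) c) = c"
    using res_mat_right [OF z c] by auto
qed

lemma proj_alg: "proj \<in> \<A>"
proof -
  let ?F = "\<lambda>z. res_mat (z / complex_of_real radius)"
  have "\<exists>Y\<in>\<A>. \<forall>k l. (\<lambda>m. (\<Sum>j<2 ^ m. ?F (root_unity (2 ^ m) j) k l) / 2 ^ m) \<longlonglongrightarrow> Y k l"
    by (rule resolvent_averages [OF gram_step_alg res_mat_alg res_mat_left res_mat_right])
  then obtain Y where Y: "Y \<in> \<A>"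
    "\<And>k l. (\<lambda>m. (\<Sum>j<2 ^ m. ?F (root_unity (2 ^ m) j) k l) / 2 ^ m) \<longlonglongrightarrow> Y k l"
    by blast
  have "Y k l = proj k l" for k l
  proof (cases "k \<in> K \<and> l \<in> K")
    case True
    then have kl: "k \<in> K" "l \<in> K" by auto
    let ?e = "mat_id K k l - cinner (Sinv (\<Psi> l)) (\<Psi> k)"
    let ?a = "\<lambda>m. (\<Sum>j<2 ^ m. 1 / (1 - root_unity (2 ^ m) j / complex_of_real radius)) / 2 ^ m"
    let ?h = "\<lambda>m. (1 / 2 ^ m) *\<^sub>C (\<Sum>j<2 ^ m. Qinv (root_unity (2 ^ m) j / complex_of_real radius) (\<Psi> l))"
    have "(\<Sum>j<2 ^ m. ?F (root_unity (2 ^ m) j) k l) / 2 ^ m = ?a m * ?e + cinner (Sinv (?h m)) (\<Psi> k)" for m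
    proof -
      have "?F (root_unity (2 ^ m) j) k l = 1 / (1 - root_unity (2 ^ m) j / complex_of_real radius) * ?e
          + cinner (Sinv (Qinv (root_unity (2 ^ m) j / complex_of_real radius) (\<Psi> l))) (\<Psi> k)" for j
        using circle [OF _ refl, of "root_unity (2 ^ m) j"] by (intro res_mat_entry kl) auto
      then have "(\<Sum>j<2 ^ m. ?F (root_unity (2 ^ m) j) k l)
          = (\<Sum>j<2 ^ m. 1 / (1 - root_unity (2 ^ m) j / complex_of_real radius)) * ?e
            + cinner (Sinv (\<Sum>j<2 ^ m. Qinv (root_unity (2 ^ m) j / complex_of_real radius) (\<Psi> l))) (\<Psi> k)"
        by (simp only: sum.distrib sum_distrib_right clinear_bddD(6) [OF clinear_Sinv] cinner_sum_left)
      then show ?thesis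
        by (simp only: clinear_bddD(4) [OF clinear_Sinv] cinner_scaleC_left) (simp add: add_divide_distrib)
    qed
    moreover have "(\<lambda>m. ?a m * ?e + cinner (Sinv (?h m)) (\<Psi> k)) \<longlonglongrightarrow> 0 * ?e + cinner (Sinv (\<Psi> l)) (\<Psi> k)"
      by (intro tendsto_add tendsto_mult tendsto_const circle_average_scalar
          bounded_linear.tendsto [OF bounded_linear_cinner_left]
          bounded_linear.tendsto [OF clinear_bddD(1) [OF clinear_Sinv]] circle_average_Qinv)
    ultimately have "(\<lambda>m. (\<Sum>j<2 ^ m. ?F (root_unity (2 ^ m) j) k l) / 2 ^ m) \<longlonglongrightarrow> cinner (Sinv (\<Psi> l)) (\<Psi> k)"
      by simp
    with Y(2) have "Y k l = cinner (Sinv (\<Psi> l)) (\<Psi> k)"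
      by (rule LIMSEQ_unique)
    with kl show ?thesis
      by (simp add: proj_entry)
  next
    case False
    then show ?thesis
      using alg_mats [OF Y(1)] by (auto simp: mats_def proj_entry)
  qed
  then have "Y = proj"
    by (intro ext)
  with Y(1) show ?thesis
    by simp
qed

lemma gram_dual_dual: "gram K dual dual = gram K \<Psi> (\<lambda>j. Sinv (Sinv (\<Psi> j)))"
  by (simp add: gram_dual dual_frame)

text \<open>The Gram matrix plus the complementary projection is invertible, and inverting it inverts
  the Gram matrix on its range.\<close>

lemma gram_dual_dual_alg: "gram K dual dual \<in> \<A>"
proof -
  let ?G = "gram K \<Psi> \<Psi>" and ?D = "gram K dual dual"
  let ?E = "\<lambda>k l. mat_id K k l - proj k l"
  let ?X = "\<lambda>k l. ?G k l + ?E k l" and ?Y = "\<lambda>k l. ?D k l + ?E k l"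
  note lin2 = clinear_bdd_compose [OF clinear_Sinv clinear_Sinv]
  have G: "l2_bounded K ?G"
    by (rule l2_bounded_gram_op [OF clinear_bdd_id])
  have D: "l2_bounded K ?D"
    unfolding gram_dual_dual by (rule l2_bounded_gram_op [OF lin2])
  have P: "l2_bounded K proj"
    unfolding gram_dual by (rule l2_bounded_gram_op [OF clinear_Sinv])
  have E: "l2_bounded K ?E" and E_alg: "?E \<in> \<A>"
    by (intro l2_bounded_diff l2_bounded_id P) (intro alg_diff alg_id proj_alg)
  have X: "l2_bounded K ?X" and X_alg: "?X \<in> \<A>" and Y: "l2_bounded K ?Y"
    by (intro l2_bounded_add G D E) (intro alg_add localized E_alg, intro l2_bounded_add G D E)
  have app_E: "mat_app K ?E c = (\<lambda>k. c k - analysis\<^sub>\<Psi> (Sinv (synthesis\<^sub>\<Psi> c)) k)" if c: "c \<in> l2_set K" for c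
    using mat_app_diff [OF mat_boundedD(1) [OF l2_bounded_id c] mat_boundedD(1) [OF P c]]
    by (simp add: mat_app_id [OF lp_set_seqs [OF c]] gram_dual mat_app_gram_op [OF clinear_Sinv c])
  have app_X: "mat_app K ?X c = (\<lambda>k. c k + analysis\<^sub>\<Psi> (synthesis\<^sub>\<Psi> c - Sinv (synthesis\<^sub>\<Psi> c)) k)"
    if c: "c \<in> l2_set K" for c
    using mat_app_add [OF mat_boundedD(1) [OF G c] mat_boundedD(1) [OF E c]] mat_app_gram_op [OF clinear_bdd_id c]
    by (simp add: app_E [OF c] analysis_diff fun_eq_iff)
  have app_Y: "mat_app K ?Y c
      = (\<lambda>k. c k + analysis\<^sub>\<Psi> (Sinv (Sinv (synthesis\<^sub>\<Psi> c)) - Sinv (synthesis\<^sub>\<Psi> c)) k)"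
    if c: "c \<in> l2_set K" for c
    using mat_app_add [OF mat_boundedD(1) [OF D c] mat_boundedD(1) [OF E c]] mat_app_gram_op [OF lin2 c]
    by (simp add: app_E [OF c] analysis_diff gram_dual_dual fun_eq_iff)
  have syn: "synthesis\<^sub>\<Psi> (\<lambda>k. c k + analysis\<^sub>\<Psi> f k) = synthesis\<^sub>\<Psi> c + S f" if "c \<in> l2_set K" for c f
    using synthesis_lin [OF that analysis_l2, of 1 1 f] by (simp add: synthesis_analysis)
  have "?Y \<in> \<A>"
  proof (rule alg_inverse [OF X_alg _ Y])
    show "?Y \<in> mats K"
      by (auto simp: mats_def mat_id_def gram_def)
    fix c assume c: "c \<in> l2_set K"
    define s where "s = synthesis\<^sub>\<Psi> c"
    show "mat_app K ?Y (mat_app K ?X c) = c"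
    proof -
      have "synthesis\<^sub>\<Psi> (mat_app K ?X c) = S s"
        using syn [OF c] by (simp add: app_X [OF c] clinear_bddD(3) [OF clinear_S] s_def)
      then show ?thesis
        unfolding app_Y [OF mat_boundedD(2) [OF X c]]
        by (simp add: app_X [OF c] analysis_diff s_def)
    qed
    show "mat_app K ?X (mat_app K ?Y c) = c"
    proof -
      have "synthesis\<^sub>\<Psi> (mat_app K ?Y c) = Sinv s"
        using syn [OF c] by (simp add: app_Y [OF c] clinear_bddD(3) [OF clinear_S] s_def)
      then show ?thesis
        unfolding app_X [OF mat_boundedD(2) [OF Y c]]
        by (simp add: app_Y [OF c] analysis_diff s_def)
    qed
  qed
  from alg_diff [OF this E_alg] show ?thesis
    by simp
qed

text \<open>The first factor carries the inverse square of S, the product inserts one S, and the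
  inverse that remains is the dual in the left index.\<close>

lemma gram_dual_alg:
  assumes "gram K \<Psi> \<Phi> \<in> \<A>"
  shows "gram K dual \<Phi> \<in> \<A>"
proof -
  have "mat_mult K (gram K dual dual) (gram K \<Psi> \<Phi>) = gram K dual \<Phi>"
    unfolding gram_dual_dual
    by (subst mat_mult_gram [OF clinear_bdd_compose [OF clinear_Sinv clinear_Sinv] bessel bessel])
       (simp add: synthesis_analysis gram_dual)
  then show ?thesis
    using alg_mult [OF gram_dual_dual_alg assms] by simp
qed

lemma proj_mult: "mat_mult K proj (gram K dual \<Phi>) = gram K dual \<Phi>"
proof -
  have "mat_mult K proj (gram K \<Psi> (\<lambda>j. Sinv (\<Phi> j))) = gram K dual \<Phi>"
    unfolding gram_dual by (subst mat_mult_gram [OF clinear_Sinv bessel bessel]) (simp add: synthesis_analysis)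
  then show ?thesis
    by (simp add: gram_dual)
qed

lemma proj_analysis_dual: "mat_app K proj (analysis K dual f) = analysis K dual f"
  using mat_app_gram_op [OF clinear_Sinv analysis_l2, of "Sinv f"]
  by (simp add: gram_dual analysis_dual synthesis_analysis)

lemma gram_analysis_dual: "mat_app K (gram K \<Psi> \<Psi>) (analysis K dual f) = analysis K \<Psi> f"
  using mat_app_gram_op [OF clinear_bdd_id analysis_l2, of "Sinv f"]
  by (simp add: analysis_dual synthesis_analysis)

end

section \<open>Weighted sequence spaces\<close>

definition trunc :: "'i set \<Rightarrow> ('i \<Rightarrow> complex) \<Rightarrow> 'i \<Rightarrow> complex" where
  "trunc F c = (\<lambda>k. if k \<in> F then c k else 0)"

lemma seqs_lincomb: "c \<in> seqs K \<Longrightarrow> d \<in> seqs K \<Longrightarrow> (\<lambda>k. a * c k + b * d k) \<in> seqs K"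
  by (simp add: seqs_def)

lemma trunc_fin_seqs: "finite F \<Longrightarrow> F \<subseteq> K \<Longrightarrow> trunc F c \<in> fin_seqs K"
  by (auto simp: fin_seqs_def seqs_def trunc_def intro: finite_subset [of _ F])

lemma wsup_le:
  assumes "0 \<le> C" "\<And>k. k \<in> K \<Longrightarrow> w k * cmod (c k) \<le> C"
  shows "wsup K w c \<le> C"
  unfolding wsup_def by (rule cSup_least) (use assms in auto)

lemma
  assumes "c \<in> linf_set K w"
  shows wsup_upper: "k \<in> K \<Longrightarrow> w k * cmod (c k) \<le> wsup K w c" and wsup_nonneg: "0 \<le> wsup K w c"
proof -
  have "bdd_above (insert 0 ((\<lambda>k. w k * cmod (c k)) ` K))"
    using assms by (simp add: linf_set_def)
  then show "k \<in> K \<Longrightarrow> w k * cmod (c k) \<le> wsup K w c" "0 \<le> wsup K w c"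
    unfolding wsup_def by (auto intro: cSup_upper)
qed

lemma linf_setI:
  "c \<in> seqs K \<Longrightarrow> (\<And>k. k \<in> K \<Longrightarrow> w k * cmod (c k) \<le> C) \<Longrightarrow> c \<in> linf_set K w"
  unfolding linf_set_def by (auto intro!: bdd_aboveI2 [where M = C])

lemma linf_set_seqs: "c \<in> linf_set K w \<Longrightarrow> c \<in> seqs K"
  by (simp add: linf_set_def)

lemma lp_set_inf: "lp_set K \<infinity> w = linf_set K w"
  and lp_norm_inf: "lp_norm K \<infinity> w = wsup K w"
  and lp_norm_0: "lp_norm K 0 w = wsup K w"
  by (auto simp: lp_set_def lp_norm_def fun_eq_iff)

lemma exponent_cases:
  assumes "p = 0 \<or> 1 \<le> (p::ereal)"
  obtains "p = 0" | "p = \<infinity>" | r where "p = ereal r" "1 \<le> r"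
  using assms by (cases p) (auto simp: one_ereal_def)

lemma lp_set_finite: "1 \<le> r \<Longrightarrow> lp_set K (ereal r) w = {c \<in> seqs K. (\<lambda>k. (w k * cmod (c k)) powr r) summable_on K}"
  and lp_norm_finite: "1 \<le> r \<Longrightarrow> lp_norm K (ereal r) w c = (\<Sum>\<^sub>\<infinity>k\<in>K. (w k * cmod (c k)) powr r) powr (1 / r)"
  by (auto simp: lp_set_def lp_norm_def)

lemma summable_on_mono:
  fixes f g :: "'i \<Rightarrow> real"
  assumes "g summable_on K" "\<And>k. k \<in> K \<Longrightarrow> 0 \<le> f k" "\<And>k. k \<in> K \<Longrightarrow> f k \<le> g k"
  shows "f summable_on K"
  using assms by (intro summable_on_comparison_test [OF assms(1)]) auto

context
  fixes K :: "'i set" and w :: "'i \<Rightarrow> real"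
  assumes weight: "weight K w"
begin

lemma w_nonneg: "k \<in> K \<Longrightarrow> 0 \<le> w k" and w_pos: "k \<in> K \<Longrightarrow> 0 < w k"
  using weight by (auto simp: weight_def less_imp_le)

lemma wcmod_nonneg: "k \<in> K \<Longrightarrow> 0 \<le> w k * cmod c"
  by (simp add: w_nonneg)

lemma
  assumes "c \<in> linf_set K w" "d \<in> linf_set K w"
  shows linf_lincomb: "(\<lambda>k. a * c k + b * d k) \<in> linf_set K w"
    and wsup_lincomb: "wsup K w (\<lambda>k. a * c k + b * d k) \<le> cmod a * wsup K w c + cmod b * wsup K w d"
proof -
  have le: "w k * cmod (a * c k + b * d k) \<le> cmod a * wsup K w c + cmod b * wsup K w d" if k: "k \<in> K" for k
  proof -
    have "w k * cmod (a * c k + b * d k) \<le> w k * (cmod a * cmod (c k) + cmod b * cmod (d k))"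
      by (intro mult_left_mono w_nonneg [OF k]) (metis norm_mult norm_triangle_ineq)
    also have "\<dots> = cmod a * (w k * cmod (c k)) + cmod b * (w k * cmod (d k))"
      by (simp add: algebra_simps)
    also have "\<dots> \<le> cmod a * wsup K w c + cmod b * wsup K w d"
      by (intro add_mono mult_left_mono wsup_upper assms k) auto
    finally show ?thesis .
  qed
  have "(\<lambda>k. a * c k + b * d k) \<in> seqs K"
    using assms by (intro seqs_lincomb linf_set_seqs)
  then show "(\<lambda>k. a * c k + b * d k) \<in> linf_set K w"
    by (rule linf_setI [OF _ le])
  have "0 \<le> cmod a * wsup K w c + cmod b * wsup K w d"
    by (intro add_nonneg_nonneg mult_nonneg_nonneg wsup_nonneg assms norm_ge_zero)
  then show "wsup K w (\<lambda>k. a * c k + b * d k) \<le> cmod a * wsup K w c + cmod b * wsup K w d"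
    by (rule wsup_le [OF _ le])
qed

lemma fin_seqs_linf:
  assumes "c \<in> fin_seqs K"
  shows "c \<in> linf_set K w"
proof -
  have fin: "finite {k. c k \<noteq> 0}"
    using assms by (simp add: fin_seqs_def)
  have "(\<lambda>k. w k * cmod (c k)) ` K \<subseteq> insert 0 ((\<lambda>k. w k * cmod (c k)) ` {k. c k \<noteq> 0})"
    by auto
  then have "finite ((\<lambda>k. w k * cmod (c k)) ` K)"
    using fin by (meson finite_imageI finite_insert finite_subset)
  then show ?thesis
    using assms by (simp add: linf_set_def fin_seqs_def bdd_above_finite)
qed

text \<open>The closure of the finite sequences is described by decay: truncating at a superlevel
  set gives the finite approximant, and conversely an approximant is nonzero wherever the sequence
  is large. Later arguments for exponent 0 work with superlevel sets.\<close>

lemma lp_set_0_iff: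
  "c \<in> lp_set K 0 w \<longleftrightarrow> c \<in> seqs K \<and> (\<forall>e>0. finite {k \<in> K. e \<le> w k * cmod (c k)})"
proof safe
  assume "c \<in> lp_set K 0 w"
  then have c: "c \<in> linf_set K w" and ex: "\<And>e. e > 0 \<Longrightarrow> \<exists>d\<in>fin_seqs K. wsup K w (\<lambda>k. c k - d k) < e"
    by (auto simp: lp_set_def)
  show "c \<in> seqs K"
    by (rule linf_set_seqs [OF c])
  fix e :: real assume "e > 0"
  then obtain d where d: "d \<in> fin_seqs K" "wsup K w (\<lambda>k. c k - d k) < e"
    using ex by blast
  have cd: "(\<lambda>k. c k - d k) \<in> linf_set K w"
    using linf_lincomb [OF c fin_seqs_linf [OF d(1)], of 1 "-1"] by simp
  have "{k \<in> K. e \<le> w k * cmod (c k)} \<subseteq> {k. d k \<noteq> 0}"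
    using wsup_upper [OF cd] d(2) by fastforce
  then show "finite {k \<in> K. e \<le> w k * cmod (c k)}"
    using d(1) by (auto simp: fin_seqs_def intro: finite_subset)
next
  assume c: "c \<in> seqs K" and fin: "\<forall>e>0. finite {k \<in> K. e \<le> w k * cmod (c k)}"
  let ?F = "\<lambda>e. {k \<in> K. e \<le> w k * cmod (c k)}"
  have "w k * cmod (c k) \<le> Max (insert 1 ((\<lambda>k. w k * cmod (c k)) ` ?F 1))" if "k \<in> K" for k
    using fin that by (cases "1 \<le> w k * cmod (c k)") (auto simp: Max_ge_iff)
  then have "c \<in> linf_set K w"
    by (rule linf_setI [OF c])
  moreover have "\<exists>d\<in>fin_seqs K. wsup K w (\<lambda>k. c k - d k) < e" if "e > 0" for e
  proof (intro bexI)
    show "trunc (?F (e / 2)) c \<in> fin_seqs K"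
      using fin [rule_format, of "e / 2"] that by (intro trunc_fin_seqs) auto
    have "wsup K w (\<lambda>k. c k - trunc (?F (e / 2)) c k) \<le> e / 2"
      using that by (intro wsup_le) (auto simp: trunc_def)
    then show "wsup K w (\<lambda>k. c k - trunc (?F (e / 2)) c k) < e"
      using that by simp
  qed
  ultimately show "c \<in> lp_set K 0 w"
    by (simp add: lp_set_def)
qed

lemma lp_0_subset_inf: "c \<in> lp_set K 0 w \<Longrightarrow> c \<in> linf_set K w"
  by (simp add: lp_set_def)

text \<open>Places every space inside the weighted sup space, so that matrix identities proved for
  bounded sequences apply to all exponents, and makes coordinates continuous.\<close>

lemma lp_coordinate:
  assumes "p = 0 \<or> 1 \<le> p" "c \<in> lp_set K p w" "k \<in> K"
  shows "w k * cmod (c k) \<le> lp_norm K p w c"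
  using assms(1)
proof (cases rule: exponent_cases)
  case 1
  then show ?thesis
    using wsup_upper [OF lp_0_subset_inf] assms by (simp add: lp_norm_0)
next
  case 2
  then show ?thesis
    using wsup_upper assms by (simp add: lp_norm_inf lp_set_inf)
next
  case (3 r)
  let ?f = "\<lambda>k. (w k * cmod (c k)) powr r"
  have "?f k \<le> infsum ?f K"
    using finite_sum_le_infsum [of ?f K "{k}"] assms 3 by (simp add: lp_set_finite)
  then have "?f k powr (1 / r) \<le> infsum ?f K powr (1 / r)"
    using 3 by (intro powr_mono2) auto
  then show ?thesis
    using 3 wcmod_nonneg [OF assms(3)] by (simp add: lp_norm_finite powr_powr)
qed

lemma lp_subset_inf:
  assumes "p = 0 \<or> 1 \<le> p" "c \<in> lp_set K p w"
  shows "c \<in> linf_set K w"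
  by (rule linf_setI [OF lp_set_seqs [OF assms(2)] lp_coordinate [OF assms]])

lemma lp_norm_nonneg:
  assumes "p = 0 \<or> 1 \<le> p" "c \<in> lp_set K p w"
  shows "0 \<le> lp_norm K p w c"
  using assms(1)
proof (cases rule: exponent_cases)
  case (3 r)
  then show ?thesis
    by (simp add: lp_norm_finite)
qed (use assms wsup_nonneg lp_0_subset_inf in \<open>auto simp: lp_norm_inf lp_norm_0 lp_set_inf\<close>)

text \<open>Solidity of the sequence spaces. It serves for truncations and, later, for sequences
  with altered phases.\<close>

lemma lp_dominated:
  assumes "p = 0 \<or> 1 \<le> p" and c: "c \<in> lp_set K p w" and d: "d \<in> seqs K"
    and le: "\<And>k. k \<in> K \<Longrightarrow> cmod (d k) \<le> cmod (c k)"
  shows "d \<in> lp_set K p w" "lp_norm K p w d \<le> lp_norm K p w c"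
proof -
  have wle: "w k * cmod (d k) \<le> w k * cmod (c k)" if "k \<in> K" for k
    by (rule mult_left_mono [OF le [OF that] w_nonneg [OF that]])
  have sup: "wsup K w d \<le> wsup K w c" if "c \<in> linf_set K w"
    by (rule wsup_le [OF wsup_nonneg [OF that]]) (rule order_trans [OF wle wsup_upper [OF that]])
  have "d \<in> lp_set K p w \<and> lp_norm K p w d \<le> lp_norm K p w c"
    using assms(1)
  proof (cases rule: exponent_cases)
    case 1
    have "finite {k \<in> K. e \<le> w k * cmod (d k)}" if "e > 0" for e
    proof (rule finite_subset)
      show "{k \<in> K. e \<le> w k * cmod (d k)} \<subseteq> {k \<in> K. e \<le> w k * cmod (c k)}"
        using wle order_trans by blast
      show "finite {k \<in> K. e \<le> w k * cmod (c k)}"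
        using 1 c that by (simp add: lp_set_0_iff)
    qed
    then have "d \<in> lp_set K 0 w"
      using d by (simp add: lp_set_0_iff)
    moreover have "c \<in> linf_set K w"
      using 1 c lp_0_subset_inf by simp
    ultimately show ?thesis
      using 1 sup by (simp add: lp_norm_0)
  next
    case 2
    then have c': "c \<in> linf_set K w"
      using c by (simp add: lp_set_inf)
    have "d \<in> linf_set K w"
      by (rule linf_setI [OF d]) (rule order_trans [OF wle wsup_upper [OF c']])
    then show ?thesis
      using 2 sup [OF c'] by (simp add: lp_set_inf lp_norm_inf)
  next
    case (3 r)
    let ?f = "\<lambda>c k. (w k * cmod (c k)) powr r"
    have c': "?f c summable_on K"
      using c 3 by (simp add: lp_set_finite)
    have mono: "?f d k \<le> ?f c k" if "k \<in> K" for k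
      using 3 wle [OF that] wcmod_nonneg [OF that] by (intro powr_mono2) auto
    have d': "?f d summable_on K"
      by (rule summable_on_mono [OF c' _ mono]) auto
    have "infsum (?f d) K powr (1 / r) \<le> infsum (?f c) K powr (1 / r)"
      using 3 by (intro powr_mono2 infsum_mono d' c' mono infsum_nonneg) auto
    then show ?thesis
      using 3 d d' by (simp add: lp_set_finite lp_norm_finite)
  qed
  then show "d \<in> lp_set K p w" "lp_norm K p w d \<le> lp_norm K p w c"
    by auto
qed

lemma lp_lincomb:
  assumes "p = 0 \<or> 1 \<le> p" and c: "c \<in> lp_set K p w" and d: "d \<in> lp_set K p w"
  shows "(\<lambda>k. a * c k + b * d k) \<in> lp_set K p w"
proof -
  let ?s = "\<lambda>k. a * c k + b * d k"
  have s: "?s \<in> seqs K"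
    using c d by (intro seqs_lincomb lp_set_seqs)
  \<comment> \<open>Twice the larger modulus arises from estimating a sum of two terms by twice the
    larger term; the maximum with 1 permits division by \<open>m\<close>.\<close>
  define m where "m = max 1 (2 * max (cmod a) (cmod b))"
  have m: "1 \<le> m" "2 * cmod a \<le> m" "2 * cmod b \<le> m"
    by (auto simp: m_def)
  have le: "w k * cmod (?s k) \<le> m * max (w k * cmod (c k)) (w k * cmod (d k))" if k: "k \<in> K" for k
  proof -
    let ?M = "max (w k * cmod (c k)) (w k * cmod (d k))"
    have M: "w k * cmod (c k) \<le> ?M" "w k * cmod (d k) \<le> ?M" "0 \<le> ?M"
      using wcmod_nonneg [OF k, of "c k"] by (auto simp: le_max_iff_disj)
    have "w k * cmod (?s k) \<le> w k * (cmod a * cmod (c k) + cmod b * cmod (d k))"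
      by (intro mult_left_mono w_nonneg [OF k]) (metis norm_mult norm_triangle_ineq)
    also have "\<dots> = cmod a * (w k * cmod (c k)) + cmod b * (w k * cmod (d k))"
      by (simp add: algebra_simps)
    also have "\<dots> \<le> (m / 2) * ?M + (m / 2) * ?M"
      using m M by (intro add_mono mult_mono) (auto simp: wcmod_nonneg [OF k])
    finally show ?thesis
      by simp
  qed
  show ?thesis
    using assms(1)
  proof (cases rule: exponent_cases)
    case 1
    have "finite {k \<in> K. e \<le> w k * cmod (?s k)}" if "e > 0" for e
    proof (rule finite_subset)
      show "{k \<in> K. e \<le> w k * cmod (?s k)}
          \<subseteq> {k \<in> K. e / m \<le> w k * cmod (c k)} \<union> {k \<in> K. e / m \<le> w k * cmod (d k)}"
      proof safe
        fix k assume k: "k \<in> K" "e \<le> w k * cmod (?s k)" "\<not> e / m \<le> w k * cmod (d k)"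
        then have "e \<le> m * max (w k * cmod (c k)) (w k * cmod (d k))"
          using le [of k] by linarith
        then have "e / m \<le> max (w k * cmod (c k)) (w k * cmod (d k))"
          using m by (simp add: divide_le_eq mult.commute)
        then show "e / m \<le> w k * cmod (c k)"
          using k(3) by linarith
      qed
      show "finite ({k \<in> K. e / m \<le> w k * cmod (c k)} \<union> {k \<in> K. e / m \<le> w k * cmod (d k)})"
        using 1 c d that m by (simp add: lp_set_0_iff)
    qed
    then show ?thesis
      using 1 s by (simp add: lp_set_0_iff)
  next
    case 2
    then show ?thesis
      using c d linf_lincomb by (simp add: lp_set_inf)
  next
    case (3 r)
    let ?f = "\<lambda>c k. (w k * cmod (c k)) powr r"
    have s1: "(\<lambda>k. m powr r * (?f c k + ?f d k)) summable_on K"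
      using 3 c d by (intro summable_on_cmult_right summable_on_add) (auto simp: lp_set_finite)
    have m1: "?f ?s k \<le> m powr r * (?f c k + ?f d k)" if k: "k \<in> K" for k
    proof -
      have "?f ?s k \<le> (m * max (w k * cmod (c k)) (w k * cmod (d k))) powr r"
        using 3 le [OF k] wcmod_nonneg [OF k] by (intro powr_mono2) auto
      also have "\<dots> = m powr r * max (w k * cmod (c k)) (w k * cmod (d k)) powr r"
        using m by (intro powr_mult)
      also have "\<dots> \<le> m powr r * (?f c k + ?f d k)"
        by (intro mult_left_mono) (auto simp: max_def)
      finally show ?thesis .
    qed
    have "?f ?s summable_on K"
      by (rule summable_on_mono [OF s1 _ m1]) auto
    then show ?thesis
      using 3 s by (simp add: lp_set_finite)
  qed
qed

lemma lp_diff: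
  assumes "p = 0 \<or> 1 \<le> p" "c \<in> lp_set K p w" "d \<in> lp_set K p w"
  shows "(\<lambda>k. c k - d k) \<in> lp_set K p w"
  using lp_lincomb [OF assms, of 1 "-1"] by simp

lemma lp_scale:
  assumes "p = 0 \<or> 1 \<le> p" "c \<in> lp_set K p w"
  shows "(\<lambda>k. a * c k) \<in> lp_set K p w" "lp_norm K p w (\<lambda>k. a * c k) = cmod a * lp_norm K p w c"
proof -
  show mem: "(\<lambda>k. a * c k) \<in> lp_set K p w" for a
    using lp_lincomb [OF assms assms(2), of a 0] by simp
  have eq: "w k * cmod (a * x) = cmod a * (w k * cmod x)" for k x
    by (simp add: norm_mult)
  have sup: "wsup K w (\<lambda>k. a * c k) = cmod a * wsup K w c" if c: "c \<in> linf_set K w"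
  proof (rule antisym)
    have ac: "(\<lambda>k. a * c k) \<in> linf_set K w"
      using linf_lincomb [OF c c, of a 0] by simp
    show "wsup K w (\<lambda>k. a * c k) \<le> cmod a * wsup K w c"
    proof (rule wsup_le)
      show "0 \<le> cmod a * wsup K w c"
        by (intro mult_nonneg_nonneg wsup_nonneg [OF c]) simp
      show "w k * cmod (a * c k) \<le> cmod a * wsup K w c" if "k \<in> K" for k
        unfolding eq by (intro mult_left_mono wsup_upper [OF c that]) simp
    qed
    show "cmod a * wsup K w c \<le> wsup K w (\<lambda>k. a * c k)"
    proof (cases "a = 0")
      case False
      have "wsup K w c \<le> wsup K w (\<lambda>k. a * c k) / cmod a"
      proof (rule wsup_le)
        show "0 \<le> wsup K w (\<lambda>k. a * c k) / cmod a"
          by (intro divide_nonneg_nonneg wsup_nonneg [OF ac]) simp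
        show "w k * cmod (c k) \<le> wsup K w (\<lambda>k. a * c k) / cmod a" if "k \<in> K" for k
          using wsup_upper [OF ac that] False unfolding eq
          by (subst pos_le_divide_eq) (auto simp: mult.commute)
      qed
      then show ?thesis
        using False by (simp add: field_simps)
    qed (use wsup_nonneg [OF ac] in simp)
  qed
  show "lp_norm K p w (\<lambda>k. a * c k) = cmod a * lp_norm K p w c"
    using assms(1)
  proof (cases rule: exponent_cases)
    case (3 r)
    let ?f = "\<lambda>c k. (w k * cmod (c k)) powr r"
    have "?f (\<lambda>k. a * c k) k = cmod a powr r * ?f c k" if "k \<in> K" for k
      by (simp only: eq powr_mult)
    then have "infsum (?f (\<lambda>k. a * c k)) K = cmod a powr r * infsum (?f c) K"
      by (simp add: infsum_cmult_right' cong: infsum_cong)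
    then show ?thesis
      using 3 by (simp add: lp_norm_finite powr_mult powr_powr infsum_nonneg)
  qed (use sup assms lp_0_subset_inf in \<open>auto simp: lp_norm_0 lp_norm_inf lp_set_inf\<close>)
qed

lemma fin_seqs_lp:
  assumes "p = 0 \<or> 1 \<le> p" and c: "c \<in> fin_seqs K"
  shows "c \<in> lp_set K p w"
  using assms(1)
proof (cases rule: exponent_cases)
  case 1
  have "finite {k \<in> K. e \<le> w k * cmod (c k)}" if "e > 0" for e
    using c that by (auto simp: fin_seqs_def intro!: finite_subset [of _ "{k. c k \<noteq> 0}"])
  then show ?thesis
    using 1 c by (simp add: lp_set_0_iff fin_seqs_def)
next
  case 2
  then show ?thesis
    using fin_seqs_linf [OF c] by (simp add: lp_set_inf)
next
  case (3 r)
  have "(\<lambda>k. (w k * cmod (c k)) powr r) summable_on K"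
    using c 3 by (intro finite_nonzero_values_imp_summable_on)
      (auto simp: fin_seqs_def intro!: finite_subset [of _ "{k. c k \<noteq> 0}"])
  then show ?thesis
    using 3 c by (simp add: lp_set_finite fin_seqs_def)
qed

lemma lp_zero: "p = 0 \<or> 1 \<le> p \<Longrightarrow> (\<lambda>k. 0) \<in> lp_set K p w"
  by (rule fin_seqs_lp) (auto simp: fin_seqs_def seqs_def)

lemma lp_trunc:
  assumes "p = 0 \<or> 1 \<le> p" "c \<in> lp_set K p w"
  shows "trunc F c \<in> lp_set K p w" "lp_norm K p w (trunc F c) \<le> lp_norm K p w c"
proof -
  have "trunc F c \<in> seqs K"
    using lp_set_seqs [OF assms(2)] by (simp add: trunc_def seqs_def)
  then show "trunc F c \<in> lp_set K p w" "lp_norm K p w (trunc F c) \<le> lp_norm K p w c"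
    by (auto intro!: lp_dominated [OF assms] simp: trunc_def)
qed

lemma trunc_tendsto_sup:
  assumes c: "c \<in> lp_set K 0 w"
  shows "((\<lambda>F. wsup K w (\<lambda>k. c k - trunc F c k)) \<longlongrightarrow> 0) (finite_subsets_at_top K)"
proof (rule tendstoI)
  fix e :: real assume "e > 0"
  let ?F = "{k \<in> K. e / 2 \<le> w k * cmod (c k)}"
  have "finite ?F" "?F \<subseteq> K"
    using lp_set_0_iff [THEN iffD1, OF c, THEN conjunct2, rule_format, of "e / 2"] \<open>e > 0\<close> by auto
  then have "\<forall>\<^sub>F F in finite_subsets_at_top K. finite F \<and> ?F \<subseteq> F \<and> F \<subseteq> K"
    by (auto simp: eventually_finite_subsets_at_top)
  then show "\<forall>\<^sub>F F in finite_subsets_at_top K. dist (wsup K w (\<lambda>k. c k - trunc F c k)) 0 < e"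
  proof eventually_elim
    case (elim F)
    have "(\<lambda>k. c k - trunc F c k) \<in> linf_set K w"
      using lp_diff [OF _ c lp_trunc(1) [OF _ c, of F]] lp_0_subset_inf by simp
    then have "0 \<le> wsup K w (\<lambda>k. c k - trunc F c k)"
      by (rule wsup_nonneg)
    moreover have "wsup K w (\<lambda>k. c k - trunc F c k) \<le> e / 2"
      using elim \<open>e > 0\<close> by (intro wsup_le) (auto simp: trunc_def)
    ultimately show ?case
      using \<open>e > 0\<close> by simp
  qed
qed

text \<open>For finite \<open>p\<close> the error is the tail of a convergent series; for the sup
  norm it is small once a superlevel set is exhausted. The latter presupposes decay, hence the
  condition for \<open>p = \<infinity>\<close>.\<close>

lemma trunc_tendsto:
  assumes "p = 0 \<or> 1 \<le> p" and c: "c \<in> lp_set K p w" and "p \<noteq> \<infinity> \<or> c \<in> lp_set K 0 w"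
  shows "((\<lambda>F. lp_norm K p w (\<lambda>k. c k - trunc F c k)) \<longlongrightarrow> 0) (finite_subsets_at_top K)"
  using assms(1)
proof (cases rule: exponent_cases)
  case 1
  then show ?thesis
    using trunc_tendsto_sup c by (simp add: lp_norm_0)
next
  case 2
  then show ?thesis
    using trunc_tendsto_sup assms(3) by (simp add: lp_norm_inf)
next
  case (3 r)
  let ?f = "\<lambda>k. (w k * cmod (c k)) powr r"
  have f: "?f summable_on K"
    using 3 c by (simp add: lp_set_finite)
  have norm: "lp_norm K p w (\<lambda>k. c k - trunc F c k) = (infsum ?f K - sum ?f F) powr (1 / r)"
    if F: "finite F" "F \<subseteq> K" for F
  proof -
    have "infsum ?f K = infsum ?f F + infsum ?f (K - F)"
      using infsum_Un_disjoint [of ?f F "K - F"] F f summable_on_subset_banach [OF f, of "K - F"]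
      by (simp add: Un_absorb1)
    moreover have "infsum (\<lambda>k. (w k * cmod (c k - trunc F c k)) powr r) K = infsum ?f (K - F)"
      by (rule infsum_cong_neutral) (use 3 in \<open>auto simp: trunc_def\<close>)
    ultimately show ?thesis
      using 3 F by (simp add: lp_norm_finite)
  qed
  have "((\<lambda>F. infsum ?f K - sum ?f F) \<longlongrightarrow> infsum ?f K - infsum ?f K) (finite_subsets_at_top K)"
    using infsum_tendsto [OF f] by (intro tendsto_diff tendsto_const)
  moreover have nonneg: "\<forall>\<^sub>F F in finite_subsets_at_top K. 0 \<le> infsum ?f K - sum ?f F"
    using finite_sum_le_infsum [OF f] by (intro eventually_finite_subsets_at_top_weakI) auto
  ultimately have "((\<lambda>F. (infsum ?f K - sum ?f F) powr (1 / r)) \<longlongrightarrow> 0 powr (1 / r)) (finite_subsets_at_top K)"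
    using 3 by (intro tendsto_powr') auto
  moreover have "\<forall>\<^sub>F F in finite_subsets_at_top K.
      lp_norm K p w (\<lambda>k. c k - trunc F c k) = (infsum ?f K - sum ?f F) powr (1 / r)"
    using norm by (intro eventually_finite_subsets_at_top_weakI) auto
  ultimately show ?thesis
    using tendsto_cong by fastforce
qed

text \<open>Finite partial sums, or single coordinates for the sup norm, keep the bound in the
  limit, and the norm is determined by them. Exponent 0 is excluded: truncations of a constant
  sequence decay, while their coordinatewise limit may not.\<close>

lemma lp_fatou:
  assumes p: "1 \<le> p" and c: "c \<in> seqs K" and C: "0 \<le> C" and G: "G \<noteq> bot"
    and lim: "\<And>k. k \<in> K \<Longrightarrow> ((\<lambda>F. d F k) \<longlongrightarrow> c k) G"
    and bound: "\<forall>\<^sub>F F in G. d F \<in> lp_set K p w \<and> lp_norm K p w (d F) \<le> C"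
  shows "c \<in> lp_set K p w" "lp_norm K p w c \<le> C"
proof -
  have "p = 0 \<or> 1 \<le> p" using p by simp
  then have "c \<in> lp_set K p w \<and> lp_norm K p w c \<le> C"
  proof (cases rule: exponent_cases)
    case 1
    then show ?thesis using p by simp
  next
    case 2
    have "w k * cmod (c k) \<le> C" if k: "k \<in> K" for k
    proof (rule tendsto_upperbound [OF _ _ G])
      show "((\<lambda>F. w k * cmod (d F k)) \<longlongrightarrow> w k * cmod (c k)) G"
        by (intro tendsto_intros lim k)
      show "\<forall>\<^sub>F F in G. w k * cmod (d F k) \<le> C"
        using bound by eventually_elim (meson lp_coordinate p k order_trans)
    qed
    then show ?thesis
      using 2 C c by (auto simp: lp_set_inf lp_norm_inf intro: linf_setI wsup_le)
  next
    case (3 r)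
    let ?f = "\<lambda>c k. (w k * cmod (c k)) powr r"
    have fin: "sum (?f c) E \<le> C powr r" if E: "finite E" "E \<subseteq> K" for E
    proof (rule tendsto_upperbound [OF _ _ G])
      show "((\<lambda>F. sum (?f (d F)) E) \<longlongrightarrow> sum (?f c) E) G"
        using E 3 wcmod_nonneg by (intro tendsto_sum tendsto_powr' tendsto_intros lim) auto
      show "\<forall>\<^sub>F F in G. sum (?f (d F)) E \<le> C powr r"
        using bound
      proof eventually_elim
        case (elim F)
        have d: "?f (d F) summable_on K"
          using elim 3 by (simp add: lp_set_finite)
        have "sum (?f (d F)) E \<le> infsum (?f (d F)) K"
          by (rule finite_sum_le_infsum [OF d]) (use E in auto)
        also have "\<dots> = (infsum (?f (d F)) K powr (1 / r)) powr r"
          using 3 by (simp add: powr_powr infsum_nonneg)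
        also have "\<dots> \<le> C powr r"
          using elim 3 by (intro powr_mono2) (auto simp: lp_norm_finite)
        finally show ?case .
      qed
    qed
    have sm: "?f c summable_on K"
      by (rule nonneg_bdd_above_summable_on) (use fin in \<open>auto intro!: bdd_aboveI2\<close>)
    have "infsum (?f c) K powr (1 / r) \<le> (C powr r) powr (1 / r)"
      using 3 by (intro powr_mono2 infsum_le_finite_sums [OF sm fin] infsum_nonneg) auto
    then show ?thesis
      using 3 C c sm by (simp add: lp_set_finite lp_norm_finite powr_powr)
  qed
  then show "c \<in> lp_set K p w" "lp_norm K p w c \<le> C"
    by auto
qed

lemma lp_1_iff: "c \<in> lp_set K 1 w \<longleftrightarrow> c \<in> seqs K \<and> (\<lambda>k. w k * cmod (c k)) summable_on K"
proof -
  have "(\<lambda>k. (w k * cmod (c k)) powr 1) summable_on K \<longleftrightarrow> (\<lambda>k. w k * cmod (c k)) summable_on K"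
    by (rule summable_on_cong) (simp add: wcmod_nonneg)
  then show ?thesis
    using lp_set_finite [of 1 K w] by (simp add: one_ereal_def)
qed

lemma lp_1_norm: "lp_norm K 1 w c = (\<Sum>\<^sub>\<infinity>k\<in>K. w k * cmod (c k))"
proof -
  have "(\<Sum>\<^sub>\<infinity>k\<in>K. (w k * cmod (c k)) powr 1) = (\<Sum>\<^sub>\<infinity>k\<in>K. w k * cmod (c k))"
    by (rule infsum_cong) (simp add: wcmod_nonneg)
  moreover have "0 \<le> (\<Sum>\<^sub>\<infinity>k\<in>K. w k * cmod (c k))"
    by (intro infsum_nonneg wcmod_nonneg)
  ultimately show ?thesis
    using lp_norm_finite [of 1 K w c] by (simp add: one_ereal_def)
qed

lemma lp_1_subset_0:
  assumes "c \<in> lp_set K 1 w"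
  shows "c \<in> lp_set K 0 w"
proof -
  have c: "c \<in> seqs K" and f: "(\<lambda>k. w k * cmod (c k)) summable_on K"
    using assms by (auto simp: lp_1_iff)
  have "finite {k \<in> K. e \<le> w k * cmod (c k)}" if "e > 0" for e
  proof -
    obtain F where F: "finite F" "F \<subseteq> K"
      "dist (\<Sum>k\<in>F. w k * cmod (c k)) (\<Sum>\<^sub>\<infinity>k\<in>K. w k * cmod (c k)) \<le> e / 2"
      using infsum_finite_approximation [OF f, of "e / 2"] \<open>e > 0\<close> by auto
    have "k \<in> F" if k: "k \<in> K" "e \<le> w k * cmod (c k)" for k
    proof (rule ccontr)
      assume "k \<notin> F"
      then have "(\<Sum>k\<in>F. w k * cmod (c k)) + w k * cmod (c k) = (\<Sum>k\<in>insert k F. w k * cmod (c k))"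
        using F by simp
      also have "\<dots> \<le> (\<Sum>\<^sub>\<infinity>k\<in>K. w k * cmod (c k))"
        by (rule finite_sum_le_infsum [OF f]) (use F k wcmod_nonneg in auto)
      finally show False
        using F(3) k(2) \<open>e > 0\<close> by (simp add: dist_real_def)
    qed
    then show ?thesis
      using F(1) by (auto intro: finite_subset [of _ F])
  qed
  with c show ?thesis
    by (simp add: lp_set_0_iff)
qed

end

section \<open>Operator norms\<close>

text \<open>What converts a supremum over the unit ball into an estimate for every vector:
  nonnegativity and scaling. The point of norm at most 1 makes the supremum range over a nonempty
  set.\<close>

definition homogeneous :: "'x nspace \<Rightarrow> bool" where
  "homogeneous X \<longleftrightarrow> (\<exists>x\<in>ns_carrier X. ns_norm X x \<le> 1) \<and>
     (\<forall>x\<in>ns_carrier X. 0 \<le> ns_norm X x \<and>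
        (\<forall>a. ns_scale X a x \<in> ns_carrier X \<and> ns_norm X (ns_scale X a x) = cmod a * ns_norm X x))"

lemma
  assumes T: "bounded_op X Y T" and X: "homogeneous X" and Y: "homogeneous Y"
  shows op_norm_nonneg: "0 \<le> op_norm X Y T"
    and op_norm_bound: "x \<in> ns_carrier X \<Longrightarrow> ns_norm Y (T x) \<le> op_norm X Y T * ns_norm X x"
proof -
  let ?N = "{ns_norm Y (T x) | x. x \<in> ns_carrier X \<and> ns_norm X x \<le> 1}"
  obtain C where C: "\<And>x. x \<in> ns_carrier X \<Longrightarrow> ns_norm Y (T x) \<le> C * ns_norm X x"
    and map: "\<And>x. x \<in> ns_carrier X \<Longrightarrow> T x \<in> ns_carrier Y"
    and scale: "\<And>a x. x \<in> ns_carrier X \<Longrightarrow> T (ns_scale X a x) = ns_scale Y a (T x)"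
    using T unfolding bounded_op_def by blast
  have Xn: "0 \<le> ns_norm X x" "ns_scale X a x \<in> ns_carrier X"
    "ns_norm X (ns_scale X a x) = cmod a * ns_norm X x" if "x \<in> ns_carrier X" for x a
    using X that by (auto simp: homogeneous_def)
  have Yn: "0 \<le> ns_norm Y y" "ns_norm Y (ns_scale Y a y) = cmod a * ns_norm Y y"
    if "y \<in> ns_carrier Y" for y a
    using Y that by (auto simp: homogeneous_def)
  have upper: "ns_norm Y (T x) \<le> op_norm X Y T" if x: "x \<in> ns_carrier X" "ns_norm X x \<le> 1" for x
    unfolding op_norm_def
  proof (rule cSup_upper)
    show "bdd_above ?N"
    proof (rule bdd_aboveI [of _ "\<bar>C\<bar>"], safe)
      fix x assume x: "x \<in> ns_carrier X" "ns_norm X x \<le> 1"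
      have "ns_norm Y (T x) \<le> \<bar>C\<bar> * ns_norm X x"
        using C [OF x(1)] Xn(1) [OF x(1)] by (meson abs_ge_self mult_right_mono order_trans)
      also have "\<dots> \<le> \<bar>C\<bar> * 1"
        using x by (intro mult_left_mono) auto
      finally show "ns_norm Y (T x) \<le> \<bar>C\<bar>" by simp
    qed
  qed (use x in blast)
  obtain x0 where x0: "x0 \<in> ns_carrier X" "ns_norm X x0 \<le> 1"
    using X by (auto simp: homogeneous_def)
  show nonneg: "0 \<le> op_norm X Y T"
    using upper [OF x0] Yn(1) [OF map [OF x0(1)]] by linarith
  assume x: "x \<in> ns_carrier X"
  show "ns_norm Y (T x) \<le> op_norm X Y T * ns_norm X x"
  proof (cases "ns_norm X x = 0")
    \<comment> \<open>A vector of norm 0 cannot be rescaled to norm 1; here the boundedness constant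
      itself gives the estimate.\<close>
    case True
    then show ?thesis
      using C [OF x] by simp
  next
    case False
    then have pos: "0 < ns_norm X x"
      using Xn(1) [OF x] by simp
    let ?a = "complex_of_real (1 / ns_norm X x)"
    have "ns_norm Y (T (ns_scale X ?a x)) \<le> op_norm X Y T"
      using pos Xn [OF x] by (intro upper) (auto simp: norm_divide)
    then show ?thesis
      using pos Yn(2) [OF map [OF x]] by (simp add: scale [OF x] norm_divide field_simps)
  qed
qed

lemma op_norm_le:
  assumes "homogeneous X" "0 \<le> C" "\<And>x. x \<in> ns_carrier X \<Longrightarrow> ns_norm Y (T x) \<le> C * ns_norm X x"
  shows "op_norm X Y T \<le> C"
  unfolding op_norm_def
proof (rule cSup_least)
  show "{ns_norm Y (T x) | x. x \<in> ns_carrier X \<and> ns_norm X x \<le> 1} \<noteq> {}"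
    using assms(1) by (auto simp: homogeneous_def)
  fix y assume "y \<in> {ns_norm Y (T x) | x. x \<in> ns_carrier X \<and> ns_norm X x \<le> 1}"
  then obtain x where x: "y = ns_norm Y (T x)" "x \<in> ns_carrier X" "ns_norm X x \<le> 1"
    by blast
  have "C * ns_norm X x \<le> C * 1"
    using x assms(2) by (intro mult_left_mono)
  then show "y \<le> C"
    using assms(3) [OF x(2)] x(1) by simp
qed

lemma homogeneous_lp:
  assumes "weight K w" "p = 0 \<or> 1 \<le> p"
  shows "homogeneous (lp K p w)"
proof -
  have "lp_norm K p w (\<lambda>k. 0) = 0"
    using lp_scale(2) [OF assms lp_zero [OF assms], of 0] by simp
  then show ?thesis
    using lp_zero [OF assms] lp_scale [OF assms] lp_norm_nonneg [OF assms]
    by (auto simp: homogeneous_def lp_def intro!: bexI [of _ "\<lambda>k. 0"])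
qed

lemma
  assumes M: "mat_bounded K p1 w1 p2 w2 M" and "weight K w1" "p1 = 0 \<or> 1 \<le> p1"
    and "weight K w2" "p2 = 0 \<or> 1 \<le> p2"
  shows mat_op_norm_nonneg: "0 \<le> op_norm (lp K p1 w1) (lp K p2 w2) (mat_app K M)"
    and mat_op_norm_bound: "c \<in> lp_set K p1 w1 \<Longrightarrow>
      lp_norm K p2 w2 (mat_app K M c) \<le> op_norm (lp K p1 w1) (lp K p2 w2) (mat_app K M) * lp_norm K p1 w1 c"
proof -
  have T: "bounded_op (lp K p1 w1) (lp K p2 w2) (mat_app K M)"
    using M by (simp add: mat_bounded_def)
  note h = T homogeneous_lp [OF assms(2,3)] homogeneous_lp [OF assms(4,5)]
  show "0 \<le> op_norm (lp K p1 w1) (lp K p2 w2) (mat_app K M)"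
    by (rule op_norm_nonneg [OF h])
  show "c \<in> lp_set K p1 w1 \<Longrightarrow>
      lp_norm K p2 w2 (mat_app K M c) \<le> op_norm (lp K p1 w1) (lp K p2 w2) (mat_app K M) * lp_norm K p1 w1 c"
    using op_norm_bound [OF h, of c] by (simp add: lp_def)
qed

section \<open>Schur bounds\<close>

text \<open>Weighted Schur test. The row condition says that the matrix of absolute values is
  bounded on the sup space with weight \<open>w\<close>, the column condition that it is bounded on
  the summable sequences with weight \<open>w\<close>. The rows also give absolute convergence
  against every sequence of the sup space.\<close>

definition schur :: "'i set \<Rightarrow> ('i \<Rightarrow> real) \<Rightarrow> 'i mat \<Rightarrow> bool" where
  "schur K w X \<longleftrightarrow> (\<exists>C.
     (\<forall>k\<in>K. (\<lambda>l. cmod (X k l) / w l) summable_on K \<and> (\<Sum>\<^sub>\<infinity>l\<in>K. cmod (X k l) / w l) \<le> C / w k) \<and>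
     (\<forall>l\<in>K. (\<lambda>k. w k * cmod (X k l)) summable_on K \<and> (\<Sum>\<^sub>\<infinity>k\<in>K. w k * cmod (X k l)) \<le> C * w l))"

lemma weight_inv: "weight K w \<Longrightarrow> weight K (inv_weight w)"
  by (simp add: weight_def inv_weight_def)

lemma schur_adj: "schur K w X \<Longrightarrow> schur K (inv_weight w) (mat_adj X)"
  unfolding schur_def inv_weight_def mat_adj_def by (simp add: mult.commute) blast

lemma schur_row:
  assumes "schur K w X" "k \<in> K"
  shows "(\<lambda>l. cmod (X k l) / w l) summable_on K"
  using assms unfolding schur_def by blast

lemma schur_column:
  assumes "schur K w X" "l \<in> K"
  shows "(\<lambda>k. w k * cmod (X k l)) summable_on K"
  using assms unfolding schur_def by blast

lemma infsum_complex_of_real: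
  "f summable_on K \<Longrightarrow> (\<Sum>\<^sub>\<infinity>k\<in>K. complex_of_real (f k)) = complex_of_real (infsum f K)"
  by (intro infsumI) (simp add: has_sum_of_real)

lemma abs_summable_mult_bounded:
  fixes x c :: "'i \<Rightarrow> complex"
  assumes w: "weight K w" and x: "(\<lambda>l. cmod (x l) / w l) summable_on K"
    and c: "\<And>l. l \<in> K \<Longrightarrow> w l * cmod (c l) \<le> M"
  shows "(\<lambda>l. cmod (x l * c l)) summable_on K"
    and "(\<Sum>\<^sub>\<infinity>l\<in>K. cmod (x l * c l)) \<le> M * (\<Sum>\<^sub>\<infinity>l\<in>K. cmod (x l) / w l)"
proof -
  have s: "(\<lambda>l. M * (cmod (x l) / w l)) summable_on K"
    by (rule summable_on_cmult_right [OF x])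
  have le: "cmod (x l * c l) \<le> M * (cmod (x l) / w l)" if l: "l \<in> K" for l
  proof -
    have "cmod (x l * c l) = (w l * cmod (c l)) * (cmod (x l) / w l)"
      using w_pos [OF w l] by (simp add: norm_mult)
    also have "\<dots> \<le> M * (cmod (x l) / w l)"
      using c [OF l] w_pos [OF w l] by (intro mult_right_mono) auto
    finally show ?thesis .
  qed
  show *: "(\<lambda>l. cmod (x l * c l)) summable_on K"
    by (rule summable_on_mono [OF s _ le]) auto
  have "(\<Sum>\<^sub>\<infinity>l\<in>K. cmod (x l * c l)) \<le> (\<Sum>\<^sub>\<infinity>l\<in>K. M * (cmod (x l) / w l))"
    by (rule infsum_mono [OF * s le])
  then show "(\<Sum>\<^sub>\<infinity>l\<in>K. cmod (x l * c l)) \<le> M * (\<Sum>\<^sub>\<infinity>l\<in>K. cmod (x l) / w l)"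
    by (simp only: infsum_cmult_right')
qed

lemma schur_summable:
  assumes "weight K w" "schur K w X" "c \<in> linf_set K w" "k \<in> K"
  shows "(\<lambda>l. X k l * c l) summable_on K"
  by (rule abs_summable_summable [OF abs_summable_mult_bounded(1) [OF assms(1) schur_row [OF assms(2,4)]
        wsup_upper [OF assms(3)]]])

lemma schur_linf:
  assumes w: "weight K w" and X: "schur K w X"
  obtains C where "0 \<le> C" "\<And>c. c \<in> linf_set K w \<Longrightarrow> mat_app K X c \<in> linf_set K w"
    "\<And>c. c \<in> linf_set K w \<Longrightarrow> wsup K w (mat_app K X c) \<le> C * wsup K w c"
proof -
  obtain C where C: "\<And>k. k \<in> K \<Longrightarrow> (\<Sum>\<^sub>\<infinity>l\<in>K. cmod (X k l) / w l) \<le> C / w k"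
    using X unfolding schur_def by blast
  have bound: "w k * cmod (mat_app K X c k) \<le> \<bar>C\<bar> * wsup K w c" if c: "c \<in> linf_set K w" and k: "k \<in> K" for c k
  proof -
    note * = abs_summable_mult_bounded [OF w schur_row [OF X k] wsup_upper [OF c]]
    have "cmod (mat_app K X c k) \<le> (\<Sum>\<^sub>\<infinity>l\<in>K. cmod (X k l * c l))"
      using norm_infsum_bound [OF *(1)] k by (simp add: mat_app_def)
    also have "\<dots> \<le> wsup K w c * (\<Sum>\<^sub>\<infinity>l\<in>K. cmod (X k l) / w l)"
      by (rule *(2))
    also have "\<dots> \<le> wsup K w c * (\<bar>C\<bar> / w k)"
    proof (intro mult_left_mono wsup_nonneg [OF c] order_trans [OF C [OF k]] divide_right_mono)
      show "0 \<le> w k" by (rule w_nonneg [OF w k])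
    qed simp
    finally show ?thesis
      using w_pos [OF w k] by (simp add: field_simps)
  qed
  show ?thesis
  proof (rule that [of "\<bar>C\<bar>"])
    fix c assume c: "c \<in> linf_set K w"
    show "mat_app K X c \<in> linf_set K w"
      by (rule linf_setI [OF mat_app_seqs bound [OF c]])
    show "wsup K w (mat_app K X c) \<le> \<bar>C\<bar> * wsup K w c"
      using bound [OF c] wsup_nonneg [OF c] by (intro wsup_le) auto
  qed simp
qed

text \<open>The condition on \<open>b\<close> is summability with weight \<open>1/w\<close>; with it
  the terms are absolutely summable over pairs of indices. With \<open>b\<close> a row of another
  matrix this gives associativity. With \<open>b\<close> the coefficients of a test element it gives
  the weak-* convergence of synthesis, for which the conclusion has the form
  \<open>has_sum\<close>.\<close>

lemma schur_fubini:
  assumes w: "weight K w" and X: "schur K w X" and c: "c \<in> linf_set K w"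
    and b: "(\<lambda>j. cmod (b j) / w j) summable_on K"
  shows "((\<lambda>l. (\<Sum>\<^sub>\<infinity>j\<in>K. b j * X j l) * c l) has_sum (\<Sum>\<^sub>\<infinity>j\<in>K. b j * (\<Sum>\<^sub>\<infinity>l\<in>K. X j l * c l))) K"
proof -
  obtain C where C: "\<And>k. k \<in> K \<Longrightarrow> (\<Sum>\<^sub>\<infinity>l\<in>K. cmod (X k l) / w l) \<le> C / w k"
    using X unfolding schur_def by blast
  let ?M = "wsup K w c"
  have abs: "(\<lambda>z. cmod (case z of (j, l) \<Rightarrow> b j * X j l * c l)) summable_on K \<times> K"
    unfolding Infinite_Sum.abs_summable_on_Sigma_iff
  proof (intro conjI ballI)
    fix j assume j: "j \<in> K"
    note * = abs_summable_mult_bounded [OF w schur_row [OF X j] wsup_upper [OF c]]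
    have "(\<lambda>l. cmod (b j) * cmod (X j l * c l)) summable_on K"
      by (rule summable_on_cmult_right [OF *(1)])
    then show "(\<lambda>l. cmod (case (j, l) of (j, l) \<Rightarrow> b j * X j l * c l)) summable_on K"
      by (simp add: norm_mult mult.assoc)
  next
    have s: "(\<lambda>j. (?M * \<bar>C\<bar>) * (cmod (b j) / w j)) summable_on K"
      by (rule summable_on_cmult_right [OF b])
    have "(\<Sum>\<^sub>\<infinity>l\<in>K. cmod (b j * X j l * c l)) \<le> (?M * \<bar>C\<bar>) * (cmod (b j) / w j)" if j: "j \<in> K" for j
    proof -
      note * = abs_summable_mult_bounded [OF w schur_row [OF X j] wsup_upper [OF c]]
      have "(\<Sum>\<^sub>\<infinity>l\<in>K. cmod (b j * X j l * c l)) = cmod (b j) * (\<Sum>\<^sub>\<infinity>l\<in>K. cmod (X j l * c l))"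
        by (simp add: norm_mult mult.assoc infsum_cmult_right')
      also have "\<dots> \<le> cmod (b j) * (?M * (\<bar>C\<bar> / w j))"
      proof (intro mult_left_mono order_trans [OF *(2)] order_trans [OF C [OF j]] divide_right_mono)
        show "0 \<le> ?M" by (rule wsup_nonneg [OF c])
        show "0 \<le> w j" by (rule w_nonneg [OF w j])
      qed simp_all
      finally show ?thesis
        by (simp add: mult_ac)
    qed
    moreover have "0 \<le> (\<Sum>\<^sub>\<infinity>l\<in>K. cmod (b j * X j l * c l))" for j
      by (rule infsum_nonneg) simp
    ultimately show "(\<lambda>j. norm (\<Sum>\<^sub>\<infinity>l\<in>K. cmod (case (j, l) of (j, l) \<Rightarrow> b j * X j l * c l))) summable_on K"
      by (intro summable_on_mono [OF s]) auto
  qed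
  then have sum: "(\<lambda>(j, l). b j * X j l * c l) summable_on K \<times> K"
    by (rule abs_summable_summable)
  then have sum': "(\<lambda>(l, j). b j * X j l * c l) summable_on K \<times> K"
    by (subst summable_on_swap) (simp add: case_prod_unfold)
  have eq1: "(\<Sum>\<^sub>\<infinity>j\<in>K. b j * X j l * c l) = (\<Sum>\<^sub>\<infinity>j\<in>K. b j * X j l) * c l" for l
    by (rule infsum_cmult_left')
  have eq2: "(\<Sum>\<^sub>\<infinity>l\<in>K. b j * X j l * c l) = b j * (\<Sum>\<^sub>\<infinity>l\<in>K. X j l * c l)" for j
    by (simp add: mult.assoc infsum_cmult_right')
  have "(\<lambda>l. \<Sum>\<^sub>\<infinity>j\<in>K. b j * X j l * c l) summable_on K"
    using summable_on_Sigma_banach [OF sum'] by simp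
  moreover have "(\<Sum>\<^sub>\<infinity>l\<in>K. \<Sum>\<^sub>\<infinity>j\<in>K. b j * X j l * c l) = (\<Sum>\<^sub>\<infinity>j\<in>K. \<Sum>\<^sub>\<infinity>l\<in>K. b j * X j l * c l)"
    by (rule infsum_swap_banach [OF sum, symmetric])
  ultimately show ?thesis
    by (simp add: has_sum_iff eq1 eq2)
qed

text \<open>Row \<open>k\<close> of \<open>X\<close> is summable against \<open>1/w\<close>, so it
  qualifies as the sequence \<open>b\<close> of \<open>schur_fubini\<close>.\<close>

lemma mat_app_mult:
  assumes "weight K w" "schur K w X" "schur K w Y" "c \<in> linf_set K w"
  shows "mat_app K X (mat_app K Y c) = mat_app K (mat_mult K X Y) c"
proof (rule seqs_eqI [OF mat_app_seqs mat_app_seqs])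
  fix k assume k: "k \<in> K"
  have "mat_app K X (mat_app K Y c) k = (\<Sum>\<^sub>\<infinity>j\<in>K. X k j * (\<Sum>\<^sub>\<infinity>l\<in>K. Y j l * c l))"
    using k by (simp add: mat_app_def cong: infsum_cong)
  also have "\<dots> = (\<Sum>\<^sub>\<infinity>l\<in>K. (\<Sum>\<^sub>\<infinity>j\<in>K. X k j * Y j l) * c l)"
    using schur_fubini [OF assms(1,3,4) schur_row [OF assms(2) k]] by (simp add: infsumI)
  also have "\<dots> = mat_app K (mat_mult K X Y) c k"
    using k by (simp add: mat_app_def mat_mult_def cong: infsum_cong)
  finally show "mat_app K X (mat_app K Y c) k = mat_app K (mat_mult K X Y) c k" .
qed

lemma mat_app_lin:
  assumes "weight K w" "schur K w X" "c \<in> linf_set K w" "d \<in> linf_set K w"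
  shows "mat_app K X (\<lambda>k. a * c k + b * d k) = (\<lambda>k. a * mat_app K X c k + b * mat_app K X d k)"
  using schur_summable [OF assms(1,2,3)] schur_summable [OF assms(1,2,4)] by (rule mat_app_linear)

lemma mat_app_trunc:
  assumes "finite F" "F \<subseteq> K" "k \<in> K"
  shows "mat_app K X (trunc F c) k = (\<Sum>l\<in>F. X k l * c l)"
proof -
  have "((\<lambda>l. X k l * trunc F c l) has_sum (\<Sum>l\<in>F. X k l * c l)) K"
    by (rule has_sum_finite_neutralI [where B = F]) (use assms in \<open>auto simp: trunc_def\<close>)
  then show ?thesis
    using assms(3) by (simp add: mat_app_def infsumI)
qed

lemma mat_app_trunc_tendsto:
  assumes "(\<lambda>l. X k l * c l) summable_on K" "k \<in> K"
  shows "((\<lambda>F. mat_app K X (trunc F c) k) \<longlongrightarrow> mat_app K X c k) (finite_subsets_at_top K)"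
proof -
  have "((\<lambda>F. \<Sum>l\<in>F. X k l * c l) \<longlongrightarrow> mat_app K X c k) (finite_subsets_at_top K)"
    using infsum_tendsto [OF assms(1)] assms(2) by (simp add: mat_app_def)
  moreover have "\<forall>\<^sub>F F in finite_subsets_at_top K. (\<Sum>l\<in>F. X k l * c l) = mat_app K X (trunc F c) k"
    by (rule eventually_finite_subsets_at_top_weakI) (simp add: mat_app_trunc assms(2))
  ultimately show ?thesis
    by (rule Lim_transform_eventually)
qed

lemma schur_column_lp1:
  assumes "weight K w" "schur K w X" "X \<in> mats K" "l \<in> K"
  shows "(\<lambda>k. X k l) \<in> lp_set K 1 w"
  using schur_column [OF assms(2,4)] assms(1,3,4) by (auto simp: lp_1_iff mats_def seqs_def)

text \<open>Columns are summable with the weight and hence decay; so do their finite combinations,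
  and decay survives limits in the sup norm.\<close>

lemma schur_lp0:
  assumes w: "weight K w" and X: "schur K w X" "X \<in> mats K" and c: "c \<in> lp_set K 0 w"
  shows "mat_app K X c \<in> lp_set K 0 w"
proof -
  obtain C where C: "0 \<le> C" "\<And>c. c \<in> linf_set K w \<Longrightarrow> mat_app K X c \<in> linf_set K w"
    "\<And>c. c \<in> linf_set K w \<Longrightarrow> wsup K w (mat_app K X c) \<le> C * wsup K w c"
    using schur_linf [OF w X(1)] by blast
  have fin: "mat_app K X (trunc F c) \<in> lp_set K 0 w" if F: "finite F" "F \<subseteq> K" for F
  proof -
    have "(\<lambda>k. \<Sum>l\<in>F. X k l * c l) \<in> lp_set K 0 w"
      using F
    proof (induction F)
      case (insert l F)
      have "(\<lambda>k. X k l) \<in> lp_set K 0 w"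
        using insert by (intro lp_1_subset_0 [OF w] schur_column_lp1 [OF w X]) auto
      from lp_lincomb [OF w _ this, of "\<lambda>k. \<Sum>l\<in>F. X k l * c l" "c l" 1] insert show ?case
        by (simp add: mult.commute)
    qed (simp add: lp_zero [OF w])
    moreover have "mat_app K X (trunc F c) = (\<lambda>k. \<Sum>l\<in>F. X k l * c l)"
    proof
      show "mat_app K X (trunc F c) k = (\<Sum>l\<in>F. X k l * c l)" for k
        using X(2) F by (cases "k \<in> K") (auto simp: mat_app_trunc, auto simp: mats_def mat_app_def)
    qed
    ultimately show ?thesis
      by simp
  qed
  have "finite {k \<in> K. e \<le> w k * cmod (mat_app K X c k)}" if "e > 0" for e
  proof -
    have cl: "c \<in> linf_set K w"
      using lp_0_subset_inf [OF w c] .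
    have tl: "trunc F c \<in> linf_set K w" for F
      using lp_0_subset_inf [OF w lp_trunc(1) [OF w _ c]] by simp
    have dl: "(\<lambda>k. c k - trunc F c k) \<in> linf_set K w" for F
      using linf_lincomb [OF w cl tl, of 1 "-1"] by simp
    have "((\<lambda>F. C * wsup K w (\<lambda>k. c k - trunc F c k)) \<longlongrightarrow> C * 0) (finite_subsets_at_top K)"
      by (intro tendsto_mult_left trunc_tendsto_sup [OF w c])
    then have "\<forall>\<^sub>F F in finite_subsets_at_top K. C * wsup K w (\<lambda>k. c k - trunc F c k) < e / 2"
      using \<open>e > 0\<close> by (intro order_tendstoD(2)) auto
    then obtain F where F: "finite F" "F \<subseteq> K" "C * wsup K w (\<lambda>k. c k - trunc F c k) < e / 2"
      unfolding eventually_finite_subsets_at_top by blast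
    have split: "mat_app K X (\<lambda>k. c k - trunc F c k) = (\<lambda>k. mat_app K X c k - mat_app K X (trunc F c) k)"
      using mat_app_lin [OF w X(1) cl tl, of 1 "-1"] by simp
    \<comment> \<open>Where the full image reaches \<open>e\<close>, the tail contributes less than
      \<open>e / 2\<close>, and the finite part must supply the rest.\<close>
    have "{k \<in> K. e \<le> w k * cmod (mat_app K X c k)} \<subseteq> {k \<in> K. e / 2 \<le> w k * cmod (mat_app K X (trunc F c) k)}"
    proof safe
      fix k assume k: "k \<in> K" "e \<le> w k * cmod (mat_app K X c k)"
      have "w k * cmod (mat_app K X c k - mat_app K X (trunc F c) k) < e / 2"
        using wsup_upper [OF C(2) [OF dl] k(1), of F] C(3) [OF dl, of F] F(3) unfolding split by linarith
      moreover have "w k * cmod (mat_app K X c k)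
          \<le> w k * (cmod (mat_app K X c k - mat_app K X (trunc F c) k) + cmod (mat_app K X (trunc F c) k))"
        by (intro mult_left_mono w_nonneg [OF w k(1)]) (metis diff_add_cancel norm_triangle_ineq)
      ultimately show "e / 2 \<le> w k * cmod (mat_app K X (trunc F c) k)"
        using k(2) by (simp add: distrib_left)
    qed
    moreover have "finite {k \<in> K. e / 2 \<le> w k * cmod (mat_app K X (trunc F c) k)}"
      using lp_set_0_iff [OF w, THEN iffD1, OF fin [OF F(1,2)], THEN conjunct2, rule_format, of "e / 2"] \<open>e > 0\<close>
      by simp
    ultimately show ?thesis
      by (rule finite_subset)
  qed
  then show ?thesis
    by (simp add: lp_set_0_iff [OF w] mat_app_seqs)
qed

text \<open>Exchanging the summations leaves the column sums. The result serves for the weight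
  \<open>1/w\<close>, where the Schur bounds are what is at hand.\<close>

lemma schur_lp1:
  assumes w: "weight K w" and X: "schur K w X"
  shows "mat_bounded K 1 w 1 w X"
proof -
  obtain C where C: "\<And>l. l \<in> K \<Longrightarrow> (\<Sum>\<^sub>\<infinity>k\<in>K. w k * cmod (X k l)) \<le> C * w l"
    using X unfolding schur_def by blast
  have main: "mat_app K X c \<in> lp_set K 1 w \<and> lp_norm K 1 w (mat_app K X c) \<le> \<bar>C\<bar> * lp_norm K 1 w c"
    if c: "c \<in> lp_set K 1 w" for c
  proof -
    have cs: "(\<lambda>l. w l * cmod (c l)) summable_on K"
      using c by (simp add: lp_1_iff [OF w])
    have cl: "c \<in> linf_set K w"
      using lp_subset_inf [OF w _ c] by simp
    define f where "f = (\<lambda>(l, k). w k * cmod (X k l) * cmod (c l))"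
    have col: "((\<lambda>k. f (l, k)) has_sum (\<Sum>\<^sub>\<infinity>k\<in>K. w k * cmod (X k l)) * cmod (c l)) K" if "l \<in> K" for l
      using has_sum_cmult_left [OF has_sum_infsum [OF schur_column [OF X that]], of "cmod (c l)"]
      by (simp add: f_def)
    have le: "(\<Sum>\<^sub>\<infinity>k\<in>K. w k * cmod (X k l)) * cmod (c l) \<le> \<bar>C\<bar> * (w l * cmod (c l))" if l: "l \<in> K" for l
    proof -
      have "(\<Sum>\<^sub>\<infinity>k\<in>K. w k * cmod (X k l)) \<le> \<bar>C\<bar> * w l"
        using C [OF l] w_nonneg [OF w l] by (meson abs_ge_self mult_right_mono order_trans)
      then show ?thesis
        by (simp add: mult_right_mono flip: mult.assoc)
    qed
    have s2: "(\<lambda>l. \<bar>C\<bar> * (w l * cmod (c l))) summable_on K"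
      by (rule summable_on_cmult_right [OF cs])
    have s1: "(\<lambda>l. (\<Sum>\<^sub>\<infinity>k\<in>K. w k * cmod (X k l)) * cmod (c l)) summable_on K"
      by (rule summable_on_mono [OF s2 _ le])
         (auto intro!: mult_nonneg_nonneg infsum_nonneg wcmod_nonneg [OF w])
    have fs: "f summable_on K \<times> K"
      by (rule summable_on_SigmaI [OF col s1]) (auto simp: f_def w_nonneg [OF w])
    have fs': "(\<lambda>(k, l). f (l, k)) summable_on K \<times> K"
      using fs by (subst (asm) summable_on_swap)
    have row: "(\<lambda>k. \<Sum>\<^sub>\<infinity>l\<in>K. f (l, k)) summable_on K"
      using summable_on_Sigma_banach [OF fs'] by simp
    have rowk: "(\<lambda>l. f (l, k)) summable_on K" if "k \<in> K" for k
      using summable_on_SigmaD1 [OF fs' that] .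
    have bd: "w k * cmod (mat_app K X c k) \<le> (\<Sum>\<^sub>\<infinity>l\<in>K. f (l, k))" if k: "k \<in> K" for k
    proof -
      have "cmod (mat_app K X c k) \<le> (\<Sum>\<^sub>\<infinity>l\<in>K. cmod (X k l * c l))"
        using norm_infsum_bound [OF abs_summable_mult_bounded(1) [OF w schur_row [OF X k] wsup_upper [OF cl]]] k
        by (simp add: mat_app_def)
      then have "w k * cmod (mat_app K X c k) \<le> w k * (\<Sum>\<^sub>\<infinity>l\<in>K. cmod (X k l * c l))"
        by (intro mult_left_mono w_nonneg [OF w k])
      also have "\<dots> = (\<Sum>\<^sub>\<infinity>l\<in>K. f (l, k))"
        by (simp add: f_def norm_mult mult.assoc infsum_cmult_right')
      finally show ?thesis .
    qed
    have mem: "(\<lambda>k. w k * cmod (mat_app K X c k)) summable_on K"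
      by (rule summable_on_mono [OF row wcmod_nonneg [OF w] bd])
    have "lp_norm K 1 w (mat_app K X c) \<le> (\<Sum>\<^sub>\<infinity>k\<in>K. \<Sum>\<^sub>\<infinity>l\<in>K. f (l, k))"
      unfolding lp_1_norm [OF w] by (rule infsum_mono [OF mem row bd])
    also have "\<dots> = (\<Sum>\<^sub>\<infinity>l\<in>K. \<Sum>\<^sub>\<infinity>k\<in>K. f (l, k))"
      by (rule infsum_swap_banach) (use fs' in simp)
    also have "\<dots> = (\<Sum>\<^sub>\<infinity>l\<in>K. (\<Sum>\<^sub>\<infinity>k\<in>K. w k * cmod (X k l)) * cmod (c l))"
      by (rule infsum_cong) (use col infsumI in blast)
    also have "\<dots> \<le> (\<Sum>\<^sub>\<infinity>l\<in>K. \<bar>C\<bar> * (w l * cmod (c l)))"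
      by (rule infsum_mono [OF s1 s2 le])
    also have "\<dots> = \<bar>C\<bar> * lp_norm K 1 w c"
      by (simp add: infsum_cmult_right' lp_1_norm [OF w])
    finally show ?thesis
      using mem by (simp add: lp_1_iff [OF w] mat_app_seqs)
  qed
  show ?thesis
  proof (rule mat_boundedI [where C = "\<bar>C\<bar>"])
    fix c k assume "c \<in> lp_set K 1 w" "k \<in> K"
    then show "(\<lambda>l. X k l * c l) summable_on K"
      using lp_subset_inf [OF w] by (intro schur_summable [OF w X]) auto
  qed (use main in auto)
qed

context matrix_algebra
begin

text \<open>The row bounds come from testing \<open>\<bar>X\<bar>\<close>, which belongs to the algebra by solidity, on \<open>1/w\<close> in
  \<open>\<ell>\<^sup>\<infinity>\<close>, the column bounds from testing \<open>X\<close> on unit sequences in \<open>\<ell>\<^sup>1\<close>. As the conditions on rows and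
  columns are exchanged by taking adjoints, they pass from \<open>w\<close> to \<open>1/w\<close>.\<close>

lemma admissible_schur:
  assumes adm: "admissible K \<A> w" and X: "X \<in> \<A>"
  shows "schur K w X"
proof -
  have w: "weight K w"
    using adm by (simp add: admissible_def)
  define Y :: "'i mat" where "Y k l = complex_of_real (cmod (X k l))" for k l
  have Y: "Y \<in> \<A>"
    using alg_mats [OF X] by (intro alg_solid [OF X]) (auto simp: Y_def mats_def)
  have bdd: "mat_bounded K \<infinity> w \<infinity> w Y" "mat_bounded K 1 w 1 w X"
    using adm X Y by (auto simp: admissible_def)
  define c :: "'i \<Rightarrow> complex" where "c l = (if l \<in> K then complex_of_real (1 / w l) else 0)" for l
  have wc: "w l * cmod (c l) = 1" if "l \<in> K" for l
    using w_pos [OF w that] that by (simp add: c_def norm_divide)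
  have c: "c \<in> lp_set K \<infinity> w"
    unfolding lp_set_inf by (rule linf_setI [where C = 1]) (use wc in \<open>auto simp: seqs_def c_def\<close>)
  obtain C1 where C1: "\<And>d. d \<in> lp_set K \<infinity> w \<Longrightarrow> wsup K w (mat_app K Y d) \<le> C1 * wsup K w d"
    using mat_boundedD(3) [OF bdd(1)] by (auto simp: lp_norm_inf)
  obtain C2 where C2: "\<And>d. d \<in> lp_set K 1 w \<Longrightarrow> lp_norm K 1 w (mat_app K X d) \<le> C2 * lp_norm K 1 w d"
    using mat_boundedD(3) [OF bdd(2)] by auto
  define C where "C = max \<bar>C1\<bar> C2"
  have row: "(\<lambda>l. cmod (X k l) / w l) summable_on K \<and> (\<Sum>\<^sub>\<infinity>l\<in>K. cmod (X k l) / w l) \<le> C / w k"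
    if k: "k \<in> K" for k
  proof -
    have "(\<lambda>l. Y k l * c l) summable_on K"
      by (rule mat_boundedD(1) [OF bdd(1) c k])
    then have "(\<lambda>l. complex_of_real (cmod (X k l) / w l)) summable_on K"
      by (rule summable_on_cong [THEN iffD1, rotated]) (simp add: Y_def c_def)
    then have s: "(\<lambda>l. cmod (X k l) / w l) summable_on K"
      using summable_on_Re by fastforce
    have "mat_app K Y c k = (\<Sum>\<^sub>\<infinity>l\<in>K. complex_of_real (cmod (X k l) / w l))"
      using k by (auto simp: mat_app_def Y_def c_def intro: infsum_cong)
    also have "\<dots> = complex_of_real (\<Sum>\<^sub>\<infinity>l\<in>K. cmod (X k l) / w l)"
      by (rule infsum_complex_of_real [OF s])
    finally have "\<bar>\<Sum>\<^sub>\<infinity>l\<in>K. cmod (X k l) / w l\<bar> = cmod (mat_app K Y c k)"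
      by (simp only: norm_of_real real_norm_def)
    then have "w k * (\<Sum>\<^sub>\<infinity>l\<in>K. cmod (X k l) / w l) \<le> w k * cmod (mat_app K Y c k)"
      by (intro mult_left_mono w_nonneg [OF w k]) simp
    also have "\<dots> \<le> wsup K w (mat_app K Y c)"
      using mat_boundedD(2) [OF bdd(1) c] k by (intro wsup_upper) (auto simp: lp_set_inf)
    also have "\<dots> \<le> C1 * wsup K w c"
      by (rule C1 [OF c])
    also have "\<dots> \<le> \<bar>C1\<bar> * 1"
      using wc c wsup_nonneg [of c K w] wsup_le [of 1 K w c] by (intro mult_mono) (auto simp: lp_set_inf)
    also have "\<dots> \<le> C"
      by (simp add: C_def)
    finally show ?thesis
      using s w_pos [OF w k] by (simp add: field_simps)
  qed
  have col: "(\<lambda>k. w k * cmod (X k l)) summable_on K \<and> (\<Sum>\<^sub>\<infinity>k\<in>K. w k * cmod (X k l)) \<le> C * w l"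
    if l: "l \<in> K" for l
  proof -
    have u: "((\<lambda>k. w k * cmod (unit_seq l k)) has_sum w l) K"
      by (rule has_sum_finite_neutralI [where B = "{l}"]) (use l in \<open>auto simp: unit_seq_def\<close>)
    then have ul: "unit_seq l \<in> lp_set K 1 w" "lp_norm K 1 w (unit_seq l) = w l"
      using l by (auto simp: lp_1_iff [OF w] lp_1_norm [OF w] has_sum_imp_summable infsumI seqs_def unit_seq_def)
    have "(\<lambda>k. X k l) \<in> lp_set K 1 w" "lp_norm K 1 w (\<lambda>k. X k l) \<le> C2 * w l"
      using mat_boundedD(2) [OF bdd(2) ul(1)] C2 [OF ul(1)] mat_app_unit_seq [OF alg_mats [OF X] l] ul(2)
      by simp_all
    moreover have "C2 * w l \<le> C * w l"
      using w_nonneg [OF w l] by (intro mult_right_mono) (auto simp: C_def)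
    ultimately show ?thesis
      by (auto simp: lp_1_iff [OF w] lp_1_norm [OF w])
  qed
  show ?thesis
    unfolding schur_def using row col by blast
qed

lemma admissible_schur_inv:
  assumes "admissible K \<A> w" "X \<in> \<A>"
  shows "schur K (inv_weight w) X"
  using schur_adj [OF admissible_schur [OF assms(1) alg_adj [OF assms(2)]]] by (simp add: mat_adj_def)

end

text \<open>By the Weierstrass test the finite partial sums converge uniformly in \<open>n\<close>,
  which permits the exchange of the two limits.\<close>

lemma dominated_infsum:
  fixes f :: "nat \<Rightarrow> 'i \<Rightarrow> complex"
  assumes g: "g summable_on K" and dom: "\<And>n j. j \<in> K \<Longrightarrow> cmod (f n j) \<le> g j"
    and lim: "\<And>j. j \<in> K \<Longrightarrow> (\<lambda>n. f n j) \<longlonglongrightarrow> h j"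
  shows "(\<lambda>n. infsum (f n) K) \<longlonglongrightarrow> infsum h K"
proof -
  have dom_h: "cmod (h j) \<le> g j" if j: "j \<in> K" for j
    by (rule tendsto_upperbound [OF tendsto_norm [OF lim [OF j]]]) (use dom [OF j] in auto)
  have g0: "0 \<le> g j" if "j \<in> K" for j
    using dom [OF that, of 0] norm_ge_zero order_trans by blast
  have unif: "uniform_limit UNIV (\<lambda>F n. \<Sum>j\<in>F. f n j) (\<lambda>n. infsum (f n) K) (finite_subsets_at_top K)"
    by (rule Weierstrass_m_test_general [OF _ g]) (use dom in auto)
  have fin: "\<forall>\<^sub>F F in finite_subsets_at_top K. ((\<lambda>n. \<Sum>j\<in>F. f n j) \<longlongrightarrow> (\<Sum>j\<in>F. h j)) sequentially"
    using lim by (intro eventually_finite_subsets_at_top_weakI tendsto_sum) auto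
  have "(\<lambda>j. cmod (h j)) summable_on K"
    by (rule summable_on_mono [OF g _ dom_h]) auto
  from infsum_tendsto [OF abs_summable_summable [OF this]]
  have "((\<lambda>F. \<Sum>j\<in>F. h j) \<longlongrightarrow> infsum h K) (finite_subsets_at_top K)" .
  from swap_uniform_limit' [OF fin this unif] show ?thesis
    by simp
qed

section \<open>Coorbit spaces through coefficient sequences\<close>

text \<open>Coorbit elements are classes of sequences over the natural numbers, whereas sums are
  limits along finite subsets; a cofinal sequence of finite subsets connects the two. This is where
  countability enters.\<close>

lemma countable_exhaustion:
  assumes "countable K"
  obtains E :: "nat \<Rightarrow> 'i set" where "\<And>n. finite (E n)" "\<And>n. E n \<subseteq> K"
    "filterlim E (finite_subsets_at_top K) sequentially"
proof
  let ?E = "\<lambda>n. {k \<in> K. to_nat_on K k < n}"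
  show fin: "finite (?E n)" for n
  proof (rule inj_on_finite)
    show "inj_on (to_nat_on K) (?E n)"
      using inj_on_to_nat_on [OF assms] by (rule inj_on_subset) auto
    show "to_nat_on K ` ?E n \<subseteq> {..<n}" by auto
  qed simp
  show "?E n \<subseteq> K" for n by auto
  show "filterlim ?E (finite_subsets_at_top K) sequentially"
    unfolding filterlim_finite_subsets_at_top
  proof (intro allI impI)
    fix X assume X: "finite X \<and> X \<subseteq> K"
    define m where "m = Suc (Max (insert 0 (to_nat_on K ` X)))"
    have "X \<subseteq> ?E n" if "m \<le> n" for n
    proof
      fix k assume k: "k \<in> X"
      then have "to_nat_on K k \<le> Max (insert 0 (to_nat_on K ` X))"
        using X by (intro Max_ge) auto
      then have "to_nat_on K k < n"
        using that unfolding m_def by linarith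
      then show "k \<in> ?E n"
        using k X by auto
    qed
    then show "\<forall>\<^sub>F n in sequentially. finite (?E n) \<and> X \<subseteq> ?E n \<and> ?E n \<subseteq> K"
      using fin unfolding eventually_sequentially by (intro exI [of _ m]) auto
  qed
qed

text \<open>The terms of a matrix operator agree on \<open>K\<close> only with the coefficients
  times frame vectors, because \<open>mat_app\<close> is cut off outside \<open>K\<close>.\<close>

lemma coorbit_sums_cong:
  assumes "\<And>k. k \<in> K \<Longrightarrow> x k = y k"
  shows "coorbit_sums K \<Psi> p w x X \<longleftrightarrow> coorbit_sums K \<Psi> p w y X"
proof -
  have eq: "sum x F = sum y F" if "F \<subseteq> K" for F
    using assms that by (intro sum.cong) auto
  have ev: "\<forall>\<^sub>F F in finite_subsets_at_top K. sum x F = sum y F"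
    by (intro eventually_finite_subsets_at_top_weakI eq)
  have "((\<lambda>F. g (sum x F)) \<longlongrightarrow> l) (finite_subsets_at_top K)
      \<longleftrightarrow> ((\<lambda>F. g (sum y F)) \<longlongrightarrow> l) (finite_subsets_at_top K)" for g :: "_ \<Rightarrow> 'x::topological_space" and l
    by (rule tendsto_cong) (use ev in eventually_elim, simp)
  note this [of "\<lambda>s. pairing K \<Psi> (emb K \<Psi> w s) Y" for Y]
    this [of "\<lambda>s. ns_norm (coorbit K \<Psi> p w) (ns_diff (coorbit K \<Psi> p w) (emb K \<Psi> w s) X)"]
  moreover have "(\<forall>F. finite F \<and> F \<subseteq> K \<longrightarrow> emb K \<Psi> w (sum x F) \<in> coorbit_set K \<Psi> p w)
      \<longleftrightarrow> (\<forall>F. finite F \<and> F \<subseteq> K \<longrightarrow> emb K \<Psi> w (sum y F) \<in> coorbit_set K \<Psi> p w)"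
    using eq by auto
  ultimately show ?thesis
    unfolding coorbit_sums_def by simp
qed

locale coorbit_frame = localized_frame K \<Psi> A B \<A> N
  for K :: "'i set" and \<Psi> :: "'i \<Rightarrow> 'h::complex_hilbert" and A B \<A> N +
  assumes countable_K: "countable K"
begin

definition schur_weight :: "('i \<Rightarrow> real) \<Rightarrow> bool" where
  "schur_weight w \<longleftrightarrow> weight K w \<and> (\<forall>X\<in>\<A>. schur K w X)"

text \<open>Common form of the three pairs in play: an admissible weight with
  \<open>p \<ge> 1\<close>, the same weight with \<open>p = 0\<close>, and \<open>1/w\<close> with
  \<open>p = 1\<close>. Boundedness is part of admissibility in the first case and follows from the
  Schur bounds in the other two.\<close>

definition schur_space :: "ereal \<Rightarrow> ('i \<Rightarrow> real) \<Rightarrow> bool" where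
  "schur_space p w \<longleftrightarrow> schur_weight w \<and> (p = 0 \<or> 1 \<le> p) \<and> (\<forall>X\<in>\<A>. mat_bounded K p w p w X)"

lemma schur_spaceD:
  assumes "schur_space p w"
  shows "schur_weight w" "weight K w" "p = 0 \<or> 1 \<le> p"
    "X \<in> \<A> \<Longrightarrow> schur K w X" "X \<in> \<A> \<Longrightarrow> mat_bounded K p w p w X"
  using assms by (auto simp: schur_space_def schur_weight_def)

lemma admissible_schur_space:
  assumes adm: "admissible K \<A> w" and p: "p = 0 \<or> 1 \<le> p"
  shows "schur_space p w"
proof -
  have w: "weight K w"
    using adm by (simp add: admissible_def)
  note X = admissible_schur [OF adm]
  have "mat_bounded K p w p w X" if X_alg: "X \<in> \<A>" for X
  proof (cases "p = 0")
    case True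
    obtain C where C: "0 \<le> C" "\<And>c. c \<in> linf_set K w \<Longrightarrow> mat_app K X c \<in> linf_set K w"
      "\<And>c. c \<in> linf_set K w \<Longrightarrow> wsup K w (mat_app K X c) \<le> C * wsup K w c"
      using schur_linf [OF w X [OF X_alg]] by blast
    have "mat_bounded K 0 w 0 w X"
    proof (rule mat_boundedI)
      fix c assume c: "c \<in> lp_set K 0 w"
      show "(\<lambda>l. X k l * c l) summable_on K" if "k \<in> K" for k
        by (rule schur_summable [OF w X [OF X_alg] lp_0_subset_inf [OF w c] that])
      show "mat_app K X c \<in> lp_set K 0 w"
        by (rule schur_lp0 [OF w X [OF X_alg] alg_mats [OF X_alg] c])
      show "lp_norm K 0 w (mat_app K X c) \<le> C * lp_norm K 0 w c"
        using C(3) [OF lp_0_subset_inf [OF w c]] by (simp add: lp_norm_0)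
    qed
    then show ?thesis
      using True by simp
  next
    case False
    then show ?thesis
      using adm p X_alg by (auto simp: admissible_def)
  qed
  then show ?thesis
    using w X p by (simp add: schur_space_def schur_weight_def)
qed

lemma admissible_schur_space_inv:
  assumes adm: "admissible K \<A> w"
  shows "schur_space 1 (inv_weight w)"
proof -
  have "weight K (inv_weight w)"
    using adm by (intro weight_inv) (simp add: admissible_def)
  then show ?thesis
    using admissible_schur_inv [OF adm] schur_lp1 by (auto simp: schur_space_def schur_weight_def)
qed

lemma analysis_dual_sum:
  assumes "finite F" "F \<subseteq> K"
  shows "analysis K dual (\<Sum>k\<in>F. c k *\<^sub>C \<Phi> k) = mat_app K (gram K dual \<Phi>) (trunc F c)"
proof
  fix k
  show "analysis K dual (\<Sum>k\<in>F. c k *\<^sub>C \<Phi> k) k = mat_app K (gram K dual \<Phi>) (trunc F c) k"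
  proof (cases "k \<in> K")
    case True
    have "analysis K dual (\<Sum>k\<in>F. c k *\<^sub>C \<Phi> k) k = (\<Sum>l\<in>F. gram K dual \<Phi> k l * c l)"
      using True assms(2)
      by (auto simp: analysis_def gram_def cinner_sum_left cinner_scaleC_left mult.commute intro!: sum.cong)
    then show ?thesis
      using mat_app_trunc [OF assms True, of "gram K dual \<Phi>" c] by simp
  qed (simp add: analysis_def mat_app_def)
qed

section \<open>Classes of sequences and their limiting coefficients\<close>

definition lim_coef :: "(nat \<Rightarrow> 'h) \<Rightarrow> 'i \<Rightarrow> complex" where
  "lim_coef f = (\<lambda>k. if k \<in> K then lim (\<lambda>n. cinner (f n) (dual k)) else 0)"

lemma coef_conv: "coef K \<Psi> X = lim_coef (SOME f. f \<in> X)"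
  by (simp add: coef_def lim_coef_def)

context
  fixes w assumes w: "schur_weight w"
begin

lemma weight_w: "weight K w" and schur_w: "X \<in> \<A> \<Longrightarrow> schur K w X"
  using w by (auto simp: schur_weight_def)

abbreviation C\<^sub>w where "C\<^sub>w \<equiv> coorbit_seqs K \<Psi> w"
abbreviation class_of where "class_of f \<equiv> coorbit_rel K \<Psi> w `` {f}"

lemma seqs_tendsto:
  assumes "f \<in> C\<^sub>w" "k \<in> K"
  shows "(\<lambda>n. cinner (f n) (dual k)) \<longlonglongrightarrow> lim_coef f k"
  using assms by (simp add: coorbit_seqs_def lim_coef_def convergent_LIMSEQ_iff)

lemma lim_coefI:
  assumes "\<And>k. k \<in> K \<Longrightarrow> (\<lambda>n. cinner (f n) (dual k)) \<longlonglongrightarrow> \<alpha> k" "\<alpha> \<in> seqs K"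
  shows "lim_coef f = \<alpha>"
  using assms by (auto simp: lim_coef_def seqs_def fun_eq_iff limI)

lemma rel_iff: "(f, g) \<in> coorbit_rel K \<Psi> w \<longleftrightarrow> f \<in> C\<^sub>w \<and> g \<in> C\<^sub>w \<and> lim_coef f = lim_coef g"
proof -
  have "(\<lambda>n. cinner (f n - g n) (dual k)) \<longlonglongrightarrow> 0 \<longleftrightarrow> lim_coef f k = lim_coef g k"
    if "f \<in> C\<^sub>w" "g \<in> C\<^sub>w" "k \<in> K" for k
  proof -
    have lim: "(\<lambda>n. cinner (f n - g n) (dual k)) \<longlonglongrightarrow> lim_coef f k - lim_coef g k"
      unfolding cinner_diff_left by (intro tendsto_diff seqs_tendsto that)
    show ?thesis
      using LIMSEQ_unique [OF lim, of 0] lim by auto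
  qed
  moreover have "lim_coef f = lim_coef g \<longleftrightarrow> (\<forall>k\<in>K. lim_coef f k = lim_coef g k)"
    by (auto simp: lim_coef_def fun_eq_iff)
  ultimately show ?thesis
    unfolding coorbit_rel_def by auto
qed

lemma class_of_eq: "f \<in> C\<^sub>w \<Longrightarrow> class_of f = {g \<in> C\<^sub>w. lim_coef g = lim_coef f}"
  by (auto simp: rel_iff)

lemma class_of_coorbit: "f \<in> C\<^sub>w \<Longrightarrow> class_of f \<in> coorbit_inf K \<Psi> w"
  by (simp add: coorbit_inf_def quotientI)

text \<open>Equivalent sequences have the same limiting coefficients, so the representative chosen
  inside \<open>coef\<close> is immaterial.\<close>

lemma coef_class: "f \<in> C\<^sub>w \<Longrightarrow> coef K \<Psi> (class_of f) = lim_coef f"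
proof -
  assume f: "f \<in> C\<^sub>w"
  then have "f \<in> class_of f"
    by (simp add: rel_iff)
  define g where "g = (SOME g. g \<in> class_of f)"
  have "g \<in> class_of f"
    unfolding g_def by (rule someI [where P = "\<lambda>g. g \<in> class_of f"]) fact
  then show ?thesis
    unfolding coef_conv g_def [symmetric] by (simp add: rel_iff)
qed

lemma coorbit_infE:
  assumes "X \<in> coorbit_inf K \<Psi> w"
  obtains f where "f \<in> C\<^sub>w" "X = class_of f" "coef K \<Psi> X = lim_coef f"
  using assms coef_class unfolding coorbit_inf_def by (metis quotientE)

lemma coef_inject:
  assumes "X \<in> coorbit_inf K \<Psi> w" "Y \<in> coorbit_inf K \<Psi> w" "coef K \<Psi> X = coef K \<Psi> Y"
  shows "X = Y"
proof -
  obtain f where f: "f \<in> C\<^sub>w" "X = class_of f" "coef K \<Psi> X = lim_coef f"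
    using coorbit_infE [OF assms(1)] .
  obtain g where g: "g \<in> C\<^sub>w" "Y = class_of g" "coef K \<Psi> Y = lim_coef g"
    using coorbit_infE [OF assms(2)] .
  show ?thesis
    using f g assms(3) by (simp add: class_of_eq)
qed

lemma coorbit_seqs_lincomb:
  assumes f: "f \<in> C\<^sub>w" and g: "g \<in> C\<^sub>w"
  shows "(\<lambda>n. a *\<^sub>C f n + b *\<^sub>C g n) \<in> C\<^sub>w"
    "lim_coef (\<lambda>n. a *\<^sub>C f n + b *\<^sub>C g n) = (\<lambda>k. a * lim_coef f k + b * lim_coef g k)"
proof -
  let ?h = "\<lambda>n. a *\<^sub>C f n + b *\<^sub>C g n"
  have lim: "(\<lambda>n. cinner (?h n) (dual k)) \<longlonglongrightarrow> a * lim_coef f k + b * lim_coef g k" if "k \<in> K" for k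
    unfolding cinner_add_left cinner_scaleC_left
    by (intro tendsto_add tendsto_mult tendsto_const seqs_tendsto f g that)
  have an: "analysis K dual (?h n) = (\<lambda>k. a * analysis K dual (f n) k + b * analysis K dual (g n) k)" for n
    by (auto simp: analysis_def cinner_add_left cinner_scaleC_left)
  have inf: "analysis K dual (f n) \<in> linf_set K w" "analysis K dual (g n) \<in> linf_set K w" for n
    using f g by (auto simp: coorbit_seqs_def)
  obtain Cf Cg where C: "\<And>n. wsup K w (analysis K dual (f n)) \<le> Cf" "\<And>n. wsup K w (analysis K dual (g n)) \<le> Cg"
    using f g by (auto simp: coorbit_seqs_def bdd_above_def lp_norm_inf)
  have "wsup K w (analysis K dual (?h n)) \<le> cmod a * Cf + cmod b * Cg" for n
    unfolding an by (rule order_trans [OF wsup_lincomb [OF weight_w inf]]) (intro add_mono mult_left_mono C norm_ge_zero)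
  moreover have "analysis K dual (?h n) \<in> linf_set K w" for n
    unfolding an by (rule linf_lincomb [OF weight_w inf])
  ultimately show "?h \<in> C\<^sub>w"
    using lim by (auto simp: coorbit_seqs_def convergent_def lp_norm_inf intro!: bdd_aboveI2)
  show "lim_coef ?h = (\<lambda>k. a * lim_coef f k + b * lim_coef g k)"
    by (rule lim_coefI) (use lim in \<open>auto simp: seqs_def lim_coef_def\<close>)
qed

lemma coorbit_add:
  assumes "X \<in> coorbit_inf K \<Psi> w" "Y \<in> coorbit_inf K \<Psi> w"
  shows "coorbit_add K \<Psi> w X Y \<in> coorbit_inf K \<Psi> w"
    "coef K \<Psi> (coorbit_add K \<Psi> w X Y) = (\<lambda>k. coef K \<Psi> X k + coef K \<Psi> Y k)"
proof -
  obtain f where f: "f \<in> C\<^sub>w" "X = class_of f" "coef K \<Psi> X = lim_coef f"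
    using coorbit_infE [OF assms(1)] .
  obtain g where g: "g \<in> C\<^sub>w" "Y = class_of g" "coef K \<Psi> Y = lim_coef g"
    using coorbit_infE [OF assms(2)] .
  have sum: "(\<lambda>n. f' n + g' n) \<in> C\<^sub>w" "lim_coef (\<lambda>n. f' n + g' n) = (\<lambda>k. lim_coef f k + lim_coef g k)"
    if "f' \<in> X" "g' \<in> Y" for f' g'
    using that f g coorbit_seqs_lincomb [of f' g' 1 1] by (auto simp: class_of_eq)
  have ne: "f \<in> X" "g \<in> Y"
    using f g by (auto simp: class_of_eq)
  have "class_of (\<lambda>n. f' n + g' n) = class_of (\<lambda>n. f n + g n)" if "f' \<in> X" "g' \<in> Y" for f' g'
    using sum [OF that] sum [OF ne] by (simp add: class_of_eq)
  then have eq: "coorbit_add K \<Psi> w X Y = class_of (\<lambda>n. f n + g n)"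
    using ne unfolding coorbit_add_def by blast
  show "coorbit_add K \<Psi> w X Y \<in> coorbit_inf K \<Psi> w"
    unfolding eq by (rule class_of_coorbit [OF sum(1) [OF ne]])
  show "coef K \<Psi> (coorbit_add K \<Psi> w X Y) = (\<lambda>k. coef K \<Psi> X k + coef K \<Psi> Y k)"
    unfolding eq coef_class [OF sum(1) [OF ne]] using sum(2) [OF ne] f g by simp
qed

lemma coorbit_scale:
  assumes "X \<in> coorbit_inf K \<Psi> w"
  shows "coorbit_scale K \<Psi> w a X \<in> coorbit_inf K \<Psi> w"
    "coef K \<Psi> (coorbit_scale K \<Psi> w a X) = (\<lambda>k. a * coef K \<Psi> X k)"
proof -
  obtain f where f: "f \<in> C\<^sub>w" "X = class_of f" "coef K \<Psi> X = lim_coef f"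
    using coorbit_infE [OF assms] .
  have sc: "(\<lambda>n. a *\<^sub>C f' n) \<in> C\<^sub>w" "lim_coef (\<lambda>n. a *\<^sub>C f' n) = (\<lambda>k. a * lim_coef f k)"
    if "f' \<in> X" for f'
    using that f coorbit_seqs_lincomb [of f' f' a 0] by (auto simp: class_of_eq)
  have ne: "f \<in> X"
    using f by (auto simp: class_of_eq)
  have "class_of (\<lambda>n. a *\<^sub>C f' n) = class_of (\<lambda>n. a *\<^sub>C f n)" if "f' \<in> X" for f'
    using sc [OF that] sc [OF ne] by (simp add: class_of_eq)
  then have eq: "coorbit_scale K \<Psi> w a X = class_of (\<lambda>n. a *\<^sub>C f n)"
    using ne unfolding coorbit_scale_def by blast
  show "coorbit_scale K \<Psi> w a X \<in> coorbit_inf K \<Psi> w"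
    unfolding eq by (rule class_of_coorbit [OF sc(1) [OF ne]])
  show "coef K \<Psi> (coorbit_scale K \<Psi> w a X) = (\<lambda>k. a * coef K \<Psi> X k)"
    unfolding eq coef_class [OF sc(1) [OF ne]] using sc(2) [OF ne] f by simp
qed

text \<open>The coefficients of each Hilbert space vector in the sequence are fixed by P. Their
  uniform bound M in the weighted sup norm supplies the majorant M times
  \<open>cmod (proj k j) / w j\<close>, under which the fixed-point equation passes to the
  limit.\<close>

lemma coef_range:
  assumes "X \<in> coorbit_inf K \<Psi> w"
  shows "coef K \<Psi> X \<in> linf_set K w" "mat_app K proj (coef K \<Psi> X) = coef K \<Psi> X"
proof -
  obtain f where f: "f \<in> C\<^sub>w" "coef K \<Psi> X = lim_coef f"
    using coorbit_infE [OF assms] by metis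
  define \<alpha> where "\<alpha> n = analysis K dual (f n)" for n
  have inf: "\<alpha> n \<in> linf_set K w" for n
    using f by (auto simp: coorbit_seqs_def \<alpha>_def)
  obtain M where M: "\<And>n. wsup K w (\<alpha> n) \<le> M"
    using f by (auto simp: coorbit_seqs_def bdd_above_def lp_norm_inf \<alpha>_def)
  have lim: "(\<lambda>n. \<alpha> n k) \<longlonglongrightarrow> coef K \<Psi> X k" if "k \<in> K" for k
    using seqs_tendsto [OF f(1) that] that f(2) by (simp add: \<alpha>_def analysis_def)
  have bound: "w k * cmod (\<alpha> n k) \<le> M" if "k \<in> K" for n k
    by (rule order_trans [OF wsup_upper [OF inf that] M])
  have seqs: "coef K \<Psi> X \<in> seqs K"
    by (simp add: seqs_def coef_def)
  show "coef K \<Psi> X \<in> linf_set K w"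
  proof (rule linf_setI [OF seqs])
    fix k assume k: "k \<in> K"
    have "(\<lambda>n. w k * cmod (\<alpha> n k)) \<longlonglongrightarrow> w k * cmod (coef K \<Psi> X k)"
      by (intro tendsto_intros lim k)
    then show "w k * cmod (coef K \<Psi> X k) \<le> M"
      by (rule tendsto_upperbound) (use bound [OF k] in auto)
  qed
  show "mat_app K proj (coef K \<Psi> X) = coef K \<Psi> X"
  proof (rule seqs_eqI [OF mat_app_seqs seqs])
    fix k assume k: "k \<in> K"
    have "(\<lambda>n. \<Sum>\<^sub>\<infinity>j\<in>K. proj k j * \<alpha> n j) \<longlonglongrightarrow> (\<Sum>\<^sub>\<infinity>j\<in>K. proj k j * coef K \<Psi> X j)"
    proof (rule dominated_infsum)
      show "(\<lambda>j. M * (cmod (proj k j) / w j)) summable_on K"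
        by (rule summable_on_cmult_right [OF schur_row [OF schur_w [OF proj_alg] k]])
      show "cmod (proj k j * \<alpha> n j) \<le> M * (cmod (proj k j) / w j)" if "j \<in> K" for n j
      proof -
        have "cmod (proj k j * \<alpha> n j) = (w j * cmod (\<alpha> n j)) * (cmod (proj k j) / w j)"
          using w_pos [OF weight_w that] by (simp add: norm_mult)
        also have "\<dots> \<le> M * (cmod (proj k j) / w j)"
          using bound [OF that] w_pos [OF weight_w that] by (intro mult_right_mono) auto
        finally show ?thesis .
      qed
      show "(\<lambda>n. proj k j * \<alpha> n j) \<longlonglongrightarrow> proj k j * coef K \<Psi> X j" if "j \<in> K" for j
        by (intro tendsto_intros lim that)
    qed
    moreover have "(\<Sum>\<^sub>\<infinity>j\<in>K. proj k j * \<alpha> n j) = \<alpha> n k" for n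
      using fun_cong [OF proj_analysis_dual [of "f n"], of k] k by (simp add: mat_app_def \<alpha>_def)
    ultimately have "(\<lambda>n. \<alpha> n k) \<longlonglongrightarrow> mat_app K proj (coef K \<Psi> X) k"
      using k by (simp add: mat_app_def)
    with lim [OF k] show "mat_app K proj (coef K \<Psi> X) k = coef K \<Psi> X k"
      using LIMSEQ_unique by blast
  qed
qed

lemma emb_coorbit:
  assumes "analysis K dual f \<in> linf_set K w"
  shows "emb K \<Psi> w f \<in> coorbit_inf K \<Psi> w" "coef K \<Psi> (emb K \<Psi> w f) = analysis K dual f"
proof -
  have f: "(\<lambda>_. f) \<in> C\<^sub>w"
    using assms by (auto simp: coorbit_seqs_def convergent_const)
  then show "emb K \<Psi> w f \<in> coorbit_inf K \<Psi> w"
    unfolding emb_def by (rule class_of_coorbit)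
  show "coef K \<Psi> (emb K \<Psi> w f) = analysis K dual f"
    unfolding emb_def coef_class [OF f] by (auto simp: lim_coef_def analysis_def fun_eq_iff)
qed

text \<open>The representing sequence consists of the syntheses of truncations of \<alpha> along an
  exhaustion. Their coefficients are P applied to the truncations: uniformly bounded, and convergent
  in each coordinate to P \<alpha> = \<alpha>.\<close>

lemma coef_surj:
  assumes \<alpha>: "\<alpha> \<in> linf_set K w" and inv: "mat_app K proj \<alpha> = \<alpha>"
  obtains X where "X \<in> coorbit_inf K \<Psi> w" "coef K \<Psi> X = \<alpha>"
proof -
  obtain E :: "nat \<Rightarrow> 'i set" where E: "\<And>n. finite (E n)" "\<And>n. E n \<subseteq> K"
    "filterlim E (finite_subsets_at_top K) sequentially"
    using countable_exhaustion [OF countable_K] by blast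
  obtain C where C: "0 \<le> C" "\<And>c. c \<in> linf_set K w \<Longrightarrow> mat_app K proj c \<in> linf_set K w"
    "\<And>c. c \<in> linf_set K w \<Longrightarrow> wsup K w (mat_app K proj c) \<le> C * wsup K w c"
    using schur_linf [OF weight_w schur_w [OF proj_alg]] by blast
  define f where "f n = (\<Sum>k\<in>E n. \<alpha> k *\<^sub>C \<Psi> k)" for n
  have an: "analysis K dual (f n) = mat_app K proj (trunc (E n) \<alpha>)" for n
    unfolding f_def by (rule analysis_dual_sum [OF E(1,2)])
  have tr: "trunc (E n) \<alpha> \<in> linf_set K w" "wsup K w (trunc (E n) \<alpha>) \<le> wsup K w \<alpha>" for n
    using lp_trunc [OF weight_w, of \<infinity> \<alpha>] \<alpha> by (auto simp: lp_set_inf lp_norm_inf)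
  have lim: "(\<lambda>n. cinner (f n) (dual k)) \<longlonglongrightarrow> \<alpha> k" if k: "k \<in> K" for k
  proof -
    have "(\<lambda>n. mat_app K proj (trunc (E n) \<alpha>) k) \<longlonglongrightarrow> mat_app K proj \<alpha> k"
      by (rule filterlim_compose [OF mat_app_trunc_tendsto E(3)])
         (rule schur_summable [OF weight_w schur_w [OF proj_alg] \<alpha> k], rule k)
    then show ?thesis
      using k unfolding an [symmetric] inv by (simp add: analysis_def)
  qed
  have "wsup K w (analysis K dual (f n)) \<le> C * wsup K w \<alpha>" for n
    unfolding an using C(3) [OF tr(1), of n] tr(2) [of n] C(1) by (meson mult_left_mono order_trans)
  then have f: "f \<in> C\<^sub>w"
    using lim C(2) [OF tr(1)]
    by (auto simp: coorbit_seqs_def convergent_def lp_norm_inf an intro!: bdd_aboveI2)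
  show ?thesis
  proof (rule that [of "class_of f"])
    show "class_of f \<in> coorbit_inf K \<Psi> w"
      by (rule class_of_coorbit [OF f])
    show "coef K \<Psi> (class_of f) = \<alpha>"
      unfolding coef_class [OF f] by (rule lim_coefI [OF lim linf_set_seqs [OF \<alpha>]])
  qed
qed

end

text \<open>This turns the completion into a condition on coefficients. A limit of finite
  combinations has its coefficients in the sequence space; conversely, truncating the coefficients
  and applying P yields approximants, since P is bounded and fixes the coefficients.\<close>

lemma coorbit_set_iff:
  assumes sp: "schur_space p w"
  shows "X \<in> coorbit_set K \<Psi> p w \<longleftrightarrow> X \<in> coorbit_inf K \<Psi> w \<and> coef K \<Psi> X \<in> lp_set K p w"
proof -
  note w = schur_spaceD(2) [OF sp] and sw = schur_spaceD(1) [OF sp] and p = schur_spaceD(3) [OF sp]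
  note P = schur_spaceD(4,5) [OF sp proj_alg]
  \<comment> \<open>For \<open>p = 0\<close> the completion is taken in the sup norm, so the
    differences are only known to be bounded; decay is recovered separately in that case.\<close>
  define r where "r = (if p = 0 then \<infinity> else p)"
  have r: "r = 0 \<or> 1 \<le> r" and pr: "lp_norm K r w = lp_norm K p w" "p \<noteq> 0 \<Longrightarrow> r = p"
    using p by (auto simp: r_def lp_norm_0 lp_norm_inf)
  have sub: "c \<in> lp_set K p w \<Longrightarrow> c \<in> lp_set K r w" for c
    using lp_0_subset_inf [OF w] by (auto simp: r_def lp_set_inf)
  show ?thesis
  proof (cases "p = \<infinity>")
    case True
    then show ?thesis
      using coef_range(1) [OF sw] by (auto simp: coorbit_set_def lp_set_inf)
  next
    case False
    have set_iff: "X \<in> coorbit_set K \<Psi> p w \<longleftrightarrow> X \<in> coorbit_inf K \<Psi> w \<and>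
        (\<exists>g::nat \<Rightarrow> 'h. (\<forall>n. g n \<in> coorbit_fin K \<Psi> \<and>
           (\<lambda>k. coef K \<Psi> X k - analysis K dual (g n) k) \<in> lp_set K r w) \<and>
           (\<lambda>n. lp_norm K r w (\<lambda>k. coef K \<Psi> X k - analysis K dual (g n) k)) \<longlonglongrightarrow> 0)"
      using False by (simp add: coorbit_set_def Let_def r_def)
    have fin: "analysis K dual h \<in> lp_set K p w" if h: "h \<in> coorbit_fin K \<Psi>" for h
    proof -
      obtain c where c: "c \<in> fin_seqs K" "h = (\<Sum>k | c k \<noteq> 0. c k *\<^sub>C \<Psi> k)"
        using h by (auto simp: coorbit_fin_def)
      have "analysis K dual h = mat_app K proj (trunc {k. c k \<noteq> 0} c)"
        unfolding c(2) by (rule analysis_dual_sum) (use c(1) in \<open>auto simp: fin_seqs_def seqs_def\<close>)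
      also have "trunc {k. c k \<noteq> 0} c = c"
        by (auto simp: trunc_def)
      finally show ?thesis
        using mat_boundedD(2) [OF P(2) fin_seqs_lp [OF w p c(1)]] by simp
    qed
    show ?thesis
    proof
      assume "X \<in> coorbit_set K \<Psi> p w"
      then obtain g where X: "X \<in> coorbit_inf K \<Psi> w" and g: "\<And>n. g n \<in> coorbit_fin K \<Psi>"
        "\<And>n. (\<lambda>k. coef K \<Psi> X k - analysis K dual (g n) k) \<in> lp_set K r w"
        "(\<lambda>n. lp_norm K r w (\<lambda>k. coef K \<Psi> X k - analysis K dual (g n) k)) \<longlonglongrightarrow> 0"
        unfolding set_iff by blast
      have "coef K \<Psi> X \<in> lp_set K p w"
      proof (cases "p = 0")
        case False
        then show ?thesis
          using lp_lincomb [OF w p g(2) [of 0, unfolded pr(2) [OF False]] fin [OF g(1) [of 0]], of 1 1] by simp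
      next
        case True
        have "finite {k \<in> K. e \<le> w k * cmod (coef K \<Psi> X k)}" if "e > 0" for e
        proof -
          have "\<forall>\<^sub>F n in sequentially. lp_norm K r w (\<lambda>k. coef K \<Psi> X k - analysis K dual (g n) k) < e / 2"
            using g(3) that by (intro order_tendstoD(2)) auto
          then obtain n where n: "lp_norm K r w (\<lambda>k. coef K \<Psi> X k - analysis K dual (g n) k) < e / 2"
            using eventually_happens' [OF sequentially_bot] by blast
          have "{k \<in> K. e \<le> w k * cmod (coef K \<Psi> X k)} \<subseteq> {k \<in> K. e / 2 \<le> w k * cmod (analysis K dual (g n) k)}"
          proof safe
            fix k assume k: "k \<in> K" "e \<le> w k * cmod (coef K \<Psi> X k)"
            have "w k * cmod (coef K \<Psi> X k - analysis K dual (g n) k) < e / 2"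
              using lp_coordinate [OF w r g(2) k(1)] n by (rule le_less_trans)
            moreover have "w k * cmod (coef K \<Psi> X k)
                \<le> w k * (cmod (coef K \<Psi> X k - analysis K dual (g n) k) + cmod (analysis K dual (g n) k))"
              by (intro mult_left_mono w_nonneg [OF w k(1)]) (metis diff_add_cancel norm_triangle_ineq)
            ultimately show "e / 2 \<le> w k * cmod (analysis K dual (g n) k)"
              using k(2) by (simp add: distrib_left)
          qed
          moreover have "finite {k \<in> K. e / 2 \<le> w k * cmod (analysis K dual (g n) k)}"
            using fin [OF g(1), of n] True that lp_set_0_iff [OF w, of "analysis K dual (g n)"]
            by (metis half_gt_zero)
          ultimately show ?thesis
            by (rule finite_subset)
        qed
        then show ?thesis
          using True linf_set_seqs [OF coef_range(1) [OF sw X]] by (simp add: lp_set_0_iff [OF w])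
      qed
      with X show "X \<in> coorbit_inf K \<Psi> w \<and> coef K \<Psi> X \<in> lp_set K p w" ..
    next
      assume R: "X \<in> coorbit_inf K \<Psi> w \<and> coef K \<Psi> X \<in> lp_set K p w"
      define \<alpha> where "\<alpha> = coef K \<Psi> X"
      have X: "X \<in> coorbit_inf K \<Psi> w" and \<alpha>: "\<alpha> \<in> lp_set K p w"
        using R by (auto simp: \<alpha>_def)
      have inv: "mat_app K proj \<alpha> = \<alpha>"
        unfolding \<alpha>_def by (rule coef_range(2) [OF sw X])
      obtain E :: "nat \<Rightarrow> 'i set" where E: "\<And>n. finite (E n)" "\<And>n. E n \<subseteq> K"
        "filterlim E (finite_subsets_at_top K) sequentially"
        using countable_exhaustion [OF countable_K] by blast
      define g where "g n = (\<Sum>k\<in>E n. \<alpha> k *\<^sub>C \<Psi> k)" for n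
      have tr: "(\<lambda>k. \<alpha> k - trunc (E n) \<alpha> k) \<in> lp_set K p w" for n
        by (rule lp_diff [OF w p \<alpha> lp_trunc(1) [OF w p \<alpha>]])
      have diff: "(\<lambda>k. \<alpha> k - analysis K dual (g n) k) = mat_app K proj (\<lambda>k. \<alpha> k - trunc (E n) \<alpha> k)" for n
        using mat_app_lin [OF w P(1) lp_subset_inf [OF w p \<alpha>] lp_subset_inf [OF w p lp_trunc(1) [OF w p \<alpha>]], of 1 "-1" "E n"]
        unfolding g_def analysis_dual_sum [OF E(1,2)] by (simp add: inv)
      obtain C where C: "\<And>c. c \<in> lp_set K p w \<Longrightarrow> lp_norm K p w (mat_app K proj c) \<le> C * lp_norm K p w c"
        using mat_boundedD(3) [OF P(2)] by blast
      have lim: "(\<lambda>n. lp_norm K r w (\<lambda>k. \<alpha> k - analysis K dual (g n) k)) \<longlonglongrightarrow> 0"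
      proof (rule Lim_null_comparison)
        have "lp_norm K p w (\<lambda>k. \<alpha> k - analysis K dual (g n) k) \<le> C * lp_norm K p w (\<lambda>k. \<alpha> k - trunc (E n) \<alpha> k)"
          "0 \<le> lp_norm K p w (\<lambda>k. \<alpha> k - analysis K dual (g n) k)" for n
          unfolding diff by (rule C [OF tr], rule lp_norm_nonneg [OF w p mat_boundedD(2) [OF P(2) tr]])
        then show "\<forall>\<^sub>F n in sequentially. norm (lp_norm K r w (\<lambda>k. \<alpha> k - analysis K dual (g n) k))
            \<le> C * lp_norm K p w (\<lambda>k. \<alpha> k - trunc (E n) \<alpha> k)"
          unfolding pr(1) by (intro always_eventually) simp
        show "(\<lambda>n. C * lp_norm K p w (\<lambda>k. \<alpha> k - trunc (E n) \<alpha> k)) \<longlonglongrightarrow> 0"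
          using False
          by (intro tendsto_mult_right_zero filterlim_compose [OF trunc_tendsto [OF w p \<alpha>] E(3)]) simp
      qed
      have gfin: "g n \<in> coorbit_fin K \<Psi>" for n
      proof -
        have "g n = (\<Sum>k | trunc (E n) \<alpha> k \<noteq> 0. trunc (E n) \<alpha> k *\<^sub>C \<Psi> k)"
          unfolding g_def by (rule sum.mono_neutral_cong_right) (use E(1) in \<open>auto simp: trunc_def\<close>)
        then show ?thesis
          using trunc_fin_seqs [OF E(1,2)] unfolding coorbit_fin_def by blast
      qed
      have "(\<lambda>k. \<alpha> k - analysis K dual (g n) k) \<in> lp_set K r w" for n
        unfolding diff by (intro sub mat_boundedD(2) [OF P(2) tr])
      with gfin lim X show "X \<in> coorbit_set K \<Psi> p w"
        unfolding set_iff \<alpha>_def [symmetric] by blast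
    qed
  qed
qed

end

section \<open>The matrix of a bounded operator on sequences\<close>

lemma mult_cnj_sgn: "z * cnj (sgn z) = complex_of_real (cmod z)"
proof (cases "z = 0")
  case False
  have "z * cnj (sgn z) = (z * cnj z) / complex_of_real (cmod z)"
    by (simp add: sgn_eq)
  also have "\<dots> = complex_of_real (cmod z)"
    using False by (simp add: complex_norm_square [symmetric] power2_eq_square)
  finally show ?thesis .
qed simp

text \<open>Abstracts the composition of synthesis, operator and analysis, so that the passage from
  operator to matrix takes place on sequences alone. For \<open>p1 = \<infinity>\<close> the actions
  of \<open>U\<close> and \<open>M\<close> may differ; they are linked through the unit
  sequences.\<close>

locale sequence_operator =
  fixes K :: "'i set" and p1 p2 :: ereal and w1 w2 :: "'i \<Rightarrow> real"
    and U :: "('i \<Rightarrow> complex) \<Rightarrow> 'i \<Rightarrow> complex" and R :: real and M :: "'i mat"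
  assumes w1: "weight K w1" and w2: "weight K w2" and p1: "p1 = 0 \<or> 1 \<le> p1" and p2: "p2 = 0 \<or> 1 \<le> p2"
    and U_mem: "\<And>c. c \<in> lp_set K p1 w1 \<Longrightarrow> U c \<in> lp_set K p2 w2"
    and U_lin: "\<And>a b c d. c \<in> lp_set K p1 w1 \<Longrightarrow> d \<in> lp_set K p1 w1 \<Longrightarrow>
        U (\<lambda>k. a * c k + b * d k) = (\<lambda>k. a * U c k + b * U d k)"
    and U_bound: "\<And>c. c \<in> lp_set K p1 w1 \<Longrightarrow> lp_norm K p2 w2 (U c) \<le> R * lp_norm K p1 w1 c"
    and R: "0 \<le> R"
    and M: "\<And>k l. k \<in> K \<Longrightarrow> l \<in> K \<Longrightarrow> M k l = U (unit_seq l) k"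
begin

lemma U_trunc:
  assumes "finite F" "F \<subseteq> K" "k \<in> K"
  shows "U (trunc F c) k = (\<Sum>l\<in>F. M k l * c l)"
  using assms(1,2)
proof (induction F)
  case empty
  have "U (\<lambda>k. 0) = (\<lambda>k. 0)"
    using U_lin [OF lp_zero [OF w1 p1] lp_zero [OF w1 p1], of 0 0] by simp
  then show ?case
    by (simp add: trunc_def)
next
  case (insert l F)
  have mem: "trunc F c \<in> lp_set K p1 w1" "unit_seq l \<in> lp_set K p1 w1"
    using insert trunc_fin_seqs [of F K c]
    by (auto intro!: fin_seqs_lp [OF w1 p1] simp: fin_seqs_def seqs_def unit_seq_def)
  have "trunc (insert l F) c = (\<lambda>k. 1 * trunc F c k + c l * unit_seq l k)"
    using insert by (auto simp: trunc_def unit_seq_def fun_eq_iff)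
  then have "U (trunc (insert l F) c) k = U (trunc F c) k + c l * U (unit_seq l) k"
    using U_lin [OF mem, of 1 "c l"] by simp
  then show ?case
    using insert M [OF assms(3), of l] by simp
qed

text \<open>Truncations converge in norm under the condition on \<open>c\<close>, and the
  coordinates of \<open>U\<close> are continuous.\<close>

lemma has_sum_U:
  assumes c: "c \<in> lp_set K p1 w1" and "p1 \<noteq> \<infinity> \<or> c \<in> lp_set K 0 w1" and k: "k \<in> K"
  shows "((\<lambda>l. M k l * c l) has_sum U c k) K"
proof -
  have tr: "trunc F c \<in> lp_set K p1 w1" for F
    by (rule lp_trunc(1) [OF w1 p1 c])
  have diff: "(\<lambda>k. c k - trunc F c k) \<in> lp_set K p1 w1" for F
    by (rule lp_diff [OF w1 p1 c tr])
  have U_diff: "U c k - U (trunc F c) k = U (\<lambda>k. c k - trunc F c k) k" for F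
    using U_lin [OF c tr, of 1 "-1" F] by simp
  have "((\<lambda>F. U c k - U (trunc F c) k) \<longlongrightarrow> 0) (finite_subsets_at_top K)"
  proof (rule Lim_null_comparison)
    show "\<forall>\<^sub>F F in finite_subsets_at_top K. norm (U c k - U (trunc F c) k)
        \<le> R / w2 k * lp_norm K p1 w1 (\<lambda>k. c k - trunc F c k)"
    proof (intro always_eventually allI)
      fix F
      have "w2 k * cmod (U c k - U (trunc F c) k) \<le> R * lp_norm K p1 w1 (\<lambda>k. c k - trunc F c k)"
        unfolding U_diff by (rule order_trans [OF lp_coordinate [OF w2 p2 U_mem [OF diff] k] U_bound [OF diff]])
      then show "norm (U c k - U (trunc F c) k) \<le> R / w2 k * lp_norm K p1 w1 (\<lambda>k. c k - trunc F c k)"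
        using w_pos [OF w2 k] by (simp add: field_simps)
    qed
    show "((\<lambda>F. R / w2 k * lp_norm K p1 w1 (\<lambda>k. c k - trunc F c k)) \<longlongrightarrow> 0) (finite_subsets_at_top K)"
      by (intro tendsto_mult_right_zero trunc_tendsto [OF w1 p1 c assms(2)])
  qed
  then have "((\<lambda>F. U c k - (U c k - U (trunc F c) k)) \<longlongrightarrow> U c k - 0) (finite_subsets_at_top K)"
    by (intro tendsto_diff tendsto_const)
  then have "((\<lambda>F. U (trunc F c) k) \<longlongrightarrow> U c k) (finite_subsets_at_top K)"
    by simp
  moreover have "\<forall>\<^sub>F F in finite_subsets_at_top K. U (trunc F c) k = (\<Sum>l\<in>F. M k l * c l)"
    by (rule eventually_finite_subsets_at_top_weakI) (rule U_trunc [OF _ _ k])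
  ultimately show ?thesis
    unfolding has_sum_def by (rule Lim_transform_eventually)
qed

lemma mat_app_eq_U:
  assumes "c \<in> lp_set K p1 w1" "p1 \<noteq> \<infinity> \<or> c \<in> lp_set K 0 w1"
  shows "mat_app K M c = U c"
  using has_sum_U [OF assms] lp_set_seqs [OF U_mem [OF assms(1)]]
  by (intro seqs_eqI [OF mat_app_seqs]) (auto simp: mat_app_def infsumI)

text \<open>Boundedness is tested on finite sequences dominated by \<open>c\<close> whose phases
  make every term of the row nonnegative. The bound does not depend on the finite set, so the row
  converges absolutely even when truncations of \<open>c\<close> do not converge in norm.\<close>

lemma row_summable:
  assumes c: "c \<in> lp_set K p1 w1" and k: "k \<in> K"
  shows "(\<lambda>l. M k l * c l) summable_on K"
proof (rule abs_summable_summable, rule nonneg_bdd_above_summable_on)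
  show "bdd_above (sum (\<lambda>l. cmod (M k l * c l)) ` {F. F \<subseteq> K \<and> finite F})"
  proof (rule bdd_aboveI2)
    fix F assume F: "F \<in> {F. F \<subseteq> K \<and> finite F}"
    define d where "d l = c l * cnj (sgn (M k l * c l))" for l
    have d_le: "cmod (d l) \<le> cmod (c l)" for l
      by (simp add: d_def norm_mult norm_sgn)
    have seq: "trunc F d \<in> seqs K"
      using F by (auto simp: trunc_def seqs_def)
    have d: "trunc F d \<in> lp_set K p1 w1" "lp_norm K p1 w1 (trunc F d) \<le> lp_norm K p1 w1 c"
      by (rule lp_dominated [OF w1 p1 c seq], simp add: trunc_def d_le)+
    have "complex_of_real (\<Sum>l\<in>F. cmod (M k l * c l)) = (\<Sum>l\<in>F. M k l * d l)"
      by (simp add: d_def mult_cnj_sgn flip: mult.assoc)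
    also have "\<dots> = U (trunc F d) k"
      using F by (intro U_trunc [symmetric] k) auto
    finally have "\<bar>\<Sum>l\<in>F. cmod (M k l * c l)\<bar> = cmod (U (trunc F d) k)"
      by (metis norm_of_real real_norm_def)
    then have "w2 k * (\<Sum>l\<in>F. cmod (M k l * c l)) \<le> w2 k * cmod (U (trunc F d) k)"
      using w_nonneg [OF w2 k] by (intro mult_left_mono) auto
    also have "\<dots> \<le> R * lp_norm K p1 w1 (trunc F d)"
      by (rule order_trans [OF lp_coordinate [OF w2 p2 U_mem [OF d(1)] k] U_bound [OF d(1)]])
    also have "\<dots> \<le> R * lp_norm K p1 w1 c"
      by (rule mult_left_mono [OF d(2) R])
    finally show "(\<Sum>l\<in>F. cmod (M k l * c l)) \<le> R * lp_norm K p1 w1 c / w2 k"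
      using w_pos [OF w2 k] by (simp add: field_simps)
  qed
qed simp

text \<open>The pair \<open>p1 = \<infinity>\<close>, \<open>p2 = 0\<close> is excluded because the
  coordinatewise limit of the images of truncations could leave the closure of the finite
  sequences.\<close>

lemma
  assumes p: "p1 = \<infinity> \<Longrightarrow> 1 \<le> p2"
  shows mat_bounded_M: "mat_bounded K p1 w1 p2 w2 M"
    and op_norm_M: "op_norm (lp K p1 w1) (lp K p2 w2) (mat_app K M) \<le> R"
proof -
  have main: "mat_app K M c \<in> lp_set K p2 w2 \<and> lp_norm K p2 w2 (mat_app K M c) \<le> R * lp_norm K p1 w1 c"
    if c: "c \<in> lp_set K p1 w1" for c
  proof (cases "p1 = \<infinity>")
    case False
    then show ?thesis
      using mat_app_eq_U [OF c] U_mem [OF c] U_bound [OF c] by simp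
  next
    case True
    have tr: "trunc F c \<in> lp_set K p1 w1" "lp_norm K p1 w1 (trunc F c) \<le> lp_norm K p1 w1 c" for F
      by (rule lp_trunc [OF w1 p1 c])+
    have bd: "\<forall>\<^sub>F F in finite_subsets_at_top K. mat_app K M (trunc F c) \<in> lp_set K p2 w2 \<and>
        lp_norm K p2 w2 (mat_app K M (trunc F c)) \<le> R * lp_norm K p1 w1 c"
    proof (rule eventually_finite_subsets_at_top_weakI)
      fix F assume F: "finite F" "F \<subseteq> K"
      have eq: "mat_app K M (trunc F c) = U (trunc F c)"
        using F by (intro seqs_eqI [OF mat_app_seqs lp_set_seqs [OF U_mem [OF tr(1)]]])
          (simp add: mat_app_trunc U_trunc)
      show "mat_app K M (trunc F c) \<in> lp_set K p2 w2 \<and>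
        lp_norm K p2 w2 (mat_app K M (trunc F c)) \<le> R * lp_norm K p1 w1 c"
        unfolding eq using U_mem [OF tr(1)] order_trans [OF U_bound [OF tr(1)] mult_left_mono [OF tr(2) R]] by blast
    qed
    have lim: "((\<lambda>F. mat_app K M (trunc F c) k) \<longlongrightarrow> mat_app K M c k) (finite_subsets_at_top K)" if "k \<in> K" for k
      by (rule mat_app_trunc_tendsto [where X = M and c = c, OF row_summable [OF c that] that])
    have nonneg: "0 \<le> R * lp_norm K p1 w1 c"
      by (intro mult_nonneg_nonneg R lp_norm_nonneg [OF w1 p1 c])
    note lp_fatou [where c = "mat_app K M c" and d = "\<lambda>F. mat_app K M (trunc F c)"
        and G = "finite_subsets_at_top K", OF w2 p [OF True] mat_app_seqs nonneg finite_subsets_at_top_neq_bot lim bd]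
    then show ?thesis
      by blast
  qed
  show "mat_bounded K p1 w1 p2 w2 M"
    by (rule mat_boundedI [where C = R]) (use row_summable main in auto)
  show "op_norm (lp K p1 w1) (lp K p2 w2) (mat_app K M) \<le> R"
    by (rule op_norm_le [OF homogeneous_lp [OF w1 p1] R]) (use main in \<open>auto simp: lp_def\<close>)
qed

end

section \<open>Analysis and synthesis on coorbit spaces\<close>

context coorbit_frame
begin

lemma coorbit_carrier [simp]: "ns_carrier (coorbit K \<Psi> p w) = coorbit_set K \<Psi> p w"
  and coorbit_ns_add [simp]: "ns_add (coorbit K \<Psi> p w) = coorbit_add K \<Psi> w"
  and coorbit_ns_scale [simp]: "ns_scale (coorbit K \<Psi> p w) = coorbit_scale K \<Psi> w"
  and coorbit_ns_norm [simp]: "ns_norm (coorbit K \<Psi> p w) X = lp_norm K p w (coef K \<Psi> X)"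
  by (simp_all add: coorbit_def)

lemma coef_surj_space:
  assumes sp: "schur_space p w" and "\<alpha> \<in> lp_set K p w" "mat_app K proj \<alpha> = \<alpha>"
  obtains X where "X \<in> coorbit_set K \<Psi> p w" "coef K \<Psi> X = \<alpha>"
  using coef_surj [OF schur_spaceD(1) [OF sp] lp_subset_inf [OF schur_spaceD(2,3) [OF sp] assms(2)] assms(3)]
    coorbit_set_iff [OF sp] assms(2) by metis

lemma coorbit_lincomb:
  assumes sp: "schur_space p w" and X: "X \<in> coorbit_set K \<Psi> p w" and Y: "Y \<in> coorbit_set K \<Psi> p w"
  shows "coorbit_add K \<Psi> w (coorbit_scale K \<Psi> w a X) (coorbit_scale K \<Psi> w b Y) \<in> coorbit_set K \<Psi> p w"
    "coef K \<Psi> (coorbit_add K \<Psi> w (coorbit_scale K \<Psi> w a X) (coorbit_scale K \<Psi> w b Y))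
       = (\<lambda>k. a * coef K \<Psi> X k + b * coef K \<Psi> Y k)"
proof -
  note sw = schur_spaceD(1) [OF sp] and iff = coorbit_set_iff [OF sp]
  have inf: "X \<in> coorbit_inf K \<Psi> w" "Y \<in> coorbit_inf K \<Psi> w"
    and lp: "coef K \<Psi> X \<in> lp_set K p w" "coef K \<Psi> Y \<in> lp_set K p w"
    using X Y by (auto simp: iff)
  note sc = coorbit_scale [OF sw inf(1)] coorbit_scale [OF sw inf(2)]
  show coef: "coef K \<Psi> (coorbit_add K \<Psi> w (coorbit_scale K \<Psi> w a X) (coorbit_scale K \<Psi> w b Y))
       = (\<lambda>k. a * coef K \<Psi> X k + b * coef K \<Psi> Y k)"
    using coorbit_add(2) [OF sw sc(1,3)] by (simp add: sc)
  show "coorbit_add K \<Psi> w (coorbit_scale K \<Psi> w a X) (coorbit_scale K \<Psi> w b Y) \<in> coorbit_set K \<Psi> p w"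
    unfolding iff coef using coorbit_add(1) [OF sw sc(1,3)] lp_lincomb [OF schur_spaceD(2,3) [OF sp] lp] by blast
qed

lemma coorbit_scale_set:
  assumes sp: "schur_space p w" and X: "X \<in> coorbit_set K \<Psi> p w"
  shows "coorbit_scale K \<Psi> w a X \<in> coorbit_set K \<Psi> p w"
  using X coorbit_scale [OF schur_spaceD(1) [OF sp]] lp_scale(1) [OF schur_spaceD(2,3) [OF sp]]
  by (simp add: coorbit_set_iff [OF sp])

lemma coorbit_inject:
  assumes sp: "schur_space p w" and "X \<in> coorbit_set K \<Psi> p w" "Y \<in> coorbit_set K \<Psi> p w"
    and "coef K \<Psi> X = coef K \<Psi> Y"
  shows "X = Y"
  using assms coef_inject [OF schur_spaceD(1) [OF sp]] by (simp add: coorbit_set_iff [OF sp])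

lemma homogeneous_coorbit:
  assumes sp: "schur_space p w"
  shows "homogeneous (coorbit K \<Psi> p w)"
proof -
  note w = schur_spaceD(2,3) [OF sp] and iff = coorbit_set_iff [OF sp]
  obtain Z where Z: "Z \<in> coorbit_set K \<Psi> p w" "coef K \<Psi> Z = (\<lambda>k. 0)"
    by (rule coef_surj_space [OF sp lp_zero [OF w]]) (simp_all add: mat_app_def fun_eq_iff)
  have 0: "lp_norm K p w (\<lambda>k. 0) = 0"
    using lp_scale(2) [OF w lp_zero [OF w], of 0] by simp
  have "ns_norm (coorbit K \<Psi> p w) Z \<le> 1"
    by (simp add: Z 0)
  moreover have "0 \<le> lp_norm K p w (coef K \<Psi> X)"
    "lp_norm K p w (coef K \<Psi> (coorbit_scale K \<Psi> w a X)) = cmod a * lp_norm K p w (coef K \<Psi> X)"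
    if "X \<in> coorbit_set K \<Psi> p w" for X a
    using that lp_norm_nonneg [OF w] lp_scale(2) [OF w] coorbit_scale(2) [OF schur_spaceD(1) [OF sp]]
    by (auto simp: iff)
  ultimately show ?thesis
    using Z(1) coorbit_scale_set [OF sp] by (auto simp: homogeneous_def)
qed

lemma emb_sum:
  assumes sp: "schur_space p w" and G: "gram K dual \<Phi> \<in> \<A>" and F: "finite F" "F \<subseteq> K"
  shows "emb K \<Psi> w (\<Sum>k\<in>F. c k *\<^sub>C \<Phi> k) \<in> coorbit_set K \<Psi> p w"
    "coef K \<Psi> (emb K \<Psi> w (\<Sum>k\<in>F. c k *\<^sub>C \<Phi> k)) = mat_app K (gram K dual \<Phi>) (trunc F c)"
proof -
  note w = schur_spaceD(2,3) [OF sp]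
  have lp: "mat_app K (gram K dual \<Phi>) (trunc F c) \<in> lp_set K p w"
    by (rule mat_boundedD(2) [OF schur_spaceD(5) [OF sp G] fin_seqs_lp [OF w trunc_fin_seqs [OF F]]])
  have "analysis K dual (\<Sum>k\<in>F. c k *\<^sub>C \<Phi> k) \<in> linf_set K w"
    unfolding analysis_dual_sum [OF F] by (rule lp_subset_inf [OF w lp])
  note emb = emb_coorbit [OF schur_spaceD(1) [OF sp] this]
  show coef: "coef K \<Psi> (emb K \<Psi> w (\<Sum>k\<in>F. c k *\<^sub>C \<Phi> k)) = mat_app K (gram K dual \<Phi>) (trunc F c)"
    unfolding emb(2) by (rule analysis_dual_sum [OF F])
  show "emb K \<Psi> w (\<Sum>k\<in>F. c k *\<^sub>C \<Phi> k) \<in> coorbit_set K \<Psi> p w"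
    unfolding coorbit_set_iff [OF sp] coef using emb(1) lp by blast
qed

lemma emb_elem:
  assumes sp: "schur_space p w" and G: "gram K dual \<Phi> \<in> \<A>" and k: "k \<in> K"
  shows "emb K \<Psi> w (\<Phi> k) \<in> coorbit_set K \<Psi> p w"
    "coef K \<Psi> (emb K \<Psi> w (\<Phi> k)) = mat_app K (gram K dual \<Phi>) (unit_seq k)"
    "coef K \<Psi> (emb K \<Psi> w (\<Phi> k)) = analysis K dual (\<Phi> k)"
proof -
  have "trunc {k} (unit_seq k) = unit_seq k"
    by (auto simp: trunc_def unit_seq_def)
  then show "emb K \<Psi> w (\<Phi> k) \<in> coorbit_set K \<Psi> p w"
    and coef: "coef K \<Psi> (emb K \<Psi> w (\<Phi> k)) = mat_app K (gram K dual \<Phi>) (unit_seq k)"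
    using emb_sum [OF sp G, of "{k}" "unit_seq k"] k by (simp_all add: unit_seq_def)
  show "coef K \<Psi> (emb K \<Psi> w (\<Phi> k)) = analysis K dual (\<Phi> k)"
    unfolding coef mat_app_unit_seq [OF gram_mats k] using k by (auto simp: gram_def analysis_def)
qed

text \<open>For an embedded Hilbert space vector the Gram matrix inside \<open>pairing\<close> turns
  dual coefficients back into inner products with \<Psi>; their conjugates form row \<open>k\<close>
  of the cross-Gram matrix.\<close>

lemma pairing_emb:
  assumes "schur_space 1 v" "gram K dual \<Phi> \<in> \<A>" "k \<in> K"
  shows "pairing K \<Psi> X (emb K \<Psi> v (\<Phi> k)) = mat_app K (gram K \<Phi> \<Psi>) (coef K \<Psi> X) k"
proof -
  have "pairing K \<Psi> X (emb K \<Psi> v (\<Phi> k)) = (\<Sum>\<^sub>\<infinity>l\<in>K. coef K \<Psi> X l * cnj (analysis K \<Psi> (\<Phi> k) l))"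
    by (simp add: pairing_def emb_elem(3) [OF assms] gram_analysis_dual)
  also have "\<dots> = (\<Sum>\<^sub>\<infinity>l\<in>K. gram K \<Phi> \<Psi> k l * coef K \<Psi> X l)"
    by (rule infsum_cong)
       (use assms(3) in \<open>simp add: analysis_def gram_def mult.commute flip: cinner_commute\<close>)
  also have "\<dots> = mat_app K (gram K \<Phi> \<Psi>) (coef K \<Psi> X) k"
    using assms(3) by (simp add: mat_app_def)
  finally show ?thesis .
qed

lemma coorbit_analysis_eq:
  assumes "schur_space 1 (inv_weight w)" "gram K dual \<Phi> \<in> \<A>"
  shows "coorbit_analysis K \<Psi> w \<Phi> X = mat_app K (gram K \<Phi> \<Psi>) (coef K \<Psi> X)"
  using pairing_emb [OF assms] by (auto simp: coorbit_analysis_def mat_app_def fun_eq_iff)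

section \<open>Unconditional convergence of synthesis\<close>

text \<open>For convergence in norm, the error is a bounded matrix applied to the tail of
  \<open>c\<close>. In the weak-* case that tail need not become small; instead Fubini moves the
  matrix onto the test element and leaves an unconditionally convergent series in the entries of
  \<open>c\<close>.\<close>

lemma coorbit_sums_coef:
  assumes sp: "schur_space p w" and sp': "schur_space 1 (inv_weight w)" and G: "gram K dual \<Phi> \<in> \<A>"
    and c: "c \<in> lp_set K p w" and X: "X \<in> coorbit_inf K \<Psi> w"
    and coef: "coef K \<Psi> X = mat_app K (gram K dual \<Phi>) c"
  shows "coorbit_sums K \<Psi> p w (\<lambda>k. c k *\<^sub>C \<Phi> k) X"
proof -
  let ?G = "gram K dual \<Phi>" and ?s = "\<lambda>F. \<Sum>k\<in>F. c k *\<^sub>C \<Phi> k"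
  note w = schur_spaceD(2,3) [OF sp] and sG = schur_spaceD(4) [OF sp G] and bG = schur_spaceD(5) [OF sp G]
  have Xs: "X \<in> coorbit_set K \<Psi> p w"
    unfolding coorbit_set_iff [OF sp] coef using X mat_boundedD(2) [OF bG c] by blast
  have cl: "c \<in> linf_set K w"
    by (rule lp_subset_inf [OF w c])
  have tr: "trunc F c \<in> lp_set K p w" for F
    by (rule lp_trunc(1) [OF w c])
  have trl: "trunc F c \<in> linf_set K w" for F
    by (rule lp_subset_inf [OF w tr])
  have "((\<lambda>F. ns_norm (coorbit K \<Psi> p w) (ns_diff (coorbit K \<Psi> p w) (emb K \<Psi> w (?s F)) X)) \<longlongrightarrow> 0)
      (finite_subsets_at_top K)" if "p \<noteq> \<infinity>"
  proof -
    obtain C where C: "\<And>c. c \<in> lp_set K p w \<Longrightarrow> lp_norm K p w (mat_app K ?G c) \<le> C * lp_norm K p w c"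
      using mat_boundedD(3) [OF bG] by blast
    have diff: "(\<lambda>k. c k - trunc F c k) \<in> lp_set K p w" for F
      by (rule lp_diff [OF w c tr])
    have norm: "ns_norm (coorbit K \<Psi> p w) (ns_diff (coorbit K \<Psi> p w) (emb K \<Psi> w (?s F)) X)
        = lp_norm K p w (mat_app K ?G (\<lambda>k. c k - trunc F c k))" if F: "finite F" "F \<subseteq> K" for F
    proof -
      note emb = emb_sum [OF sp G F, of c]
      have e: "emb K \<Psi> w (?s F) \<in> coorbit_inf K \<Psi> w"
        using emb(1) by (simp add: coorbit_set_iff [OF sp])
      note sc = coorbit_scale [OF schur_spaceD(1) [OF sp] X, of "-1"]
      have "coef K \<Psi> (ns_diff (coorbit K \<Psi> p w) (emb K \<Psi> w (?s F)) X)
          = (\<lambda>k. mat_app K ?G (trunc F c) k + (-1) * mat_app K ?G c k)"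
        unfolding ns_diff_def coorbit_ns_add coorbit_ns_scale
        using coorbit_add(2) [OF schur_spaceD(1) [OF sp] e sc(1)] by (simp add: sc(2) emb(2) coef)
      also have "\<dots> = (\<lambda>k. (-1) * mat_app K ?G (\<lambda>k. c k - trunc F c k) k)"
        using mat_app_lin [OF w(1) sG cl trl, of 1 "-1" F] by simp
      finally show ?thesis
        using lp_scale(2) [OF w mat_boundedD(2) [OF bG diff], of "-1" F] by simp
    qed
    have "((\<lambda>F. lp_norm K p w (mat_app K ?G (\<lambda>k. c k - trunc F c k))) \<longlongrightarrow> 0) (finite_subsets_at_top K)"
    proof (rule Lim_null_comparison)
      show "\<forall>\<^sub>F F in finite_subsets_at_top K. norm (lp_norm K p w (mat_app K ?G (\<lambda>k. c k - trunc F c k)))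
          \<le> C * lp_norm K p w (\<lambda>k. c k - trunc F c k)"
        using C [OF diff] lp_norm_nonneg [OF w mat_boundedD(2) [OF bG diff]] by (intro always_eventually) simp
      show "((\<lambda>F. C * lp_norm K p w (\<lambda>k. c k - trunc F c k)) \<longlongrightarrow> 0) (finite_subsets_at_top K)"
        using that by (intro tendsto_mult_right_zero trunc_tendsto [OF w c]) simp
    qed
    then show ?thesis
      by (rule Lim_transform_eventually) (rule eventually_finite_subsets_at_top_weakI, rule norm [symmetric])
  qed
  moreover have "((\<lambda>F. pairing K \<Psi> (emb K \<Psi> w (?s F)) Y) \<longlongrightarrow> pairing K \<Psi> X Y) (finite_subsets_at_top K)"
    if Y: "Y \<in> coorbit_set K \<Psi> 1 (inv_weight w)" for Y
  proof -
    define b where "b j = cnj (mat_app K (gram K \<Psi> \<Psi>) (coef K \<Psi> Y) j)" for j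
    have "mat_app K (gram K \<Psi> \<Psi>) (coef K \<Psi> Y) \<in> lp_set K 1 (inv_weight w)"
      using Y mat_boundedD(2) [OF schur_spaceD(5) [OF sp' localized]] by (simp add: coorbit_set_iff [OF sp'])
    then have b: "(\<lambda>j. cmod (b j) / w j) summable_on K"
      unfolding lp_1_iff [OF schur_spaceD(2) [OF sp']] by (simp add: b_def inv_weight_def)
    have pair: "pairing K \<Psi> Z Y = (\<Sum>\<^sub>\<infinity>j\<in>K. b j * (\<Sum>\<^sub>\<infinity>l\<in>K. ?G j l * d l))"
      if "coef K \<Psi> Z = mat_app K ?G d" for Z d
      by (simp add: pairing_def that b_def mat_app_def mult.commute cong: infsum_cong)
    have "((\<lambda>F. \<Sum>l\<in>F. (\<Sum>\<^sub>\<infinity>j\<in>K. b j * ?G j l) * c l) \<longlongrightarrow> pairing K \<Psi> X Y) (finite_subsets_at_top K)"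
      using schur_fubini [OF w(1) sG cl b] unfolding has_sum_def pair [OF coef] .
    moreover have "(\<Sum>l\<in>F. (\<Sum>\<^sub>\<infinity>j\<in>K. b j * ?G j l) * c l) = pairing K \<Psi> (emb K \<Psi> w (?s F)) Y"
      if F: "finite F" "F \<subseteq> K" for F
    proof -
      have "((\<lambda>l. (\<Sum>\<^sub>\<infinity>j\<in>K. b j * ?G j l) * trunc F c l) has_sum (\<Sum>l\<in>F. (\<Sum>\<^sub>\<infinity>j\<in>K. b j * ?G j l) * c l)) K"
        by (rule has_sum_finite_neutralI [where B = F]) (use F in \<open>auto simp: trunc_def\<close>)
      from has_sum_unique [OF this schur_fubini [OF w(1) sG trl b]] show ?thesis
        by (simp add: pair [OF emb_sum(2) [OF sp G F]])
    qed
    ultimately show ?thesis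
      by (elim Lim_transform_eventually) (rule eventually_finite_subsets_at_top_weakI)
  qed
  ultimately show ?thesis
    unfolding coorbit_sums_def using Xs emb_sum(1) [OF sp G, of _ c] by simp
qed

text \<open>Either kind of limit determines every coefficient. The norm dominates coordinates; in
  the weak-* case the pairing with the k-th dual vector returns the k-th coefficient, as P fixes
  coefficient sequences. That dual vector is a legitimate test element because the Gram matrix of
  the dual lies in the algebra.\<close>

lemma coorbit_sums_unique:
  assumes sp: "schur_space p w" and sp': "schur_space 1 (inv_weight w)"
    and X: "coorbit_sums K \<Psi> p w x X" and Y: "coorbit_sums K \<Psi> p w x Y"
  shows "X = Y"
proof -
  note w = schur_spaceD(2,3) [OF sp] and sw = schur_spaceD(1) [OF sp] and iff = coorbit_set_iff [OF sp]
  have XY: "X \<in> coorbit_set K \<Psi> p w" "Y \<in> coorbit_set K \<Psi> p w"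
    using X Y by (auto simp: coorbit_sums_def)
  have "coef K \<Psi> X k = coef K \<Psi> Y k" if k: "k \<in> K" for k
  proof (cases "p = \<infinity>")
    case False
    have lim: "((\<lambda>F. coef K \<Psi> (emb K \<Psi> w (sum x F)) k) \<longlongrightarrow> coef K \<Psi> Z k) (finite_subsets_at_top K)"
      if Z: "coorbit_sums K \<Psi> p w x Z" for Z
    proof -
      let ?n = "\<lambda>F. ns_norm (coorbit K \<Psi> p w) (ns_diff (coorbit K \<Psi> p w) (emb K \<Psi> w (sum x F)) Z)"
      have n: "(?n \<longlongrightarrow> 0) (finite_subsets_at_top K)" and Zs: "Z \<in> coorbit_set K \<Psi> p w"
        and es: "\<And>F. finite F \<Longrightarrow> F \<subseteq> K \<Longrightarrow> emb K \<Psi> w (sum x F) \<in> coorbit_set K \<Psi> p w"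
        using Z False by (auto simp: coorbit_sums_def)
      have "((\<lambda>F. coef K \<Psi> (emb K \<Psi> w (sum x F)) k - coef K \<Psi> Z k) \<longlongrightarrow> 0) (finite_subsets_at_top K)"
      proof (rule Lim_null_comparison)
        show "((\<lambda>F. ?n F / w k) \<longlongrightarrow> 0) (finite_subsets_at_top K)"
          using tendsto_divide_zero [OF n] .
        show "\<forall>\<^sub>F F in finite_subsets_at_top K. norm (coef K \<Psi> (emb K \<Psi> w (sum x F)) k - coef K \<Psi> Z k) \<le> ?n F / w k"
        proof (rule eventually_finite_subsets_at_top_weakI)
          fix F assume F: "finite F" "F \<subseteq> K"
          have e: "emb K \<Psi> w (sum x F) \<in> coorbit_inf K \<Psi> w" "coef K \<Psi> (emb K \<Psi> w (sum x F)) \<in> lp_set K p w"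
            and z: "Z \<in> coorbit_inf K \<Psi> w" "coef K \<Psi> Z \<in> lp_set K p w"
            using es [OF F] Zs by (auto simp: iff)
          note sc = coorbit_scale [OF sw z(1), of "-1"]
          have "coef K \<Psi> (ns_diff (coorbit K \<Psi> p w) (emb K \<Psi> w (sum x F)) Z)
              = (\<lambda>k. coef K \<Psi> (emb K \<Psi> w (sum x F)) k - coef K \<Psi> Z k)"
            using coorbit_add(2) [OF sw e(1) sc(1)] by (simp add: ns_diff_def sc(2))
          then have "w k * cmod (coef K \<Psi> (emb K \<Psi> w (sum x F)) k - coef K \<Psi> Z k) \<le> ?n F"
            using lp_coordinate [OF w lp_diff [OF w e(2) z(2)] k] by simp
          then show "norm (coef K \<Psi> (emb K \<Psi> w (sum x F)) k - coef K \<Psi> Z k) \<le> ?n F / w k"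
            using w_pos [OF w(1) k] by (simp add: field_simps)
        qed
      qed
      then show ?thesis
        by (rule LIM_zero_cancel)
    qed
    show ?thesis
      by (rule tendsto_unique [OF finite_subsets_at_top_neq_bot lim [OF X] lim [OF Y]])
  next
    case True
    have G: "gram K dual dual \<in> \<A>"
      by (rule gram_dual_dual_alg)
    let ?Y = "emb K \<Psi> (inv_weight w) (dual k)"
    have mem: "?Y \<in> coorbit_set K \<Psi> 1 (inv_weight w)"
      by (rule emb_elem(1) [OF sp' G k])
    have eq: "pairing K \<Psi> Z ?Y = coef K \<Psi> Z k" if "Z \<in> coorbit_set K \<Psi> p w" for Z
      using that coef_range(2) [OF sw] by (simp add: pairing_emb [OF sp' G k] iff)
    have lim: "((\<lambda>F. pairing K \<Psi> (emb K \<Psi> w (sum x F)) ?Y) \<longlongrightarrow> pairing K \<Psi> Z ?Y) (finite_subsets_at_top K)"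
      if "coorbit_sums K \<Psi> p w x Z" for Z
      using that mem True by (simp add: coorbit_sums_def)
    have "pairing K \<Psi> X ?Y = pairing K \<Psi> Y ?Y"
      by (rule tendsto_unique [OF finite_subsets_at_top_neq_bot lim [OF X] lim [OF Y]])
    then show ?thesis
      using eq XY by simp
  qed
  then have "coef K \<Psi> X = coef K \<Psi> Y"
    by (auto simp: coef_def fun_eq_iff)
  with XY show ?thesis
    by (rule coorbit_inject [OF sp])
qed

text \<open>P leaves the cross-Gram matrix of the dual with \<Phi> unchanged from the left, so the
  image of \<open>c\<close> is fixed by P and is the coefficient sequence of some class.\<close>

lemma coorbit_sums_ex:
  assumes sp: "schur_space p w" and sp': "schur_space 1 (inv_weight w)" and G: "gram K dual \<Phi> \<in> \<A>"
    and c: "c \<in> lp_set K p w"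
  obtains X where "X \<in> coorbit_set K \<Psi> p w" "coef K \<Psi> X = mat_app K (gram K dual \<Phi>) c"
    "coorbit_sums K \<Psi> p w (\<lambda>k. c k *\<^sub>C \<Phi> k) X"
proof -
  note w = schur_spaceD(2,3) [OF sp]
  have "mat_app K proj (mat_app K (gram K dual \<Phi>) c) = mat_app K (gram K dual \<Phi>) c"
    using mat_app_mult [OF w(1) schur_spaceD(4) [OF sp proj_alg] schur_spaceD(4) [OF sp G] lp_subset_inf [OF w c]]
    by (simp add: proj_mult)
  then obtain X where X: "X \<in> coorbit_set K \<Psi> p w" "coef K \<Psi> X = mat_app K (gram K dual \<Phi>) c"
    using coef_surj_space [OF sp mat_boundedD(2) [OF schur_spaceD(5) [OF sp G] c]] by blast
  have "coorbit_sums K \<Psi> p w (\<lambda>k. c k *\<^sub>C \<Phi> k) X"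
    using X by (intro coorbit_sums_coef [OF sp sp' G c]) (auto simp: coorbit_set_iff [OF sp])
  with X show ?thesis
    by (rule that)
qed

lemma coorbit_sums_the:
  assumes "schur_space p w" "schur_space 1 (inv_weight w)" "coorbit_sums K \<Psi> p w x X"
  shows "(THE X. coorbit_sums K \<Psi> p w x X) = X"
proof (rule the_equality)
  show "coorbit_sums K \<Psi> p w x X" by fact
  show "Y = X" if "coorbit_sums K \<Psi> p w x Y" for Y
    by (rule coorbit_sums_unique [OF assms(1,2) that assms(3)])
qed

lemma coorbit_synthesis:
  assumes "schur_space p w" "schur_space 1 (inv_weight w)" "gram K dual \<Phi> \<in> \<A>" "c \<in> lp_set K p w"
  shows "coorbit_synthesis K \<Psi> p w \<Phi> c \<in> coorbit_set K \<Psi> p w"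
    "coef K \<Psi> (coorbit_synthesis K \<Psi> p w \<Phi> c) = mat_app K (gram K dual \<Phi>) c"
    "coorbit_sums K \<Psi> p w (\<lambda>k. c k *\<^sub>C \<Phi> k) (coorbit_synthesis K \<Psi> p w \<Phi> c)"
  using coorbit_sums_ex [OF assms] coorbit_sums_the [OF assms(1,2)]
  unfolding coorbit_synthesis_def by metis+

end

section \<open>Galerkin matrices\<close>

lemma mat_adj_gram: "mat_adj (gram K \<Phi> \<Psi>) = gram K \<Psi> \<Phi>"
  unfolding mat_adj_def gram_def by (auto simp: fun_eq_iff simp flip: cinner_commute)

context coorbit_frame
begin

section \<open>The weak-* topology\<close>

lemma pairing_weak_star_continuous:
  assumes "Y \<in> coorbit_set K \<Psi> 1 (inv_weight w)"
  shows "continuous_map (weak_star_topology K \<Psi> w) euclidean (\<lambda>X. pairing K \<Psi> X Y)"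
proof -
  have "continuous_map (weak_star_topology K \<Psi> w) euclidean
      ((\<lambda>h. h Y) \<circ> (\<lambda>X. restrict (pairing K \<Psi> X) (coorbit_set K \<Psi> 1 (inv_weight w))))"
    unfolding weak_star_topology_def
    by (rule continuous_map_pullback) (rule continuous_map_product_projection [OF assms])
  then show ?thesis
    using assms by (simp add: o_def)
qed

text \<open>Convergence in a product is componentwise and the components are the pairings; pulling
  back adds the membership of the partial sums in the carrier.\<close>

lemma weak_star_sums:
  assumes "coorbit_sums K \<Psi> \<infinity> w x X"
  shows "limitin (weak_star_topology K \<Psi> w) (\<lambda>F. emb K \<Psi> w (sum x F)) X (finite_subsets_at_top K)"
proof -
  define Z where "Z = coorbit_set K \<Psi> 1 (inv_weight w)"
  let ?P = "product_topology (\<lambda>_. euclidean) Z :: ('h coorb \<Rightarrow> complex) topology"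
  let ?f = "\<lambda>X. restrict (pairing K \<Psi> X) Z" and ?e = "\<lambda>F. emb K \<Psi> w (sum x F)"
  have X: "X \<in> coorbit_set K \<Psi> \<infinity> w"
    and e: "\<And>F. finite F \<Longrightarrow> F \<subseteq> K \<Longrightarrow> ?e F \<in> coorbit_set K \<Psi> \<infinity> w"
    and lim: "\<And>Y. Y \<in> Z \<Longrightarrow> ((\<lambda>F. pairing K \<Psi> (?e F) Y) \<longlongrightarrow> pairing K \<Psi> X Y) (finite_subsets_at_top K)"
    using assms by (auto simp: coorbit_sums_def Z_def)
  have top: "?f Y \<in> topspace ?P" for Y
    by simp
  have flim: "limitin ?P (\<lambda>F. ?f (?e F)) (?f X) (finite_subsets_at_top K)"
    unfolding limitin_componentwise using top lim by (auto intro!: always_eventually)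
  have ev: "\<forall>\<^sub>F F in finite_subsets_at_top K. ?e F \<in> coorbit_set K \<Psi> \<infinity> w"
    by (rule eventually_finite_subsets_at_top_weakI) (rule e)
  show ?thesis
    unfolding limitin_def weak_star_topology_def Z_def [symmetric]
  proof (intro conjI allI impI)
    show "X \<in> topspace (pullback_topology (coorbit_set K \<Psi> \<infinity> w) ?f ?P)"
      unfolding topspace_pullback_topology using X top by blast
    fix U assume U: "openin (pullback_topology (coorbit_set K \<Psi> \<infinity> w) ?f ?P) U \<and> X \<in> U"
    then obtain V where V: "openin ?P V" "U = ?f -` V \<inter> coorbit_set K \<Psi> \<infinity> w"
      unfolding openin_pullback_topology by blast
    then have "\<forall>\<^sub>F F in finite_subsets_at_top K. ?f (?e F) \<in> V"
      using flim U unfolding limitin_def by blast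
    with ev show "\<forall>\<^sub>F F in finite_subsets_at_top K. ?e F \<in> U"
      unfolding V(2) by eventually_elim simp
  qed
qed

lemma coorbit_add_set:
  assumes sp: "schur_space p w" and "X \<in> coorbit_set K \<Psi> p w" "Y \<in> coorbit_set K \<Psi> p w"
  shows "coorbit_add K \<Psi> w X Y \<in> coorbit_set K \<Psi> p w"
  using assms(2,3) coorbit_add [OF schur_spaceD(1) [OF sp]] lp_lincomb [OF schur_spaceD(2,3) [OF sp], of _ _ 1 1]
  by (simp add: coorbit_set_iff [OF sp])

end

section \<open>From operators to matrices and back\<close>

locale galerkin_setting = coorbit_frame K \<Psi> A B \<A> N
  for K :: "'i set" and \<Psi> :: "'i \<Rightarrow> 'h::complex_hilbert" and A B \<A> N +
  fixes \<Phi> \<Xi> :: "'i \<Rightarrow> 'h" and w1 w2 :: "'i \<Rightarrow> real" and p1 p2 :: ereal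
  assumes s1: "schur_space p1 w1" and s1': "schur_space 1 (inv_weight w1)"
    and s2: "schur_space p2 w2" and s2': "schur_space 1 (inv_weight w2)"
    and \<Phi>\<Psi>: "gram K \<Phi> \<Psi> \<in> \<A>" and \<Xi>\<Psi>: "gram K \<Xi> \<Psi> \<in> \<A>"
    and exponents: "(1 \<le> p1 \<and> 1 \<le> p2) \<or> (p1 = 0 \<and> p2 = 0)"
begin

text \<open>Localization is assumed with \<Psi> on the right; adjoints put \<Psi> on the left, where
  it can be replaced by its dual.\<close>

lemma dual_\<Phi>: "gram K dual \<Phi> \<in> \<A>" and dual_\<Xi>: "gram K dual \<Xi> \<in> \<A>"
  using alg_adj [OF \<Phi>\<Psi>] alg_adj [OF \<Xi>\<Psi>] by (simp_all add: mat_adj_gram gram_dual_alg)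

lemmas w1 = schur_spaceD(2,3) [OF s1]
lemmas w2 = schur_spaceD(2,3) [OF s2]

abbreviation H1 where "H1 \<equiv> coorbit K \<Psi> p1 w1"
abbreviation H2 where "H2 \<equiv> coorbit K \<Psi> p2 w2"
abbreviation D where "D \<equiv> coorbit_synthesis K \<Psi> p1 w1 \<Xi>"

lemmas D_set = coorbit_synthesis(1) [OF s1 s1' dual_\<Xi>]
lemmas coef_D = coorbit_synthesis(2) [OF s1 s1' dual_\<Xi>]
lemmas D_sums = coorbit_synthesis(3) [OF s1 s1' dual_\<Xi>]

text \<open>Written in coefficients, the operator on sequences is \<open>T\<close> between two Gram
  matrices, which accounts for the three factors of the bound. On unit sequences it gives the
  Galerkin entries, because synthesis of a unit sequence is the embedded frame vector.\<close>

lemma galerkin_operator: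
  assumes T: "bounded_op H1 H2 T"
  shows "mat_bounded K p1 w1 p2 w2 (galerkin K \<Psi> w1 w2 \<Phi> \<Xi> T)"
    and "op_norm (lp K p1 w1) (lp K p2 w2) (mat_app K (galerkin K \<Psi> w1 w2 \<Phi> \<Xi> T))
          \<le> op_norm (lp K p2 w2) (lp K p2 w2) (mat_app K (gram K \<Phi> \<Psi>))
            * op_norm (lp K p1 w1) (lp K p1 w1) (mat_app K (gram K dual \<Xi>)) * op_norm H1 H2 T"
    and "c \<in> lp_set K p1 w1 \<Longrightarrow> p1 \<noteq> \<infinity> \<or> c \<in> lp_set K 0 w1 \<or>
        continuous_map (weak_star_topology K \<Psi> w1) (weak_star_topology K \<Psi> w2) T \<Longrightarrow>
      mat_app K (galerkin K \<Psi> w1 w2 \<Phi> \<Xi> T) c = coorbit_analysis K \<Psi> w2 \<Phi> (T (D c))"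
proof -
  let ?G = "gram K \<Phi> \<Psi>" and ?H = "gram K dual \<Xi>" and ?M = "galerkin K \<Psi> w1 w2 \<Phi> \<Xi> T"
  define U where "U c = mat_app K ?G (coef K \<Psi> (T (D c)))" for c
  define nG where "nG = op_norm (lp K p2 w2) (lp K p2 w2) (mat_app K ?G)"
  define nH where "nH = op_norm (lp K p1 w1) (lp K p1 w1) (mat_app K ?H)"
  define nT where "nT = op_norm H1 H2 T"
  note G = schur_spaceD(4,5) [OF s2 \<Phi>\<Psi>] and H = schur_spaceD(4,5) [OF s1 dual_\<Xi>]
  note nGH = mat_op_norm_nonneg [OF G(2) w2 w2, folded nG_def] mat_op_norm_bound [OF G(2) w2 w2, folded nG_def]
    mat_op_norm_nonneg [OF H(2) w1 w1, folded nH_def] mat_op_norm_bound [OF H(2) w1 w1, folded nH_def]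
  have nT: "0 \<le> nT" "\<And>X. X \<in> coorbit_set K \<Psi> p1 w1 \<Longrightarrow>
      lp_norm K p2 w2 (coef K \<Psi> (T X)) \<le> nT * lp_norm K p1 w1 (coef K \<Psi> X)"
    using op_norm_nonneg [OF T homogeneous_coorbit [OF s1] homogeneous_coorbit [OF s2]]
      op_norm_bound [OF T homogeneous_coorbit [OF s1] homogeneous_coorbit [OF s2]]
    by (simp_all add: nT_def)
  have T_set: "T X \<in> coorbit_set K \<Psi> p2 w2" if "X \<in> coorbit_set K \<Psi> p1 w1" for X
    using T that by (simp add: bounded_op_def)
  have T_coef: "coef K \<Psi> (T X) \<in> lp_set K p2 w2" if "X \<in> coorbit_set K \<Psi> p1 w1" for X
    using T_set [OF that] by (simp add: coorbit_set_iff [OF s2])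
  have T_lin: "T (coorbit_add K \<Psi> w1 (coorbit_scale K \<Psi> w1 a X) (coorbit_scale K \<Psi> w1 b Y))
      = coorbit_add K \<Psi> w2 (coorbit_scale K \<Psi> w2 a (T X)) (coorbit_scale K \<Psi> w2 b (T Y))"
    if "X \<in> coorbit_set K \<Psi> p1 w1" "Y \<in> coorbit_set K \<Psi> p1 w1" for a b X Y
    using T that coorbit_scale_set [OF s1] by (simp add: bounded_op_def)
  interpret U: sequence_operator K p1 p2 w1 w2 U "nG * nH * nT" ?M
  proof
    fix c assume c: "c \<in> lp_set K p1 w1"
    show "U c \<in> lp_set K p2 w2"
      unfolding U_def by (rule mat_boundedD(2) [OF G(2) T_coef [OF D_set [OF c]]])
    have "lp_norm K p2 w2 (U c) \<le> nG * lp_norm K p2 w2 (coef K \<Psi> (T (D c)))"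
      unfolding U_def by (rule nGH(2) [OF T_coef [OF D_set [OF c]]])
    also have "\<dots> \<le> nG * (nT * lp_norm K p1 w1 (mat_app K ?H c))"
      using nT(2) [OF D_set [OF c]] unfolding coef_D [OF c] by (rule mult_left_mono) (rule nGH(1))
    also have "\<dots> \<le> nG * (nT * (nH * lp_norm K p1 w1 c))"
      by (intro mult_left_mono nGH(1,4) nT(1) c)
    finally show "lp_norm K p2 w2 (U c) \<le> nG * nH * nT * lp_norm K p1 w1 c"
      by (simp add: mult_ac)
  next
    fix a b c d assume c: "c \<in> lp_set K p1 w1" and d: "d \<in> lp_set K p1 w1"
    note cd = lp_lincomb [OF w1 c d]
    note lin = coorbit_lincomb [OF s1 D_set [OF c] D_set [OF d], of a b]
      coorbit_lincomb [OF s2 T_set [OF D_set [OF c]] T_set [OF D_set [OF d]], of a b]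
    have "D (\<lambda>k. a * c k + b * d k)
        = coorbit_add K \<Psi> w1 (coorbit_scale K \<Psi> w1 a (D c)) (coorbit_scale K \<Psi> w1 b (D d))"
      by (rule coorbit_inject [OF s1 D_set [OF cd] lin(1)])
         (simp add: lin(2) coef_D c d cd mat_app_lin [OF w1(1) H(1) lp_subset_inf [OF w1 c] lp_subset_inf [OF w1 d]])
    then show "U (\<lambda>k. a * c k + b * d k) = (\<lambda>k. a * U c k + b * U d k)"
      unfolding U_def using T_coef [OF D_set [OF c]] T_coef [OF D_set [OF d]]
      by (simp add: T_lin [OF D_set [OF c] D_set [OF d]] lin(4) mat_app_lin [OF w2(1) G(1)] lp_subset_inf [OF w2])
  next
    fix k l assume kl: "k \<in> K" "l \<in> K"
    have u: "unit_seq l \<in> lp_set K p1 w1"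
      using kl by (intro fin_seqs_lp [OF w1]) (auto simp: fin_seqs_def seqs_def unit_seq_def)
    have "D (unit_seq l) = emb K \<Psi> w1 (\<Xi> l)"
      using emb_elem(1,2) [OF s1 dual_\<Xi> kl(2)] by (intro coorbit_inject [OF s1 D_set [OF u]]) (simp_all add: coef_D [OF u])
    then show "?M k l = U (unit_seq l) k"
      using kl by (simp add: galerkin_def U_def pairing_emb [OF s2' dual_\<Phi> kl(1)])
  qed (use w1 w2 nGH nT in auto)
  have p: "p1 = \<infinity> \<Longrightarrow> 1 \<le> p2"
    using exponents by auto
  show "mat_bounded K p1 w1 p2 w2 ?M"
    by (rule U.mat_bounded_M [OF p])
  show "op_norm (lp K p1 w1) (lp K p2 w2) (mat_app K ?M)
      \<le> op_norm (lp K p2 w2) (lp K p2 w2) (mat_app K ?G)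
        * op_norm (lp K p1 w1) (lp K p1 w1) (mat_app K ?H) * op_norm H1 H2 T"
    using U.op_norm_M [OF p] unfolding nG_def nH_def nT_def .
  assume c: "c \<in> lp_set K p1 w1"
    and cases: "p1 \<noteq> \<infinity> \<or> c \<in> lp_set K 0 w1 \<or>
      continuous_map (weak_star_topology K \<Psi> w1) (weak_star_topology K \<Psi> w2) T"
  have "mat_app K ?M c = U c"
  proof (cases "p1 \<noteq> \<infinity> \<or> c \<in> lp_set K 0 w1")
    case True
    then show ?thesis
      by (rule U.mat_app_eq_U [OF c])
  next
    case False
    then have inf: "p1 = \<infinity>"
      and cont: "continuous_map (weak_star_topology K \<Psi> w1) (weak_star_topology K \<Psi> w2) T"
      using cases by auto
    show ?thesis
    proof (rule seqs_eqI [OF mat_app_seqs lp_set_seqs [OF U.U_mem [OF c]]])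
      fix k assume k: "k \<in> K"
      let ?Y = "emb K \<Psi> (inv_weight w2) (\<Phi> k)" and ?e = "\<lambda>F. emb K \<Psi> w1 (\<Sum>l\<in>F. c l *\<^sub>C \<Xi> l)"
      have pair: "pairing K \<Psi> X ?Y = mat_app K ?G (coef K \<Psi> X) k" for X
        by (rule pairing_emb [OF s2' dual_\<Phi> k])
      \<comment> \<open>Synthesis converges weak-*, \<open>T\<close> preserves this, and pairing
        with \<open>\<Phi> k\<close> is weak-* continuous. The images of the finite syntheses thus
        converge to entry \<open>k\<close>, and they are the partial sums of row
        \<open>k\<close>.\<close>
      have "continuous_map (weak_star_topology K \<Psi> w1) euclidean ((\<lambda>X. pairing K \<Psi> X ?Y) \<circ> T)"
        using cont pairing_weak_star_continuous [OF emb_elem(1) [OF s2' dual_\<Phi> k]]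
        by (rule continuous_map_compose)
      from continuous_map_limit [OF this weak_star_sums [OF D_sums [OF c, unfolded inf]]]
      have lim: "((\<lambda>F. pairing K \<Psi> (T (?e F)) ?Y) \<longlongrightarrow> U c k) (finite_subsets_at_top K)"
        by (simp add: o_def pair U_def inf)
      have "pairing K \<Psi> (T (?e F)) ?Y = (\<Sum>l\<in>F. ?M k l * c l)" if F: "finite F" "F \<subseteq> K" for F
      proof -
        have tr: "trunc F c \<in> lp_set K p1 w1"
          by (rule lp_trunc(1) [OF w1 c])
        have "?e F = D (trunc F c)"
          using emb_sum [OF s1 dual_\<Xi> F, of c] by (intro coorbit_inject [OF s1 _ D_set [OF tr]]) (simp_all add: coef_D [OF tr])
        then show ?thesis
          using U.U_trunc [OF F k, of c] by (simp add: pair U_def)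
      qed
      then have "((\<lambda>F. \<Sum>l\<in>F. ?M k l * c l) \<longlongrightarrow> U c k) (finite_subsets_at_top K)"
        by (intro Lim_transform_eventually [OF lim] eventually_finite_subsets_at_top_weakI)
      then have "((\<lambda>l. ?M k l * c l) has_sum U c k) K"
        unfolding has_sum_def .
      then show "mat_app K ?M c k = U c k"
        using k by (simp add: mat_app_def infsumI)
    qed
  qed
  also have "U c = coorbit_analysis K \<Psi> w2 \<Phi> (T (D c))"
    by (simp add: U_def coorbit_analysis_eq [OF s2' dual_\<Phi>])
  finally show "mat_app K ?M c = coorbit_analysis K \<Psi> w2 \<Phi> (T (D c))" .
qed

text \<open>\<open>mat_bounded\<close> includes convergence of each row against every sequence of
  the domain, so the composition with analysis and synthesis is meaningful on the whole space, also
  for \<open>p1 = \<infinity>\<close>.\<close>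

lemma matrix_operator:
  assumes M: "mat_bounded K p1 w1 p2 w2 M"
  shows "X \<in> coorbit_set K \<Psi> p1 w1 \<Longrightarrow>
      coorbit_sums K \<Psi> p2 w2 (matrix_op_terms K \<Psi> w1 \<Phi> \<Xi> M X) (matrix_op K \<Psi> w1 p2 w2 \<Phi> \<Xi> M X)"
    and "bounded_op H1 H2 (matrix_op K \<Psi> w1 p2 w2 \<Phi> \<Xi> M)"
    and "X \<in> coorbit_set K \<Psi> p1 w1 \<Longrightarrow> matrix_op K \<Psi> w1 p2 w2 \<Phi> \<Xi> M X
       = coorbit_synthesis K \<Psi> p2 w2 \<Phi> (mat_app K M (coorbit_analysis K \<Psi> w1 \<Xi> X))"
    and "op_norm H1 H2 (matrix_op K \<Psi> w1 p2 w2 \<Phi> \<Xi> M)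
          \<le> op_norm (lp K p2 w2) (lp K p2 w2) (mat_app K (gram K dual \<Phi>))
            * op_norm (lp K p1 w1) (lp K p1 w1) (mat_app K (gram K \<Xi> \<Psi>))
            * op_norm (lp K p1 w1) (lp K p2 w2) (mat_app K M)"
proof -
  let ?G = "gram K dual \<Phi>" and ?H = "gram K \<Xi> \<Psi>" and ?W = "matrix_op K \<Psi> w1 p2 w2 \<Phi> \<Xi> M"
  define nG where "nG = op_norm (lp K p2 w2) (lp K p2 w2) (mat_app K ?G)"
  define nH where "nH = op_norm (lp K p1 w1) (lp K p1 w1) (mat_app K ?H)"
  define nM where "nM = op_norm (lp K p1 w1) (lp K p2 w2) (mat_app K M)"
  note G = schur_spaceD(4,5) [OF s2 dual_\<Phi>] and H = schur_spaceD(4,5) [OF s1 \<Xi>\<Psi>]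
  note nG = mat_op_norm_nonneg [OF G(2) w2 w2, folded nG_def] mat_op_norm_bound [OF G(2) w2 w2, folded nG_def]
    and nH = mat_op_norm_nonneg [OF H(2) w1 w1, folded nH_def] mat_op_norm_bound [OF H(2) w1 w1, folded nH_def]
    and nM = mat_op_norm_nonneg [OF M w1 w2, folded nM_def] mat_op_norm_bound [OF M w1 w2, folded nM_def]
  \<comment> \<open>\<open>M\<close> may lie outside the algebra and carry no Schur bound, so its
    linearity is read off from \<open>bounded_op\<close>; \<open>mat_app_lin\<close> serves for the
    two Gram matrices.\<close>
  have M_add: "mat_app K M (\<lambda>k. c k + d k) = (\<lambda>k. mat_app K M c k + mat_app K M d k)"
    if "c \<in> lp_set K p1 w1" "d \<in> lp_set K p1 w1" for c d
    using M that by (simp add: mat_bounded_def bounded_op_def lp_def)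
  have M_scale: "mat_app K M (\<lambda>k. a * c k) = (\<lambda>k. a * mat_app K M c k)" if "c \<in> lp_set K p1 w1" for a c
    using M that by (simp add: mat_bounded_def bounded_op_def lp_def)
  define V where "V X = mat_app K ?H (coef K \<Psi> X)" for X
  have coef_lp: "coef K \<Psi> X \<in> lp_set K p1 w1" if "X \<in> coorbit_set K \<Psi> p1 w1" for X
    using that by (simp add: coorbit_set_iff [OF s1])
  have coef_inf: "coef K \<Psi> X \<in> linf_set K w1" if "X \<in> coorbit_set K \<Psi> p1 w1" for X
    by (rule lp_subset_inf [OF w1 coef_lp [OF that]])
  have V: "V X \<in> lp_set K p1 w1" if "X \<in> coorbit_set K \<Psi> p1 w1" for X
    unfolding V_def by (rule mat_boundedD(2) [OF H(2) coef_lp [OF that]])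
  have MV: "mat_app K M (V X) \<in> lp_set K p2 w2" if "X \<in> coorbit_set K \<Psi> p1 w1" for X
    by (rule mat_boundedD(2) [OF M V [OF that]])
  have analysis: "coorbit_analysis K \<Psi> w1 \<Xi> X = V X" for X
    unfolding V_def by (rule coorbit_analysis_eq [OF s1' dual_\<Xi>])
  have terms: "matrix_op_terms K \<Psi> w1 \<Phi> \<Xi> M X k = mat_app K M (V X) k *\<^sub>C \<Phi> k" if "k \<in> K" for X k
    using that by (simp add: matrix_op_terms_def mat_app_def V_def pairing_emb [OF s1' dual_\<Xi>] cong: infsum_cong)
  have sums: "coorbit_sums K \<Psi> p2 w2 (matrix_op_terms K \<Psi> w1 \<Phi> \<Xi> M X) Y
      \<longleftrightarrow> coorbit_sums K \<Psi> p2 w2 (\<lambda>k. mat_app K M (V X) k *\<^sub>C \<Phi> k) Y" for X Y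
    by (rule coorbit_sums_cong) (rule terms)
  have W: "?W X = coorbit_synthesis K \<Psi> p2 w2 \<Phi> (mat_app K M (V X))" for X
    unfolding matrix_op_def coorbit_synthesis_def sums ..
  then show "X \<in> coorbit_set K \<Psi> p1 w1 \<Longrightarrow> ?W X
       = coorbit_synthesis K \<Psi> p2 w2 \<Phi> (mat_app K M (coorbit_analysis K \<Psi> w1 \<Xi> X))"
    by (simp add: analysis)
  show "X \<in> coorbit_set K \<Psi> p1 w1 \<Longrightarrow>
      coorbit_sums K \<Psi> p2 w2 (matrix_op_terms K \<Psi> w1 \<Phi> \<Xi> M X) (?W X)"
    unfolding sums W by (rule coorbit_synthesis(3) [OF s2 s2' dual_\<Phi> MV])
  have W_set: "?W X \<in> coorbit_set K \<Psi> p2 w2" and W_coef: "coef K \<Psi> (?W X) = mat_app K ?G (mat_app K M (V X))"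
    if "X \<in> coorbit_set K \<Psi> p1 w1" for X
    unfolding W by (rule coorbit_synthesis [OF s2 s2' dual_\<Phi> MV [OF that]])+
  have MV_inf: "mat_app K M (V X) \<in> linf_set K w2" if "X \<in> coorbit_set K \<Psi> p1 w1" for X
    by (rule lp_subset_inf [OF w2 MV [OF that]])
  have bound: "lp_norm K p2 w2 (coef K \<Psi> (?W X)) \<le> (nG * nH * nM) * lp_norm K p1 w1 (coef K \<Psi> X)"
    if X: "X \<in> coorbit_set K \<Psi> p1 w1" for X
  proof -
    have "lp_norm K p2 w2 (coef K \<Psi> (?W X)) \<le> nG * lp_norm K p2 w2 (mat_app K M (V X))"
      unfolding W_coef [OF X] by (rule nG(2) [OF MV [OF X]])
    also have "\<dots> \<le> nG * (nM * lp_norm K p1 w1 (V X))"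
      by (intro mult_left_mono nM(2) V [OF X] nG(1))
    also have "\<dots> \<le> nG * (nM * (nH * lp_norm K p1 w1 (coef K \<Psi> X)))"
      unfolding V_def by (intro mult_left_mono nH(2) coef_lp [OF X] nG(1) nM(1))
    finally show ?thesis
      by (simp add: mult_ac)
  qed
  show "bounded_op H1 H2 ?W"
    unfolding bounded_op_def coorbit_carrier coorbit_ns_add coorbit_ns_scale coorbit_ns_norm
  proof (intro conjI ballI allI)
    fix X Y assume X: "X \<in> coorbit_set K \<Psi> p1 w1" and Y: "Y \<in> coorbit_set K \<Psi> p1 w1"
    note XY = coorbit_add_set [OF s1 X Y]
    have "coef K \<Psi> (coorbit_add K \<Psi> w1 X Y) = (\<lambda>k. coef K \<Psi> X k + coef K \<Psi> Y k)"
      using X Y by (intro coorbit_add(2) [OF schur_spaceD(1) [OF s1]]) (simp_all add: coorbit_set_iff [OF s1])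
    then have "V (coorbit_add K \<Psi> w1 X Y) = (\<lambda>k. V X k + V Y k)"
      using mat_app_lin [OF w1(1) H(1) coef_inf [OF X] coef_inf [OF Y], of 1 1] by (simp add: V_def)
    then have MVXY: "mat_app K M (V (coorbit_add K \<Psi> w1 X Y)) = (\<lambda>k. mat_app K M (V X) k + mat_app K M (V Y) k)"
      using M_add [OF V [OF X] V [OF Y]] by simp
    have "coef K \<Psi> (coorbit_add K \<Psi> w2 (?W X) (?W Y)) = (\<lambda>k. coef K \<Psi> (?W X) k + coef K \<Psi> (?W Y) k)"
      using W_set [OF X] W_set [OF Y]
      by (intro coorbit_add(2) [OF schur_spaceD(1) [OF s2]]) (simp_all add: coorbit_set_iff [OF s2])
    then have "coef K \<Psi> (?W (coorbit_add K \<Psi> w1 X Y)) = coef K \<Psi> (coorbit_add K \<Psi> w2 (?W X) (?W Y))"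
      using mat_app_lin [OF w2(1) G(1) MV_inf [OF X] MV_inf [OF Y], of 1 1]
      by (simp add: W_coef [OF XY] W_coef [OF X] W_coef [OF Y] MVXY)
    then show "?W (coorbit_add K \<Psi> w1 X Y) = coorbit_add K \<Psi> w2 (?W X) (?W Y)"
      by (rule coorbit_inject [OF s2 W_set [OF XY] coorbit_add_set [OF s2 W_set [OF X] W_set [OF Y]]])
  next
    fix a X assume X: "X \<in> coorbit_set K \<Psi> p1 w1"
    note aX = coorbit_scale_set [OF s1 X, of a]
    have "coef K \<Psi> (coorbit_scale K \<Psi> w1 a X) = (\<lambda>k. a * coef K \<Psi> X k)"
      using X by (intro coorbit_scale(2) [OF schur_spaceD(1) [OF s1]]) (simp add: coorbit_set_iff [OF s1])
    then have "V (coorbit_scale K \<Psi> w1 a X) = (\<lambda>k. a * V X k)"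
      using mat_app_lin [OF w1(1) H(1) coef_inf [OF X] coef_inf [OF X], of a 0] by (simp add: V_def)
    then have MVX: "mat_app K M (V (coorbit_scale K \<Psi> w1 a X)) = (\<lambda>k. a * mat_app K M (V X) k)"
      using M_scale [OF V [OF X]] by simp
    have "coef K \<Psi> (coorbit_scale K \<Psi> w2 a (?W X)) = (\<lambda>k. a * coef K \<Psi> (?W X) k)"
      using W_set [OF X] by (intro coorbit_scale(2) [OF schur_spaceD(1) [OF s2]]) (simp add: coorbit_set_iff [OF s2])
    then have "coef K \<Psi> (?W (coorbit_scale K \<Psi> w1 a X)) = coef K \<Psi> (coorbit_scale K \<Psi> w2 a (?W X))"
      using mat_app_lin [OF w2(1) G(1) MV_inf [OF X] MV_inf [OF X], of a 0]
      by (simp add: W_coef [OF aX] W_coef [OF X] MVX)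
    then show "?W (coorbit_scale K \<Psi> w1 a X) = coorbit_scale K \<Psi> w2 a (?W X)"
      by (rule coorbit_inject [OF s2 W_set [OF aX] coorbit_scale_set [OF s2 W_set [OF X]]])
  next
    show "\<exists>C. \<forall>X\<in>coorbit_set K \<Psi> p1 w1. lp_norm K p2 w2 (coef K \<Psi> (?W X)) \<le> C * lp_norm K p1 w1 (coef K \<Psi> X)"
      using bound by blast
  qed (rule W_set)
  have "op_norm H1 H2 ?W \<le> nG * nH * nM"
    by (rule op_norm_le [OF homogeneous_coorbit [OF s1]]) (use nG nH nM bound in simp_all)
  then show "op_norm H1 H2 ?W \<le> op_norm (lp K p2 w2) (lp K p2 w2) (mat_app K ?G)
      * op_norm (lp K p1 w1) (lp K p1 w1) (mat_app K ?H) * op_norm (lp K p1 w1) (lp K p2 w2) (mat_app K M)"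
    unfolding nG_def nH_def nM_def .
qed

end

theorem theorem5:
  fixes K :: "(real ^ 'd) set"
    and \<A> :: "(real ^ 'd) mat set" and N :: "(real ^ 'd) mat \<Rightarrow> real"
    and \<Phi> \<Psi> \<Xi> :: "real ^ 'd \<Rightarrow> 'h::complex_hilbert"
    and w1 w2 :: "real ^ 'd \<Rightarrow> real"
    and p1 p2 :: ereal
  assumes "separable_type TYPE('h)"
    and "countable K" and "separated K"
    and "solid_spectral_algebra K \<A> N"
    and "frame K \<Phi>" and "frame K \<Psi>" and "frame K \<Xi>"
    and "localized K \<A> \<Phi>" and "localized K \<A> \<Psi>" and "localized K \<A> \<Xi>"
    and "localized_wrt K \<A> \<Phi> \<Psi>" and "localized_wrt K \<A> \<Xi> \<Psi>"
    and "admissible K \<A> w1" and "admissible K \<A> w2"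
    and "(1 \<le> p1 \<and> 1 \<le> p2) \<or> (p1 = 0 \<and> p2 = 0)"
  shows
    "(\<forall>T. bounded_op (coorbit K \<Psi> p1 w1) (coorbit K \<Psi> p2 w2) T \<longrightarrow>
        mat_bounded K p1 w1 p2 w2 (galerkin K \<Psi> w1 w2 \<Phi> \<Xi> T) \<and>
        op_norm (lp K p1 w1) (lp K p2 w2) (mat_app K (galerkin K \<Psi> w1 w2 \<Phi> \<Xi> T))
          \<le> op_norm (lp K p2 w2) (lp K p2 w2) (mat_app K (gram K \<Phi> \<Psi>))
            * op_norm (lp K p1 w1) (lp K p1 w1) (mat_app K (gram K (dual_frame K \<Psi>) \<Xi>))
            * op_norm (coorbit K \<Psi> p1 w1) (coorbit K \<Psi> p2 w2) T \<and>
        (\<forall>c\<in>lp_set K p1 w1.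
           p1 \<noteq> \<infinity> \<or> c \<in> lp_set K 0 w1 \<or>
           continuous_map (weak_star_topology K \<Psi> w1) (weak_star_topology K \<Psi> w2) T \<longrightarrow>
           mat_app K (galerkin K \<Psi> w1 w2 \<Phi> \<Xi> T) c
             = coorbit_analysis K \<Psi> w2 \<Phi> (T (coorbit_synthesis K \<Psi> p1 w1 \<Xi> c)))) \<and>
     (\<forall>M. mat_bounded K p1 w1 p2 w2 M \<longrightarrow>
        (\<forall>X\<in>coorbit_set K \<Psi> p1 w1.
           coorbit_sums K \<Psi> p2 w2 (matrix_op_terms K \<Psi> w1 \<Phi> \<Xi> M X)
             (matrix_op K \<Psi> w1 p2 w2 \<Phi> \<Xi> M X)) \<and>
        bounded_op (coorbit K \<Psi> p1 w1) (coorbit K \<Psi> p2 w2) (matrix_op K \<Psi> w1 p2 w2 \<Phi> \<Xi> M) \<and>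
        (\<forall>X\<in>coorbit_set K \<Psi> p1 w1.
           matrix_op K \<Psi> w1 p2 w2 \<Phi> \<Xi> M X
             = coorbit_synthesis K \<Psi> p2 w2 \<Phi> (mat_app K M (coorbit_analysis K \<Psi> w1 \<Xi> X))) \<and>
        op_norm (coorbit K \<Psi> p1 w1) (coorbit K \<Psi> p2 w2) (matrix_op K \<Psi> w1 p2 w2 \<Phi> \<Xi> M)
          \<le> op_norm (lp K p2 w2) (lp K p2 w2) (mat_app K (gram K (dual_frame K \<Psi>) \<Phi>))
            * op_norm (lp K p1 w1) (lp K p1 w1) (mat_app K (gram K \<Xi> \<Psi>))
            * op_norm (lp K p1 w1) (lp K p2 w2) (mat_app K M))"
proof -
  obtain A B where "0 < A" and frame: "\<And>f. (\<lambda>k. (cmod (cinner f (\<Psi> k)))\<^sup>2) summable_on K"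
    "\<And>f. A * (norm f)\<^sup>2 \<le> (\<Sum>\<^sub>\<infinity>k\<in>K. (cmod (cinner f (\<Psi> k)))\<^sup>2)"
    "\<And>f. (\<Sum>\<^sub>\<infinity>k\<in>K. (cmod (cinner f (\<Psi> k)))\<^sup>2) \<le> B * (norm f)\<^sup>2"
    using \<open>frame K \<Psi>\<close> unfolding frame_def by blast
  \<comment> \<open>On the trivial Hilbert space any two positive numbers are frame bounds, so
    \<open>A \<le> B\<close> is arranged by enlarging the upper one.\<close>
  interpret coorbit_frame K \<Psi> A "max A B" \<A> N
  proof
    show "(\<Sum>\<^sub>\<infinity>k\<in>K. (cmod (cinner f (\<Psi> k)))\<^sup>2) \<le> max A B * (norm f)\<^sup>2" for f
      by (rule order_trans [OF frame(3)]) (simp add: mult_right_mono)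
    show "gram K \<Psi> \<Psi> \<in> \<A>"
      using \<open>localized K \<A> \<Psi>\<close> by (simp add: localized_def localized_wrt_def)
  qed (use \<open>0 < A\<close> frame assms in auto)
  have p: "p1 = 0 \<or> 1 \<le> p1" "p2 = 0 \<or> 1 \<le> p2"
    using assms(15) by auto
  interpret galerkin_setting K \<Psi> A "max A B" \<A> N \<Phi> \<Xi> w1 w2 p1 p2
  proof
    show "schur_space p1 w1" "schur_space p2 w2"
      using p \<open>admissible K \<A> w1\<close> \<open>admissible K \<A> w2\<close> by (auto intro: admissible_schur_space)
    show "schur_space 1 (inv_weight w1)" "schur_space 1 (inv_weight w2)"
      using \<open>admissible K \<A> w1\<close> \<open>admissible K \<A> w2\<close> by (auto intro: admissible_schur_space_inv)
  qed (use assms in \<open>auto simp: localized_wrt_def\<close>)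
  show ?thesis
    using galerkin_operator matrix_operator by (intro conjI allI impI ballI) auto
qed

end
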